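(* Let $\mathbb L$ be a finite or countably infinite set. Suppose $u_k=\beta(e_k)\in\mathbb Z^n$, $k\in\mathbb L$, are primitive and span $\mathbb R^n$. Let $\lambda_k\in\mathrm{Im}\,\mathbb H$, $k\in\mathbb L$, be given such that $$\sum_{k\in\mathbb L}\bigl(1+|\lambda_k|/\|u_k\|\bigr)^{-1}<\infty$$ and such that the flats $H_k=\{a\in\mathrm{Im}\,\mathbb H\otimes(\mathbb R^n)^*: a(u_k)=\lambda_k\}$, $k\in\mathbb L$, are distinct. Then the hyperKähler quotient $M=M(\beta,\lambda)=\mu_\beta^{-1}(0)/N_\beta$ is smooth if (a) any set of $n+1$ flats $H_k$ has empty intersection, and (b) whenever $n$ distinct flats $H_{k(1)},\dots,H_{k(n)}$ have non-empty intersection, the corresponding vectors $u_{k(1)},\dots,u_{k(n)}$ form a $\mathbb Z$-basis for $\mathbb Z^n$.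
   Context: $\mathrm{Im}\,\mathbb H\cong\mathbb R^3$ denotes the imaginary quaternions. Construction of $M(\beta,\lambda)$: choose $\Lambda=(\Lambda_k)_{k\in\mathbb L}\in\mathbb H^{\mathbb L}$ with $\lambda_k=-\tfrac12\overline{\Lambda_k}\,\mathbf i\,\Lambda_k$ for all $k$ (possible since $v\mapsto\overline v\,\mathbf i\,v$ maps $\mathbb H$ onto $\mathrm{Im}\,\mathbb H$). Let $L^2(\mathbb H)=\{v\in\mathbb H^{\mathbb L}:\sum_k|v_k|^2<\infty\}$ and let $M_\Lambda=\Lambda+L^2(\mathbb H)$ be the affine Hilbert manifold with the flat $L^2$-metric and with complex structures obtained by regarding $L^2(\mathbb H)$ as a right $\mathbb H$-module. Let $T_\lambda=\{g\in(S^1)^{\mathbb L}:\sum_k(1+|\lambda_k|)|1-g_k|^2<\infty\}$, a Hilbert Lie group with Lie algebra $\mathfrak t_\lambda=\{t\in\mathbb R^{\mathbb L}:\|t\|^2_{\lambda,\mathfrak t}=\sum_k(1+|\lambda_k|)|t_k|^2<\infty\}$ and exponential map $(t_k)\mapsto(e^{\mathbf it_k})$. It acts on $M_\Lambda$ by $(gx)_k=g_kx_k$, preserving the flat hyperKähler structure, with hyperKähler moment map $\mu_\Lambda(x)=\sum_k(\lambda_k+\tfrac12\overline{x_k}\,\mathbf i\,x_k)e_k^*\in\mathrm{Im}\,\mathbb H\otimes\mathfrak t_\lambda^*$, where $e_k=(\delta_k^j)_{j\in\mathbb L}$. Let $\beta\colon\mathfrak t_\lambda\to\mathbb R^n$ be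 the linear map with $\beta(e_k)=u_k$, supposed continuous, let $\mathfrak n_\beta=\ker\beta$ with inclusion $\iota\colon\mathfrak n_\beta\to\mathfrak t_\lambda$, and let $N_\beta=\ker(\exp\circ\beta\circ\exp^{-1}\colon T_\lambda\to T^n)$, where $T^n=\mathbb R^n/2\pi\mathbb Z^n$. The hyperKähler moment map for $N_\beta$ is $\mu_\beta=\iota^*\mu_\Lambda\colon M_\Lambda\to\mathrm{Im}\,\mathbb H\otimes\mathfrak n_\beta^*$, and $M(\beta,\lambda)=M_\Lambda/\!/\!/N_\beta=\mu_\beta^{-1}(0)/N_\beta$. "Smooth" means that this quotient is a smooth manifold. *)

theory Defs
  imports "HOL-Analysis.Analysis"
begin

section \<open>Quaternions\<close>

text \<open>The pair \<open>(a, b)\<close> of complex numbers stands for the quaternion \<open>a + b j\<close>; multiplication is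
  determined by \<open>j c = cnj c j\<close> and \<open>j j = -1\<close>.  The inner product and norm of the product type
  are the usual ones on the quaternions.\<close>

type_synonym quat = "complex \<times> complex"

definition qmul :: "quat \<Rightarrow> quat \<Rightarrow> quat"  (infixl "\<odot>" 70) where
  "p \<odot> q = (fst p * fst q - snd p * cnj (snd q), fst p * snd q + snd p * cnj (fst q))"

definition qcnj :: "quat \<Rightarrow> quat" where
  "qcnj q = (cnj (fst q), - snd q)"

definition qcomplex :: "complex \<Rightarrow> quat" where
  "qcomplex c = (c, 0)"

definition qi :: quat where
  "qi = qcomplex \<i>"

definition ImH :: "quat set" where
  "ImH = {q. Re (fst q) = 0}"

lemma qmul_assoc: "(p \<odot> q) \<odot> r = p \<odot> (q \<odot> r)"
  by (simp add: qmul_def algebra_simps)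

lemma qcnj_qmul: "qcnj (p \<odot> q) = qcnj q \<odot> qcnj p"
  by (simp add: qmul_def qcnj_def algebra_simps)

lemma qcnj_qmul_self: "qcnj q \<odot> q = qcomplex (of_real ((norm q)\<^sup>2))"
  by (simp add: qmul_def qcnj_def qcomplex_def norm_prod_def complex_norm_square[symmetric]
      mult.commute)

lemma norm_qmul: "norm (p \<odot> q) = norm p * norm q"
proof -
  have "qcomplex (of_real ((norm (p \<odot> q))\<^sup>2)) = qcnj (p \<odot> q) \<odot> (p \<odot> q)"
    by (simp add: qcnj_qmul_self)
  also have "\<dots> = qcnj q \<odot> (qcnj p \<odot> p) \<odot> q"
    by (simp add: qcnj_qmul qmul_assoc)
  also have "\<dots> = qcomplex (of_real ((norm p)\<^sup>2)) \<odot> (qcnj q \<odot> q)"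
    by (simp add: qcnj_qmul_self[of p]) (simp add: qmul_def qcomplex_def algebra_simps)
  also have "\<dots> = qcomplex (of_real ((norm p * norm q)\<^sup>2))"
    by (simp add: qcnj_qmul_self[of q]) (simp add: qmul_def qcomplex_def power_mult_distrib)
  finally have "(norm (p \<odot> q))\<^sup>2 = (norm p * norm q)\<^sup>2"
    unfolding qcomplex_def using of_real_eq_iff[where 'a = complex] by blast
  then show ?thesis by (simp add: power2_eq_iff_nonneg)
qed

lemma ImH_iff: "q \<in> ImH \<longleftrightarrow> qcnj q = - q"
  by (auto simp: ImH_def qcnj_def prod_eq_iff complex_eq_iff)


section \<open>The Hilbert space of square summable quaternionic families\<close>

typedef 'k l2H = "{v :: 'k \<Rightarrow> quat. (\<lambda>k. (norm (v k))\<^sup>2) summable_on UNIV}"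
  morphisms l2H_apply Abs_l2H
  by (rule exI[of _ "\<lambda>_. 0"]) simp

setup_lifting type_definition_l2H

lemma l2H_scale:
  fixes v :: "'k \<Rightarrow> quat"
  assumes "(\<lambda>k. (norm (v k))\<^sup>2) summable_on UNIV"
  shows "(\<lambda>k. (norm (c *\<^sub>R v k))\<^sup>2) summable_on UNIV"
  using summable_on_cmult_right[OF assms, of "c\<^sup>2"] by (simp add: power_mult_distrib)

lemma l2H_add:
  fixes v w :: "'k \<Rightarrow> quat"
  assumes "(\<lambda>k. (norm (v k))\<^sup>2) summable_on UNIV" "(\<lambda>k. (norm (w k))\<^sup>2) summable_on UNIV"
  shows "(\<lambda>k. (norm (v k + w k))\<^sup>2) summable_on UNIV"
proof (rule summable_on_comparison_test)
  show "(\<lambda>k. 2 * (norm (v k))\<^sup>2 + 2 * (norm (w k))\<^sup>2) summable_on UNIV"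
    by (intro summable_on_add summable_on_cmult_right assms)
next
  fix k
  have "(norm (v k + w k))\<^sup>2 \<le> (norm (v k) + norm (w k))\<^sup>2"
    by (intro power_mono norm_triangle_ineq) auto
  also have "\<dots> \<le> 2 * (norm (v k))\<^sup>2 + 2 * (norm (w k))\<^sup>2"
    using sum_squares_bound[of "norm (v k)" "norm (w k)"] by (simp add: power2_sum)
  finally show "(norm (v k + w k))\<^sup>2 \<le> 2 * (norm (v k))\<^sup>2 + 2 * (norm (w k))\<^sup>2" .
qed auto

lemma l2H_inner_summable:
  "(\<lambda>k. l2H_apply v k \<bullet> l2H_apply w k) summable_on UNIV"
proof (rule abs_summable_summable, rule summable_on_comparison_test)
  show "(\<lambda>k. (norm (l2H_apply v k))\<^sup>2 + (norm (l2H_apply w k))\<^sup>2) summable_on UNIV"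
    using l2H_apply[of v] l2H_apply[of w] by (intro summable_on_add) auto
next
  fix k
  have "\<bar>l2H_apply v k \<bullet> l2H_apply w k\<bar> \<le> norm (l2H_apply v k) * norm (l2H_apply w k)"
    by (rule Cauchy_Schwarz_ineq2)
  also have "\<dots> \<le> (norm (l2H_apply v k))\<^sup>2 + (norm (l2H_apply w k))\<^sup>2"
    using sum_squares_bound[of "norm (l2H_apply v k)" "norm (l2H_apply w k)"]
      mult_nonneg_nonneg[OF norm_ge_zero norm_ge_zero, of "l2H_apply v k" "l2H_apply w k"]
    by linarith
  finally show "norm (l2H_apply v k \<bullet> l2H_apply w k)
      \<le> (norm (l2H_apply v k))\<^sup>2 + (norm (l2H_apply w k))\<^sup>2"
    by simp
qed auto

instantiation l2H :: (type) real_vector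
begin

lift_definition zero_l2H :: "'a l2H" is "\<lambda>_. 0" by simp

lift_definition plus_l2H :: "'a l2H \<Rightarrow> 'a l2H \<Rightarrow> 'a l2H" is "\<lambda>v w k. v k + w k"
  by (simp add: l2H_add)

lift_definition uminus_l2H :: "'a l2H \<Rightarrow> 'a l2H" is "\<lambda>v k. - v k" by simp

lift_definition minus_l2H :: "'a l2H \<Rightarrow> 'a l2H \<Rightarrow> 'a l2H" is "\<lambda>v w k. v k - w k"
  subgoal for v w using l2H_add[of v "\<lambda>k. - w k"] by simp
  done

lift_definition scaleR_l2H :: "real \<Rightarrow> 'a l2H \<Rightarrow> 'a l2H" is "\<lambda>c v k. c *\<^sub>R v k"
  by (rule l2H_scale)

instance
proof
  fix u v w :: "'a l2H" and a b :: real
  show "u + v + w = u + (v + w)" by transfer (simp add: add.assoc)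
  show "u + v = v + u" by transfer (simp add: add.commute)
  show "0 + u = u" by transfer simp
  show "- u + u = 0" by transfer simp
  show "u - v = u + - v" by transfer simp
  show "a *\<^sub>R (u + v) = a *\<^sub>R u + a *\<^sub>R v" by transfer (simp add: scaleR_add_right)
  show "(a + b) *\<^sub>R u = a *\<^sub>R u + b *\<^sub>R u" by transfer (simp add: scaleR_add_left)
  show "a *\<^sub>R b *\<^sub>R u = (a * b) *\<^sub>R u" by transfer simp
  show "1 *\<^sub>R u = u" by transfer simp
qed

end

instantiation l2H :: (type) real_inner
begin

definition inner_l2H :: "'a l2H \<Rightarrow> 'a l2H \<Rightarrow> real" where
  "inner_l2H v w = (\<Sum>\<^sub>\<infinity>k. l2H_apply v k \<bullet> l2H_apply w k)"

definition norm_l2H :: "'a l2H \<Rightarrow> real" where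
  "norm_l2H v = sqrt (v \<bullet> v)"

definition sgn_l2H :: "'a l2H \<Rightarrow> 'a l2H" where
  "sgn_l2H v = v /\<^sub>R norm v"

definition dist_l2H :: "'a l2H \<Rightarrow> 'a l2H \<Rightarrow> real" where
  "dist_l2H v w = norm (v - w)"

definition uniformity_l2H :: "('a l2H \<times> 'a l2H) filter" where
  "uniformity_l2H = (INF e\<in>{0<..}. principal {(v, w). dist v w < e})"

definition open_l2H :: "'a l2H set \<Rightarrow> bool" where
  "open_l2H U \<longleftrightarrow> (\<forall>x\<in>U. \<forall>\<^sub>F (x', y) in uniformity. x' = x \<longrightarrow> y \<in> U)"

instance
proof
  fix u v w :: "'a l2H" and a :: real
  show "dist u v = norm (u - v)" by (rule dist_l2H_def)
  show "sgn u = u /\<^sub>R norm u" by (rule sgn_l2H_def)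
  show "uniformity = (INF e\<in>{0<..}. principal {(v, w :: 'a l2H). dist v w < e})"
    by (rule uniformity_l2H_def)
  show "open U \<longleftrightarrow> (\<forall>x\<in>U. \<forall>\<^sub>F (x', y) in uniformity. x' = x \<longrightarrow> y \<in> U)" for U :: "'a l2H set"
    by (rule open_l2H_def)
  show "u \<bullet> v = v \<bullet> u" by (simp add: inner_l2H_def inner_commute)
  show "(u + v) \<bullet> w = u \<bullet> w + v \<bullet> w"
    by (simp add: inner_l2H_def plus_l2H.rep_eq inner_add_left infsum_add l2H_inner_summable)
  show "(a *\<^sub>R u) \<bullet> v = a * (u \<bullet> v)"
    by (simp add: inner_l2H_def scaleR_l2H.rep_eq infsum_cmult_right l2H_inner_summable)
  show "0 \<le> u \<bullet> u" by (simp add: inner_l2H_def infsum_nonneg)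
  show "u \<bullet> u = 0 \<longleftrightarrow> u = 0"
  proof
    assume "u \<bullet> u = 0"
    then have "l2H_apply u k \<bullet> l2H_apply u k = 0" for k
      unfolding inner_l2H_def
      by (intro nonneg_infsum_le_0D[where A = UNIV]) (auto simp: l2H_inner_summable)
    then show "u = 0" by transfer auto
  qed (simp add: inner_l2H_def zero_l2H.rep_eq)
  show "norm u = sqrt (u \<bullet> u)" by (rule norm_l2H_def)
qed

end


section \<open>Smooth maps and smooth manifolds\<close>

text \<open>Frechet smoothness on an open subset \<open>S\<close> of a normed space.  For \<open>length vs = m\<close>,
  \<open>D vs x\<close> is the \<open>m\<close>-th derivative of \<open>f\<close> at \<open>x\<close> applied to the vectors \<open>vs\<close>.  The three
  conditions on \<open>D\<close> say that \<open>D (h # vs) x\<close> is linear in \<open>h\<close>, that each derivative has finite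
  multilinear operator norm, and that the \<open>m\<close>-th derivative is Frechet differentiable in that
  operator norm with the \<open>m+1\<close>-st one as its derivative.  Linearity in the
  remaining arguments follows.\<close>

definition smooth_on :: "'a::real_normed_vector set \<Rightarrow> ('a \<Rightarrow> 'b::real_normed_vector) \<Rightarrow> bool" where
  "smooth_on S f \<longleftrightarrow> (\<exists>D :: 'a list \<Rightarrow> 'a \<Rightarrow> 'b. \<forall>x\<in>S.
     D [] x = f x \<and>
     (\<forall>vs. linear (\<lambda>h. D (h # vs) x)) \<and>
     (\<forall>m. \<exists>C. \<forall>vs. length vs = m \<longrightarrow> norm (D vs x) \<le> C * prod_list (map norm vs)) \<and>
     (\<forall>m. \<forall>e>0. \<exists>d>0. \<forall>y\<in>S. norm (y - x) < d \<longrightarrow> (\<forall>vs. length vs = m \<longrightarrow>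
        norm (D vs y - D vs x - D ((y - x) # vs) x)
          \<le> e * norm (y - x) * prod_list (map norm vs))))"

text \<open>A chart is a pair of an open set and a map that is only meaningful on that set.\<close>

definition smooth_atlas ::
  "'q topology \<Rightarrow> ('q set \<times> ('q \<Rightarrow> 'e::euclidean_space)) set \<Rightarrow> bool" where
  "smooth_atlas Q A \<longleftrightarrow>
     \<Union> (fst ` A) = topspace Q \<and>
     (\<forall>(U, \<phi>)\<in>A. openin Q U \<and> open (\<phi> ` U) \<and>
        homeomorphic_map (subtopology Q U) (top_of_set (\<phi> ` U)) \<phi>) \<and>
     (\<forall>(U, \<phi>)\<in>A. \<forall>(V, \<psi>)\<in>A. smooth_on (\<phi> ` (U \<inter> V)) (\<psi> \<circ> inv_into U \<phi>))"

definition smooth_manifold ::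
  "'q topology \<Rightarrow> ('q set \<times> ('q \<Rightarrow> 'e::euclidean_space)) set \<Rightarrow> bool" where
  "smooth_manifold Q A \<longleftrightarrow> Hausdorff_space Q \<and> second_countable Q \<and> smooth_atlas Q A"

definition quotient_topology :: "'a topology \<Rightarrow> ('a \<Rightarrow> 'b) \<Rightarrow> 'b topology" where
  "quotient_topology X p =
     topology (\<lambda>U. U \<subseteq> p ` topspace X \<and> openin X {x \<in> topspace X. p x \<in> U})"

lemma openin_quotient_topology:
  "openin (quotient_topology X p) U \<longleftrightarrow>
     U \<subseteq> p ` topspace X \<and> openin X {x \<in> topspace X. p x \<in> U}"
proof -
  have "istopology (\<lambda>U. U \<subseteq> p ` topspace X \<and> openin X {x \<in> topspace X. p x \<in> U})"
    unfolding istopology_def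
  proof (intro conjI allI impI)
    fix S T
    assume "S \<subseteq> p ` topspace X \<and> openin X {x \<in> topspace X. p x \<in> S}"
      and "T \<subseteq> p ` topspace X \<and> openin X {x \<in> topspace X. p x \<in> T}"
    moreover have "{x \<in> topspace X. p x \<in> S \<inter> T}
        = {x \<in> topspace X. p x \<in> S} \<inter> {x \<in> topspace X. p x \<in> T}" by auto
    ultimately show "S \<inter> T \<subseteq> p ` topspace X" "openin X {x \<in> topspace X. p x \<in> S \<inter> T}" by auto
  next
    fix \<K>
    assume *: "\<forall>K\<in>\<K>. K \<subseteq> p ` topspace X \<and> openin X {x \<in> topspace X. p x \<in> K}"
    then show "\<Union>\<K> \<subseteq> p ` topspace X" by blast
    have "{x \<in> topspace X. p x \<in> \<Union>\<K>} = (\<Union>K\<in>\<K>. {x \<in> topspace X. p x \<in> K})" by auto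
    then show "openin X {x \<in> topspace X. p x \<in> \<Union>\<K>}" using * by auto
  qed
  then show ?thesis by (simp add: quotient_topology_def)
qed

lemma topspace_quotient_topology: "topspace (quotient_topology X p) = p ` topspace X"
proof
  show "topspace (quotient_topology X p) \<subseteq> p ` topspace X"
    using openin_topspace[of "quotient_topology X p"] by (simp only: openin_quotient_topology)
  have "{x \<in> topspace X. p x \<in> p ` topspace X} = topspace X" by auto
  then have "openin (quotient_topology X p) (p ` topspace X)"
    by (simp add: openin_quotient_topology)
  then show "p ` topspace X \<subseteq> topspace (quotient_topology X p)" by (rule openin_subset)
qed

lemma quotient_map_quotient_topology: "quotient_map X (quotient_topology X p) p"
  by (simp add: quotient_map_def topspace_quotient_topology openin_quotient_topology)


section \<open>The affine Hilbert manifold\<close>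

definition M_aff :: "('k \<Rightarrow> quat) \<Rightarrow> ('k \<Rightarrow> quat) set" where
  "M_aff \<Lambda> = {x. (\<lambda>k. (norm (x k - \<Lambda> k))\<^sup>2) summable_on UNIV}"

definition coord :: "('k \<Rightarrow> quat) \<Rightarrow> ('k \<Rightarrow> quat) \<Rightarrow> 'k l2H" where
  "coord \<Lambda> x = Abs_l2H (\<lambda>k. x k - \<Lambda> k)"

definition M_topology :: "('k \<Rightarrow> quat) \<Rightarrow> ('k \<Rightarrow> quat) topology" where
  "M_topology \<Lambda> = pullback_topology (M_aff \<Lambda>) (coord \<Lambda>) euclidean"

text \<open>A map on an arbitrary subset \<open>Y\<close> of the affine manifold is smooth if locally it extends to
  a smooth map on an open set; \<open>coord\<close> is the global chart.\<close>

definition smooth_on_M ::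
  "('k \<Rightarrow> quat) \<Rightarrow> ('k \<Rightarrow> quat) set \<Rightarrow> (('k \<Rightarrow> quat) \<Rightarrow> 'e::real_normed_vector) \<Rightarrow> bool" where
  "smooth_on_M \<Lambda> Y f \<longleftrightarrow> (\<forall>y\<in>Y. \<exists>\<Omega> F. open \<Omega> \<and> coord \<Lambda> y \<in> \<Omega> \<and> smooth_on \<Omega> F \<and>
     (\<forall>x\<in>Y. coord \<Lambda> x \<in> \<Omega> \<longrightarrow> f x = F (coord \<Lambda> x)))"

text \<open>The projection \<open>p\<close> from \<open>Z\<close> is smooth for the atlas \<open>A\<close> and has a smooth local section through
  every point of \<open>Z\<close>, i.e. it is a smooth submersion.  At most one smooth structure on the
  quotient has this property.\<close>

definition smooth_submersion_onto ::
  "('k \<Rightarrow> quat) \<Rightarrow> ('k \<Rightarrow> quat) set \<Rightarrow> (('k \<Rightarrow> quat) \<Rightarrow> 'q)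
    \<Rightarrow> ('q set \<times> ('q \<Rightarrow> 'e::euclidean_space)) set \<Rightarrow> bool" where
  "smooth_submersion_onto \<Lambda> Z p A \<longleftrightarrow> (\<forall>(U, \<phi>)\<in>A.
     smooth_on_M \<Lambda> {z \<in> Z. p z \<in> U} (\<phi> \<circ> p) \<and>
     (\<forall>z\<in>Z. p z \<in> U \<longrightarrow> (\<exists>W s. open W \<and> \<phi> (p z) \<in> W \<and> W \<subseteq> \<phi> ` U \<and>
        s (\<phi> (p z)) = z \<and>
        (\<forall>w\<in>W. s w \<in> Z \<and> p (s w) \<in> U \<and> \<phi> (p (s w)) = w) \<and>
        smooth_on W (coord \<Lambda> \<circ> s))))"


section \<open>The torus, the moment map and the hyperKaehler quotient\<close>

definition t_alg :: "('k \<Rightarrow> quat) \<Rightarrow> ('k \<Rightarrow> real) set" where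
  "t_alg lam = {t. (\<lambda>k. (1 + norm (lam k)) * (t k)\<^sup>2) summable_on UNIV}"

definition t_norm :: "('k \<Rightarrow> quat) \<Rightarrow> ('k \<Rightarrow> real) \<Rightarrow> real" where
  "t_norm lam t = sqrt (\<Sum>\<^sub>\<infinity>k. (1 + norm (lam k)) * (t k)\<^sup>2)"

definition e_vec :: "'k \<Rightarrow> 'k \<Rightarrow> real" where
  "e_vec k = (\<lambda>j. if j = k then 1 else 0)"

definition continuous_linear_t ::
  "('k \<Rightarrow> quat) \<Rightarrow> (('k \<Rightarrow> real) \<Rightarrow> 'v::real_normed_vector) \<Rightarrow> bool" where
  "continuous_linear_t lam \<beta> \<longleftrightarrow>
     (\<forall>s\<in>t_alg lam. \<forall>t\<in>t_alg lam. \<beta> (\<lambda>k. s k + t k) = \<beta> s + \<beta> t) \<and>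
     (\<forall>c. \<forall>t\<in>t_alg lam. \<beta> (\<lambda>k. c * t k) = c *\<^sub>R \<beta> t) \<and>
     (\<exists>C. \<forall>t\<in>t_alg lam. norm (\<beta> t) \<le> C * t_norm lam t)"

definition T_group :: "('k \<Rightarrow> quat) \<Rightarrow> ('k \<Rightarrow> complex) set" where
  "T_group lam = {g. (\<forall>k. norm (g k) = 1) \<and>
     (\<lambda>k. (1 + norm (lam k)) * (norm (1 - g k))\<^sup>2) summable_on UNIV}"

definition exp_t :: "('k \<Rightarrow> real) \<Rightarrow> 'k \<Rightarrow> complex" where
  "exp_t t = (\<lambda>k. exp (\<i> * complex_of_real (t k)))"

definition real_vec :: "int ^ 'n \<Rightarrow> real ^ 'n" where
  "real_vec v = (\<chi> i. real_of_int (v $ i))"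

definition n_alg :: "('k \<Rightarrow> quat) \<Rightarrow> (('k \<Rightarrow> real) \<Rightarrow> real ^ 'n) \<Rightarrow> ('k \<Rightarrow> real) set" where
  "n_alg lam \<beta> = {t \<in> t_alg lam. \<beta> t = 0}"

text \<open>The kernel of the map sending \<open>exp_t t\<close> to the class of \<open>\<beta> t\<close> in the torus
  \<open>R^n / 2 pi Z^n\<close>.\<close>

definition N_group :: "('k \<Rightarrow> quat) \<Rightarrow> (('k \<Rightarrow> real) \<Rightarrow> real ^ 'n) \<Rightarrow> ('k \<Rightarrow> complex) set" where
  "N_group lam \<beta> = {g \<in> T_group lam. \<exists>t\<in>t_alg lam. g = exp_t t \<and>
     (\<exists>m. \<beta> t = (2 * pi) *\<^sub>R real_vec m)}"

definition act :: "('k \<Rightarrow> complex) \<Rightarrow> ('k \<Rightarrow> quat) \<Rightarrow> ('k \<Rightarrow> quat)" where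
  "act g x = (\<lambda>k. qcomplex (g k) \<odot> x k)"

definition orbit :: "('k \<Rightarrow> complex) set \<Rightarrow> ('k \<Rightarrow> quat) \<Rightarrow> ('k \<Rightarrow> quat) set" where
  "orbit N x = (\<lambda>g. act g x) ` N"

text \<open>An element of the tensor product of \<open>ImH\<close> with the dual of the Lie algebra is a map from
  the Lie algebra to \<open>ImH\<close>.\<close>

definition moment :: "('k \<Rightarrow> quat) \<Rightarrow> ('k \<Rightarrow> quat) \<Rightarrow> ('k \<Rightarrow> real) \<Rightarrow> quat" where
  "moment lam x t = (\<Sum>\<^sub>\<infinity>k. t k *\<^sub>R (lam k + (1/2) *\<^sub>R (qcnj (x k) \<odot> qi \<odot> x k)))"

lemma moment_summable:
  assumes lam: "\<And>k. lam k = - (1/2) *\<^sub>R (qcnj (\<Lambda> k) \<odot> qi \<odot> \<Lambda> k)"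
    and x: "x \<in> M_aff \<Lambda>" and t: "t \<in> t_alg lam"
  shows "(\<lambda>k. norm (t k *\<^sub>R (lam k + (1/2) *\<^sub>R (qcnj (x k) \<odot> qi \<odot> x k)))) summable_on UNIV"
proof -
  define v where "v k = x k - \<Lambda> k" for k
  define S where "S = (\<Sum>\<^sub>\<infinity>k. (1 + norm (lam k)) * (t k)\<^sup>2)"
  have sv: "(\<lambda>k. (norm (v k))\<^sup>2) summable_on UNIV" using x by (simp add: M_aff_def v_def)
  have st: "(\<lambda>k. (1 + norm (lam k)) * (t k)\<^sup>2) summable_on UNIV" using t by (simp add: t_alg_def)
  have nqi: "norm qi = 1" "\<And>q. norm (qcnj q) = norm q"
    by (simp_all add: qi_def qcomplex_def qcnj_def norm_prod_def)
  have nlam: "(norm (\<Lambda> k))\<^sup>2 = 2 * norm (lam k)" for k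
    by (simp add: lam norm_qmul nqi power2_eq_square)
  have tS: "\<bar>t k\<bar> \<le> 1 + S" for k
  proof -
    have "(t k)\<^sup>2 \<le> (1 + norm (lam k)) * (t k)\<^sup>2" by (simp add: algebra_simps)
    also have "\<dots> = (\<Sum>\<^sub>\<infinity>k\<in>{k}. (1 + norm (lam k)) * (t k)\<^sup>2)" by simp
    also have "\<dots> \<le> S" unfolding S_def
      by (rule infsum_mono2) (use st in auto)
    finally have "\<bar>t k\<bar>\<^sup>2 \<le> S" by simp
    moreover have "2 * \<bar>t k\<bar> \<le> 1 + \<bar>t k\<bar>\<^sup>2"
      using zero_le_power2[of "\<bar>t k\<bar> - 1"] by (simp add: power2_diff)
    ultimately show ?thesis using abs_ge_zero[of "t k"] by linarith
  qed
  show ?thesis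
  proof (rule summable_on_comparison_test)
    show "(\<lambda>k. 2 * ((1 + norm (lam k)) * (t k)\<^sup>2) + (2 + S) * (norm (v k))\<^sup>2) summable_on UNIV"
      by (intro summable_on_add summable_on_cmult_right sv st)
  next
    fix k
    have x: "x k = \<Lambda> k + v k" by (simp add: v_def)
    let ?y = "qcnj (v k) \<odot> qi \<odot> \<Lambda> k + qcnj (\<Lambda> k) \<odot> qi \<odot> v k + qcnj (v k) \<odot> qi \<odot> v k"
    have "qcnj (x k) \<odot> qi \<odot> x k = qcnj (\<Lambda> k) \<odot> qi \<odot> \<Lambda> k + ?y"
      unfolding x by (simp add: qmul_def qcnj_def algebra_simps)
    then have "lam k + (1/2) *\<^sub>R (qcnj (x k) \<odot> qi \<odot> x k) = (1/2) *\<^sub>R ?y"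
      by (simp add: lam scaleR_add_right)
    then have "norm (lam k + (1/2) *\<^sub>R (qcnj (x k) \<odot> qi \<odot> x k)) = norm ?y / 2"
      by simp
    moreover have "norm ?y \<le> norm (v k) * norm (\<Lambda> k) + norm (\<Lambda> k) * norm (v k) + norm (v k) * norm (v k)"
      by (intro norm_triangle_le add_mono) (simp_all add: norm_qmul nqi)
    then have "norm ?y \<le> 2 * (norm (\<Lambda> k) * norm (v k)) + (norm (v k))\<^sup>2"
      by (simp only: power2_eq_square mult.commute[of "norm (v k)" "norm (\<Lambda> k)"])
    moreover have "0 \<le> (norm (v k))\<^sup>2" by simp
    ultimately have "norm (lam k + (1/2) *\<^sub>R (qcnj (x k) \<odot> qi \<odot> x k))
        \<le> norm (\<Lambda> k) * norm (v k) + (norm (v k))\<^sup>2"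
      by linarith
    then have "norm (t k *\<^sub>R (lam k + (1/2) *\<^sub>R (qcnj (x k) \<odot> qi \<odot> x k)))
        \<le> \<bar>t k\<bar> * (norm (\<Lambda> k) * norm (v k) + (norm (v k))\<^sup>2)"
      unfolding norm_scaleR by (intro mult_left_mono) auto
    also have "\<dots> = (\<bar>t k\<bar> * norm (\<Lambda> k)) * norm (v k) + \<bar>t k\<bar> * (norm (v k))\<^sup>2"
      by (simp add: algebra_simps)
    also have "\<dots> \<le> ((\<bar>t k\<bar> * norm (\<Lambda> k))\<^sup>2 + (norm (v k))\<^sup>2) + (1 + S) * (norm (v k))\<^sup>2"
    proof (rule add_mono)
      have "2 * ((\<bar>t k\<bar> * norm (\<Lambda> k)) * norm (v k)) \<le> (\<bar>t k\<bar> * norm (\<Lambda> k))\<^sup>2 + (norm (v k))\<^sup>2"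
        using sum_squares_bound[of "\<bar>t k\<bar> * norm (\<Lambda> k)" "norm (v k)"] by simp
      moreover have "0 \<le> (\<bar>t k\<bar> * norm (\<Lambda> k)) * norm (v k)" by simp
      ultimately show "(\<bar>t k\<bar> * norm (\<Lambda> k)) * norm (v k)
          \<le> (\<bar>t k\<bar> * norm (\<Lambda> k))\<^sup>2 + (norm (v k))\<^sup>2" by linarith
      show "\<bar>t k\<bar> * (norm (v k))\<^sup>2 \<le> (1 + S) * (norm (v k))\<^sup>2"
        by (intro mult_right_mono tS) simp
    qed
    also have "\<dots> \<le> 2 * ((1 + norm (lam k)) * (t k)\<^sup>2) + (2 + S) * (norm (v k))\<^sup>2"
      by (simp add: power_mult_distrib nlam algebra_simps)
    finally show "norm (t k *\<^sub>R (lam k + (1/2) *\<^sub>R (qcnj (x k) \<odot> qi \<odot> x k)))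
        \<le> 2 * ((1 + norm (lam k)) * (t k)\<^sup>2) + (2 + S) * (norm (v k))\<^sup>2" .
  qed auto
qed

definition zero_level ::
  "('k \<Rightarrow> quat) \<Rightarrow> ('k \<Rightarrow> quat) \<Rightarrow> (('k \<Rightarrow> real) \<Rightarrow> real ^ 'n) \<Rightarrow> ('k \<Rightarrow> quat) set" where
  "zero_level \<Lambda> lam \<beta> = {x \<in> M_aff \<Lambda>. \<forall>t\<in>n_alg lam \<beta>. moment lam x t = 0}"

definition hk_quotient ::
  "('k \<Rightarrow> quat) \<Rightarrow> ('k \<Rightarrow> quat) \<Rightarrow> (('k \<Rightarrow> real) \<Rightarrow> real ^ 'n) \<Rightarrow> ('k \<Rightarrow> quat) set topology" where
  "hk_quotient \<Lambda> lam \<beta> = quotient_topology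
     (subtopology (M_topology \<Lambda>) (zero_level \<Lambda> lam \<beta>)) (orbit (N_group lam \<beta>))"

text \<open>The quotient has real dimension \<open>4n\<close>, so its charts take values in the space of \<open>n\<close>-tuples of
  quaternions.\<close>

definition hk_quotient_smooth ::
  "('k \<Rightarrow> quat) \<Rightarrow> ('k \<Rightarrow> quat) \<Rightarrow> (('k \<Rightarrow> real) \<Rightarrow> real ^ 'n) \<Rightarrow> bool" where
  "hk_quotient_smooth \<Lambda> lam \<beta> \<longleftrightarrow>
     (\<exists>A :: (('k \<Rightarrow> quat) set set \<times> (('k \<Rightarrow> quat) set \<Rightarrow> quat ^ 'n)) set.
        smooth_manifold (hk_quotient \<Lambda> lam \<beta>) A \<and>
        smooth_submersion_onto \<Lambda> (zero_level \<Lambda> lam \<beta>) (orbit (N_group lam \<beta>)) A)"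


section \<open>Flats and lattice vectors\<close>

definition primitive :: "int ^ 'n \<Rightarrow> bool" where
  "primitive v \<longleftrightarrow> (\<forall>m w. v = m *s w \<longrightarrow> \<bar>m\<bar> = 1)"

lemma primitive_iff_Gcd: "primitive v \<longleftrightarrow> Gcd (range (($) v)) = 1"
proof
  assume v: "primitive v"
  define g where "g = Gcd (range (($) v))"
  have "v = g *s (\<chi> i. v $ i div g)"
    by (auto simp: vec_eq_iff g_def Gcd_dvd)
  then have "\<bar>g\<bar> = 1" using v unfolding primitive_def by blast
  then show "Gcd (range (($) v)) = 1" by (simp add: g_def)
next
  assume g: "Gcd (range (($) v)) = 1"
  show "primitive v" unfolding primitive_def
  proof (intro allI impI)
    fix m w assume "v = m *s w"
    then have "m dvd Gcd (range (($) v))" by (intro Gcd_greatest) auto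
    then show "\<bar>m\<bar> = 1" using g by simp
  qed
qed

definition flat :: "('k \<Rightarrow> int ^ 'n) \<Rightarrow> ('k \<Rightarrow> quat) \<Rightarrow> 'k \<Rightarrow> (real ^ 'n \<Rightarrow> quat) set" where
  "flat u lam k = {a. linear a \<and> range a \<subseteq> ImH \<and> a (real_vec (u k)) = lam k}"

definition Z_basis_family :: "('k \<Rightarrow> int ^ 'n) \<Rightarrow> 'k set \<Rightarrow> bool" where
  "Z_basis_family u K \<longleftrightarrow> (\<forall>w. \<exists>!c. c \<in> K \<rightarrow>\<^sub>E UNIV \<and> w = (\<Sum>k\<in>K. c k *s u k))"

end

theory Submission
  imports Defs
begin

text \<open>For a point \<open>x\<close> of the zero level the moment values \<open>mu x k\<close> have the form \<open>a (u k)\<close> with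
  \<open>a\<close> linear, and \<open>x k = 0\<close> exactly when \<open>a\<close> lies on the flat of \<open>k\<close>.  Conditions (a) and (b)
  put these indices into a set \<open>K\<close> of \<open>n\<close> indices whose vectors form a basis of the integer
  lattice.  An element of the group is then determined by its coordinates off \<open>K\<close>, where the
  coordinates of \<open>x\<close> are nonzero.  Hence every orbit near \<open>x\<close> has exactly one representative whose
  coordinates off \<open>K\<close> have positive Hermitian product with those of \<open>x\<close>.  The coordinates of this
  representative in \<open>K\<close> form a chart: they determine the moment values, and these determine the
  other coordinates through a local section of the Hopf map.  All infinite families that occur are
  controlled by the sum of \<open>(norm (u k))\<^sup>2 / (1 + norm (lam k))\<close>, which converges because \<open>\<beta>\<close> is
  continuous.  Two points with the same moment values differ by phases and lie in the domain of one
  such gauge, which separates their orbits; other orbits are separated by their moment values.\<close>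

section \<open>Uniformly smooth families of maps\<close>

text \<open>Two infinite processes have to be smooth: the section moves all coordinates at once, and
  the phase correction that gauges a point is, on the frame, a sum over all other indices. Both are
  written as a square summable scalar sequence times functions whose derivatives of each order are
  locally bounded uniformly in the index; hence estimates for families instead of single maps. For
  the section the weights are \<open>norm (V k) / norm (x0 k)\<close>, and dividing by them leads to
  a difference quotient of the Hopf section in which the small parameter has been cancelled. For the
  phases the logarithm is split into a linear part, which acts as a bounded operator on the Hilbert
  space, and a quadratic remainder, which gains a factor \<open>1 / norm (x0 k)\<close>. The
  integral basis enters through freeness: phases that are trivial off the frame come from angles in
  2 pi Z, only finitely many of them nonzero, and integral coordinates then force the angles on the
  frame into 2 pi Z too.\<close>

definition loc_bdd :: "'a::real_normed_vector set \<Rightarrow> ('a \<Rightarrow> 'b::real_normed_vector) set \<Rightarrow> bool" where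
  "loc_bdd S F \<longleftrightarrow> (\<forall>x\<in>S. \<exists>d>0. \<exists>C\<ge>0. \<forall>y\<in>S. dist y x < d \<longrightarrow> (\<forall>f\<in>F. norm (f y) \<le> C))"

text \<open>The directional derivatives of a set of functions form a set of functions of the same type, so
  that higher derivatives need no iterated operator spaces.\<close>

primrec equi_Ck ::
  "nat \<Rightarrow> 'a::real_normed_vector set \<Rightarrow> ('a \<Rightarrow> 'b::real_normed_vector) set \<Rightarrow> bool" where
  "equi_Ck 0 S F \<longleftrightarrow> loc_bdd S F"
| "equi_Ck (Suc m) S F \<longleftrightarrow> loc_bdd S F \<and> (\<exists>G. equi_Ck m S G \<and>
     (\<forall>f\<in>F. \<exists>f'. (\<forall>x\<in>S. (f has_derivative f' x) (at x)) \<and>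
        (\<forall>h. norm h \<le> 1 \<longrightarrow> (\<exists>g\<in>G. \<forall>x\<in>S. g x = f' x h))))"

lemma loc_bddE:
  assumes "loc_bdd S F" "x \<in> S"
  obtains d C where "d > 0" "C \<ge> 0" "\<And>y f. y \<in> S \<Longrightarrow> dist y x < d \<Longrightarrow> f \<in> F \<Longrightarrow> norm (f y) \<le> C"
  using assms unfolding loc_bdd_def by blast

lemma loc_bddI:
  assumes "\<And>x. x \<in> S \<Longrightarrow> \<exists>d>0. \<exists>C. \<forall>y\<in>S. dist y x < d \<longrightarrow> (\<forall>f\<in>F. norm (f y) \<le> C)"
  shows "loc_bdd S F"
  unfolding loc_bdd_def
proof
  fix x assume "x \<in> S"
  then obtain d C where "d > 0" "\<forall>y\<in>S. dist y x < d \<longrightarrow> (\<forall>f\<in>F. norm (f y) \<le> C)"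
    using assms by metis
  then show "\<exists>d>0. \<exists>C\<ge>0. \<forall>y\<in>S. dist y x < d \<longrightarrow> (\<forall>f\<in>F. norm (f y) \<le> C)"
    by (intro exI[of _ d] conjI exI[of _ "max C 0"]) (auto simp: le_max_iff_disj)
qed

lemma equi_Ck_loc_bdd: "equi_Ck m S F \<Longrightarrow> loc_bdd S F"
  by (cases m) auto

lemma equi_Ck_SucE:
  assumes "equi_Ck (Suc m) S F"
  obtains G f' where "loc_bdd S F" "equi_Ck m S G"
    "\<And>f x. f \<in> F \<Longrightarrow> x \<in> S \<Longrightarrow> (f has_derivative f' f x) (at x)"
    "\<And>f h. f \<in> F \<Longrightarrow> norm h \<le> 1 \<Longrightarrow> \<exists>g\<in>G. \<forall>x\<in>S. g x = f' f x h"
proof -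
  obtain G where G: "loc_bdd S F" "equi_Ck m S G"
    "\<forall>f\<in>F. \<exists>f'. (\<forall>x\<in>S. (f has_derivative f' x) (at x)) \<and>
        (\<forall>h. norm h \<le> 1 \<longrightarrow> (\<exists>g\<in>G. \<forall>x\<in>S. g x = f' x h))"
    using assms unfolding equi_Ck.simps by blast
  from bchoice[OF G(3)] obtain f' where "\<forall>f\<in>F. (\<forall>x\<in>S. (f has_derivative f' f x) (at x)) \<and>
        (\<forall>h. norm h \<le> 1 \<longrightarrow> (\<exists>g\<in>G. \<forall>x\<in>S. g x = f' f x h))"
    by (rule exE)
  with G show ?thesis by (intro that[of G f']) simp_all
qed

lemma equi_Ck_SucI:
  assumes "loc_bdd S F" "equi_Ck m S G"
    "\<And>f x. f \<in> F \<Longrightarrow> x \<in> S \<Longrightarrow> (f has_derivative f' f x) (at x)"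
    "\<And>f h. f \<in> F \<Longrightarrow> norm h \<le> 1 \<Longrightarrow> \<exists>g\<in>G. \<forall>x\<in>S. g x = f' f x h"
  shows "equi_Ck (Suc m) S F"
  unfolding equi_Ck.simps
proof (intro conjI exI[of _ G] ballI)
  fix f assume "f \<in> F"
  then show "\<exists>f'. (\<forall>x\<in>S. (f has_derivative f' x) (at x)) \<and>
        (\<forall>h. norm h \<le> 1 \<longrightarrow> (\<exists>g\<in>G. \<forall>x\<in>S. g x = f' x h))"
    using assms(3,4) by (intro exI[of _ "f' f"]) simp
qed (fact assms)+

lemma equi_Ck_SucD: "equi_Ck (Suc m) S F \<Longrightarrow> equi_Ck m S F"
proof (induction m arbitrary: F)
  case (Suc m)
  obtain G f' where G: "loc_bdd S F" "equi_Ck (Suc m) S G"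
    "\<And>f x. f \<in> F \<Longrightarrow> x \<in> S \<Longrightarrow> (f has_derivative f' f x) (at x)"
    "\<And>f h. f \<in> F \<Longrightarrow> norm h \<le> 1 \<Longrightarrow> \<exists>g\<in>G. \<forall>x\<in>S. g x = f' f x h"
    using Suc.prems by (rule equi_Ck_SucE) (rule that)
  show ?case by (rule equi_Ck_SucI[OF G(1) Suc.IH[OF G(2)] G(3,4)])
qed auto

text \<open>A family enters only through its values on \<open>S\<close>: as \<open>S\<close> is
  open, derivatives on \<open>S\<close> depend on nothing else, and arbitrary values outside do no
  harm.\<close>

lemma equi_Ck_subset:
  assumes "equi_Ck m S F" "open S" "\<And>h. h \<in> H \<Longrightarrow> \<exists>f\<in>F. \<forall>x\<in>S. h x = f x"
  shows "equi_Ck m S H"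
proof -
  have "\<forall>h\<in>H. \<exists>f. f \<in> F \<and> (\<forall>x\<in>S. h x = f x)" using assms(3) by blast
  from bchoice[OF this] obtain c where "\<forall>h\<in>H. c h \<in> F \<and> (\<forall>x\<in>S. h x = c h x)"
    by (rule exE)
  then have c: "\<And>h. h \<in> H \<Longrightarrow> c h \<in> F" "\<And>h x. h \<in> H \<Longrightarrow> x \<in> S \<Longrightarrow> h x = c h x"
    by blast+
  have bd: "loc_bdd S H"
  proof (rule loc_bddI)
    fix x assume "x \<in> S"
    with equi_Ck_loc_bdd[OF assms(1)] obtain d C where "d > 0"
      "\<And>y f. y \<in> S \<Longrightarrow> dist y x < d \<Longrightarrow> f \<in> F \<Longrightarrow> norm (f y) \<le> C"
      by (rule loc_bddE) (rule that)
    then show "\<exists>d>0. \<exists>C. \<forall>y\<in>S. dist y x < d \<longrightarrow> (\<forall>f\<in>H. norm (f y) \<le> C)"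
      by (intro exI[of _ d] conjI exI[of _ C]) (simp_all add: c)
  qed
  show ?thesis
  proof (cases m)
    case (Suc k)
    with assms(1) have "equi_Ck (Suc k) S F" by simp
    then show ?thesis unfolding Suc
    proof (rule equi_Ck_SucE)
      fix G f' assume G: "equi_Ck k S G"
        and d: "\<And>f x. f \<in> F \<Longrightarrow> x \<in> S \<Longrightarrow> (f has_derivative f' f x) (at x)"
        and e: "\<And>f h. f \<in> F \<Longrightarrow> norm h \<le> 1 \<Longrightarrow> \<exists>g\<in>G. \<forall>x\<in>S. g x = f' f x h"
      show "equi_Ck (Suc k) S H"
      proof (rule equi_Ck_SucI[OF bd G])
        fix h x assume h: "h \<in> H" and x: "x \<in> S"
        show "(h has_derivative f' (c h) x) (at x)"
          using d[OF c(1)[OF h] x] \<open>open S\<close> x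
          by (rule has_derivative_transform_within_open) (simp add: c(2) h)
      next
        fix h and v :: 'a assume "h \<in> H" "norm v \<le> 1"
        then show "\<exists>g\<in>G. \<forall>x\<in>S. g x = f' (c h) x v" by (intro e c(1))
      qed
    qed
  qed (simp add: bd)
qed

lemma equi_Ck_Un:
  assumes "equi_Ck m S F" "equi_Ck m S G"
  shows "equi_Ck m S (F \<union> G)"
  using assms
proof (induction m arbitrary: F G)
  case 0
  show ?case unfolding equi_Ck.simps
  proof (rule loc_bddI)
    fix x assume x: "x \<in> S"
    obtain d C where 1: "d > 0" "\<And>y f. y \<in> S \<Longrightarrow> dist y x < d \<Longrightarrow> f \<in> F \<Longrightarrow> norm (f y) \<le> C"
      using equi_Ck_loc_bdd[OF 0(1)] x by (rule loc_bddE) (rule that)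
    obtain e D where 2: "e > 0" "\<And>y f. y \<in> S \<Longrightarrow> dist y x < e \<Longrightarrow> f \<in> G \<Longrightarrow> norm (f y) \<le> D"
      using equi_Ck_loc_bdd[OF 0(2)] x by (rule loc_bddE) (rule that)
    show "\<exists>d>0. \<exists>C. \<forall>y\<in>S. dist y x < d \<longrightarrow> (\<forall>f\<in>F \<union> G. norm (f y) \<le> C)"
      by (intro exI[of _ "min d e"] conjI exI[of _ "max C D"])
        (use 1 2 in \<open>auto simp: le_max_iff_disj\<close>)
  qed
next
  case (Suc m)
  obtain F' f' where F: "loc_bdd S F" "equi_Ck m S F'"
    "\<And>f x. f \<in> F \<Longrightarrow> x \<in> S \<Longrightarrow> (f has_derivative f' f x) (at x)"
    "\<And>f h. f \<in> F \<Longrightarrow> norm h \<le> 1 \<Longrightarrow> \<exists>g\<in>F'. \<forall>x\<in>S. g x = f' f x h"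
    using Suc.prems(1) by (rule equi_Ck_SucE) (rule that)
  obtain G' g' where G: "loc_bdd S G" "equi_Ck m S G'"
    "\<And>f x. f \<in> G \<Longrightarrow> x \<in> S \<Longrightarrow> (f has_derivative g' f x) (at x)"
    "\<And>f h. f \<in> G \<Longrightarrow> norm h \<le> 1 \<Longrightarrow> \<exists>g\<in>G'. \<forall>x\<in>S. g x = g' f x h"
    using Suc.prems(2) by (rule equi_Ck_SucE) (rule that)
  have "loc_bdd S (F \<union> G)"
    using Suc.IH[OF Suc.prems[THEN equi_Ck_SucD]] by (rule equi_Ck_loc_bdd)
  then show ?case
  proof (rule equi_Ck_SucI[where G = "F' \<union> G'" and f' = "\<lambda>f. if f \<in> F then f' f else g' f"])
    show "equi_Ck m S (F' \<union> G')" by (rule Suc.IH[OF F(2) G(2)])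
  next
    fix f and x assume "f \<in> F \<union> G" "x \<in> S"
    then show "(f has_derivative (if f \<in> F then f' f else g' f) x) (at x)"
      using F(3)[of f x] G(3)[of f x] by auto
  next
    fix f and h :: 'a assume "f \<in> F \<union> G" "norm h \<le> 1"
    then show "\<exists>g\<in>F' \<union> G'. \<forall>x\<in>S. g x = (if f \<in> F then f' f else g' f) x h"
      using F(4)[of f h] G(4)[of f h] by (cases "f \<in> F") (simp_all, blast+)
  qed
qed

text \<open>Sets of functions forget which functions belong together. The index restores this, so
  that sums and products can be taken termwise; the index set \<open>{()}\<close> gives a single
  map.\<close>

definition smooth_family ::
  "'a::real_normed_vector set \<Rightarrow> 'i set \<Rightarrow> ('i \<Rightarrow> 'a \<Rightarrow> 'b::real_normed_vector) \<Rightarrow> bool" where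
  "smooth_family S I f \<longleftrightarrow> open S \<and> (\<forall>m. equi_Ck m S (f ` I))"

lemma smooth_family_subset:
  assumes "smooth_family S I f" "\<And>j. j \<in> J \<Longrightarrow> \<exists>i\<in>I. \<forall>x\<in>S. g j x = f i x"
  shows "smooth_family S J g"
  unfolding smooth_family_def
proof (intro conjI allI)
  fix m
  show "equi_Ck m S (g ` J)"
  proof (rule equi_Ck_subset)
    fix h assume "h \<in> g ` J"
    then show "\<exists>k\<in>f ` I. \<forall>x\<in>S. h x = k x" using assms(2) by blast
  qed (use assms(1) in \<open>simp_all add: smooth_family_def\<close>)
qed (use assms(1) in \<open>simp add: smooth_family_def\<close>)

lemma smooth_family_cong:
  assumes "smooth_family S I f" "\<And>i x. i \<in> I \<Longrightarrow> x \<in> S \<Longrightarrow> g i x = f i x"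
  shows "smooth_family S I g"
  using assms(1) by (rule smooth_family_subset) (use assms(2) in blast)

section \<open>Constants, linear maps, sums and products of families\<close>

lemma loc_bdd_const:
  assumes "\<And>h. h \<in> H \<Longrightarrow> \<exists>c. norm c \<le> C \<and> (\<forall>x\<in>S. h x = c)"
  shows "loc_bdd S H"
  by (rule loc_bddI) (metis assms zero_less_one)

lemma equi_Ck_const:
  fixes H :: "('a::real_normed_vector \<Rightarrow> 'b::real_normed_vector) set"
  assumes "open S" "\<And>h. h \<in> H \<Longrightarrow> \<exists>c. norm c \<le> C \<and> (\<forall>x\<in>S. h x = c)"
  shows "equi_Ck m S H"
  using assms(2)
proof (induction m arbitrary: H C)
  case 0
  then show ?case unfolding equi_Ck.simps by (rule loc_bdd_const)
next
  case (Suc m)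
  have "loc_bdd S H" using Suc.prems by (rule loc_bdd_const)
  moreover have "equi_Ck m S {\<lambda>_::'a. 0::'b}" by (rule Suc.IH[where C = 0]) auto
  ultimately show ?case
  proof (rule equi_Ck_SucI[where f' = "\<lambda>_ _ _. 0"])
    fix f x assume f: "f \<in> H" and x: "x \<in> S"
    obtain c where c: "\<forall>x\<in>S. f x = c" using Suc.prems f by metis
    show "(f has_derivative (\<lambda>_. 0)) (at x)"
      using has_derivative_const \<open>open S\<close> x
      by (rule has_derivative_transform_within_open[of "\<lambda>_. c"]) (use c in auto)
  qed auto
qed

lemma smooth_family_const:
  assumes "open S" "\<And>i. i \<in> I \<Longrightarrow> norm (c i) \<le> C"
  shows "smooth_family S I (\<lambda>i x. c i)"
  unfolding smooth_family_def using assms by (auto intro!: equi_Ck_const)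

lemma smooth_family_linear_maps:
  assumes "open S" "\<And>i. i \<in> I \<Longrightarrow> linear (f i)" "\<And>i x. i \<in> I \<Longrightarrow> norm (f i x) \<le> C * norm x"
  shows "smooth_family S I f"
proof -
  have bl: "bounded_linear (f i)" if "i \<in> I" for i
    using assms(2,3)[OF that] bounded_linear_intro[of "f i" C]
    by (simp add: linear_add linear_scale mult.commute)
  have lb: "loc_bdd S (f ` I)"
  proof (rule loc_bddI)
    fix x assume "x \<in> S"
    have "norm (f i y) \<le> \<bar>C\<bar> * (norm x + 1)" if "dist y x < 1" "i \<in> I" for y i
    proof -
      have "norm y \<le> norm x + 1" using that(1) by norm
      then have "\<bar>C\<bar> * norm y \<le> \<bar>C\<bar> * (norm x + 1)" by (intro mult_left_mono) auto
      moreover have "C * norm y \<le> \<bar>C\<bar> * norm y" by (intro mult_right_mono) auto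
      ultimately show ?thesis using assms(3)[OF that(2), of y] by linarith
    qed
    then show "\<exists>d>0. \<exists>C. \<forall>y\<in>S. dist y x < d \<longrightarrow> (\<forall>g\<in>f ` I. norm (g y) \<le> C)"
      by (intro exI[of _ 1] conjI exI[of _ "\<bar>C\<bar> * (norm x + 1)"]) auto
  qed
  have "equi_Ck m S (f ` I)" for m
  proof (cases m)
    case (Suc k)
    have "equi_Ck k S {\<lambda>_::'a. f i h |i h. i \<in> I \<and> norm h \<le> 1}"
    proof (rule equi_Ck_const[of _ _ "\<bar>C\<bar>"])
      fix g :: "'a \<Rightarrow> 'c" assume "g \<in> {\<lambda>_. f i h |i h. i \<in> I \<and> norm h \<le> 1}"
      then obtain i h where g: "g = (\<lambda>_. f i h)" "i \<in> I" "norm h \<le> 1" by auto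
      have "norm (f i h) \<le> C * norm h" by (rule assms(3)[OF g(2)])
      also have "\<dots> \<le> \<bar>C\<bar> * 1" by (intro mult_mono) (use g in auto)
      finally show "\<exists>c. norm c \<le> \<bar>C\<bar> \<and> (\<forall>x\<in>S. g x = c)" using g by auto
    qed (rule assms(1))
    with lb show ?thesis unfolding Suc
      by (rule equi_Ck_SucI[where f' = "\<lambda>g x. g"])
        (use bl in \<open>auto intro: bounded_linear_imp_has_derivative\<close>)
  qed (simp add: lb)
  then show ?thesis by (simp add: smooth_family_def assms(1))
qed

text \<open>The bound is left as an arbitrary monotone function \<open>b\<close>, so that one
  argument serves sums, products, the exponential and the quadratic estimate for the
  logarithm.\<close>

lemma loc_bdd_comp2:
  assumes F: "loc_bdd S F" and G: "loc_bdd S G"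
    and H: "\<And>h. h \<in> H \<Longrightarrow> \<exists>f\<in>F. \<exists>g\<in>G. \<forall>x\<in>S. norm (h x) \<le> b (norm (f x)) (norm (g x))"
    and b: "\<And>s t s' t'. 0 \<le> s \<Longrightarrow> 0 \<le> t \<Longrightarrow> s \<le> s' \<Longrightarrow> t \<le> t' \<Longrightarrow> b s t \<le> b s' t'"
  shows "loc_bdd S H"
proof (rule loc_bddI)
  fix x assume x: "x \<in> S"
  obtain d C where 1: "d > 0" "\<And>y f. y \<in> S \<Longrightarrow> dist y x < d \<Longrightarrow> f \<in> F \<Longrightarrow> norm (f y) \<le> C"
    using F x by (rule loc_bddE) (rule that)
  obtain e D where 2: "e > 0" "\<And>y f. y \<in> S \<Longrightarrow> dist y x < e \<Longrightarrow> f \<in> G \<Longrightarrow> norm (f y) \<le> D"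
    using G x by (rule loc_bddE) (rule that)
  have "norm (h y) \<le> b C D" if h: "h \<in> H" "y \<in> S" "dist y x < min d e" for h y
  proof -
    obtain f g where fg: "f \<in> F" "g \<in> G" "norm (h y) \<le> b (norm (f y)) (norm (g y))"
      using H h by metis
    moreover have "b (norm (f y)) (norm (g y)) \<le> b C D" by (intro b) (use 1 2 h fg in auto)
    ultimately show ?thesis by simp
  qed
  then show "\<exists>d>0. \<exists>C. \<forall>y\<in>S. dist y x < d \<longrightarrow> (\<forall>f\<in>H. norm (f y) \<le> C)"
    using 1(1) 2(1) by (intro exI[of _ "min d e"] conjI exI[of _ "b C D"]) auto
qed

lemma equi_Ck_add:
  assumes "open S" "equi_Ck m S F" "equi_Ck m S G"
    "\<And>h. h \<in> H \<Longrightarrow> \<exists>f\<in>F. \<exists>g\<in>G. \<forall>x\<in>S. h x = f x + g x"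
  shows "equi_Ck m S H"
  using assms(2-)
proof (induction m arbitrary: F G H)
  have *: "loc_bdd S H" if "loc_bdd S F" "loc_bdd S G"
    "\<And>h. h \<in> H \<Longrightarrow> \<exists>f\<in>F. \<exists>g\<in>G. \<forall>x\<in>S. h x = f x + g x" for H F and G :: "('a \<Rightarrow> 'b) set"
    by (rule loc_bdd_comp2[OF that(1,2), of _ "(+)"]) (use that(3) norm_triangle_ineq in \<open>metis,
        auto\<close>)
  {
    case 0
    then show ?case using *[of F G H] by simp
  next
    case (Suc m)
    obtain F' f' where F: "loc_bdd S F" "equi_Ck m S F'"
      "\<And>f x. f \<in> F \<Longrightarrow> x \<in> S \<Longrightarrow> (f has_derivative f' f x) (at x)"
      "\<And>f h. f \<in> F \<Longrightarrow> norm h \<le> 1 \<Longrightarrow> \<exists>g\<in>F'. \<forall>x\<in>S. g x = f' f x h"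
      using Suc.prems(1) by (rule equi_Ck_SucE) (rule that)
    obtain G' g' where G: "loc_bdd S G" "equi_Ck m S G'"
      "\<And>f x. f \<in> G \<Longrightarrow> x \<in> S \<Longrightarrow> (f has_derivative g' f x) (at x)"
      "\<And>f h. f \<in> G \<Longrightarrow> norm h \<le> 1 \<Longrightarrow> \<exists>g\<in>G'. \<forall>x\<in>S. g x = g' f x h"
      using Suc.prems(2) by (rule equi_Ck_SucE) (rule that)
    obtain a b where ab: "\<And>h. h \<in> H \<Longrightarrow> a h \<in> F" "\<And>h. h \<in> H \<Longrightarrow> b h \<in> G"
      "\<And>h x. h \<in> H \<Longrightarrow> x \<in> S \<Longrightarrow> h x = a h x + b h x"
      using Suc.prems(3) by metis
    have "equi_Ck m S {\<lambda>x. f x + g x |f g. f \<in> F' \<and> g \<in> G'}"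
      by (rule Suc.IH[OF F(2) G(2)]) blast
    note IH = this
    show ?case
    proof (rule equi_Ck_SucI[OF *[OF F(1) G(1) Suc.prems(3)] IH,
          where f' = "\<lambda>h x v. f' (a h) x v + g' (b h) x v"])
      fix h x assume h: "h \<in> H" and x: "x \<in> S"
      show "(h has_derivative (\<lambda>v. f' (a h) x v + g' (b h) x v)) (at x)"
        by (rule has_derivative_transform_within_open
            [OF has_derivative_add[OF F(3)[OF ab(1)] G(3)[OF ab(2)]] \<open>open S\<close> x])
          (use h x ab in auto)
    next
      fix h and v :: 'a assume h: "h \<in> H" and v: "norm v \<le> 1"
      obtain p q where "p \<in> F'" "\<forall>x\<in>S. p x = f' (a h) x v" "q \<in> G'" "\<forall>x\<in>S. q x = g' (b h) x v"
        using F(4) G(4) h v ab by metis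
      then show "\<exists>g\<in>{\<lambda>x. f x + g x |f g. f \<in> F' \<and> g \<in> G'}. \<forall>x\<in>S. g x = f' (a h) x v + g' (b h) x v"
        by (intro bexI[of _ "\<lambda>x. p x + q x"]) auto
    qed auto
  }
qed

lemma smooth_family_add:
  assumes "smooth_family S I f" "smooth_family S I g"
  shows "smooth_family S I (\<lambda>i x. f i x + g i x)"
  unfolding smooth_family_def
proof (intro conjI allI)
  fix m show "equi_Ck m S ((\<lambda>i x. f i x + g i x) ` I)"
    by (rule equi_Ck_add[of _ _ "f ` I" "g ` I"]) (use assms in \<open>auto simp: smooth_family_def\<close>)
qed (use assms in \<open>simp add: smooth_family_def\<close>)

lemma (in bounded_bilinear) equi_Ck_prod:
  assumes "open S" "equi_Ck m S F" "equi_Ck m S G"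
    "\<And>h. h \<in> H \<Longrightarrow> \<exists>f\<in>F. \<exists>g\<in>G. \<forall>x\<in>S. h x = prod (f x) (g x)"
  shows "equi_Ck m S H"
  using assms(2-)
proof (induction m arbitrary: F G H)
  obtain K where K: "K \<ge> 0" "\<And>a b. norm (prod a b) \<le> norm a * norm b * K"
    using nonneg_bounded by blast
  have *: "loc_bdd S H" if "loc_bdd S F" "loc_bdd S G"
    "\<And>h. h \<in> H \<Longrightarrow> \<exists>f\<in>F. \<exists>g\<in>G. \<forall>x\<in>S. h x = prod (f x) (g x)" for H F and G :: "('d \<Rightarrow> 'b) set"
    by (rule loc_bdd_comp2[OF that(1,2), of _ "\<lambda>s t. s * t * K"])
      (use that(3) K in \<open>metis, auto intro!: mult_mono\<close>)
  {
    case 0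
    then show ?case using *[of F G H] by simp
  next
    case (Suc m)
    obtain F' f' where F: "loc_bdd S F" "equi_Ck m S F'"
      "\<And>f x. f \<in> F \<Longrightarrow> x \<in> S \<Longrightarrow> (f has_derivative f' f x) (at x)"
      "\<And>f h. f \<in> F \<Longrightarrow> norm h \<le> 1 \<Longrightarrow> \<exists>g\<in>F'. \<forall>x\<in>S. g x = f' f x h"
      using Suc.prems(1) by (rule equi_Ck_SucE) (rule that)
    obtain G' g' where G: "loc_bdd S G" "equi_Ck m S G'"
      "\<And>f x. f \<in> G \<Longrightarrow> x \<in> S \<Longrightarrow> (f has_derivative g' f x) (at x)"
      "\<And>f h. f \<in> G \<Longrightarrow> norm h \<le> 1 \<Longrightarrow> \<exists>g\<in>G'. \<forall>x\<in>S. g x = g' f x h"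
      using Suc.prems(2) by (rule equi_Ck_SucE) (rule that)
    obtain a b where ab: "\<And>h. h \<in> H \<Longrightarrow> a h \<in> F" "\<And>h. h \<in> H \<Longrightarrow> b h \<in> G"
      "\<And>h x. h \<in> H \<Longrightarrow> x \<in> S \<Longrightarrow> h x = prod (a h x) (b h x)"
      using Suc.prems(3) by metis
    \<comment> \<open>By the Leibniz rule the derivative of a product is a member of
      \<open>B\<close> plus a member of \<open>A\<close>. In each of them one factor has been
      differentiated and the other is needed to order \<open>m\<close> only.\<close>
    define A where "A = {\<lambda>x. prod (f x) (g x) |f g. f \<in> F \<and> g \<in> G'}"
    define B where "B = {\<lambda>x. prod (f x) (g x) |f g. f \<in> F' \<and> g \<in> G}"
    let ?C = "{\<lambda>x. f x + g x |f g. f \<in> A \<and> g \<in> B}"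
    have "equi_Ck m S A"
      unfolding A_def by (rule Suc.IH[OF equi_Ck_SucD[OF Suc.prems(1)] G(2)]) blast
    moreover have "equi_Ck m S B"
      unfolding B_def by (rule Suc.IH[OF F(2) equi_Ck_SucD[OF Suc.prems(2)]]) blast
    ultimately have "equi_Ck m S ?C"
      by (rule equi_Ck_add[OF \<open>open S\<close>]) blast
    note IH = this
    show ?case
    proof (rule equi_Ck_SucI[OF *[OF F(1) G(1) Suc.prems(3)] IH,
          where f' = "\<lambda>h x v. prod (a h x) (g' (b h) x v) + prod (f' (a h) x v) (b h x)"])
      fix h x assume h: "h \<in> H" and x: "x \<in> S"
      show "(h has_derivative
          (\<lambda>v. prod (a h x) (g' (b h) x v) + prod (f' (a h) x v) (b h x))) (at x)"
        by (rule has_derivative_transform_within_open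
            [OF FDERIV[OF F(3)[OF ab(1)] G(3)[OF ab(2)]] \<open>open S\<close> x])
          (use h x ab in auto)
    next
      fix h and v :: 'd assume h: "h \<in> H" and v: "norm v \<le> 1"
      obtain p q where pq: "p \<in> F'" "\<forall>x\<in>S. p x = f' (a h) x v" "q \<in> G'" "\<forall>x\<in>S. q x = g' (b h) x v"
        using F(4) G(4) h v ab by metis
      then have "(\<lambda>x. prod (a h x) (q x)) \<in> A" "(\<lambda>x. prod (p x) (b h x)) \<in> B"
        unfolding A_def B_def using ab(1,2)[OF h] by blast+
      then have "(\<lambda>x. prod (a h x) (q x) + prod (p x) (b h x)) \<in> ?C"
        by (intro CollectI exI conjI) (rule refl)
      then show "\<exists>g\<in>?C. \<forall>x\<in>S. g x = prod (a h x) (g' (b h) x v) + prod (f' (a h) x v) (b h x)"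
        by (rule bexI[rotated]) (use pq in auto)
    qed auto
  }
qed

lemma (in bounded_bilinear) smooth_family_prod:
  assumes "smooth_family S I f" "smooth_family S I g"
  shows "smooth_family S I (\<lambda>i x. prod (f i x) (g i x))"
  unfolding smooth_family_def
proof (intro conjI allI)
  fix m show "equi_Ck m S ((\<lambda>i x. prod (f i x) (g i x)) ` I)"
    by (rule equi_Ck_prod[of _ _ "f ` I" "g ` I"]) (use assms in \<open>auto simp: smooth_family_def\<close>)
qed (use assms in \<open>simp add: smooth_family_def\<close>)

lemmas smooth_family_mult = bounded_bilinear.smooth_family_prod[OF bounded_bilinear_mult]
lemmas smooth_family_scaleR = bounded_bilinear.smooth_family_prod[OF bounded_bilinear_scaleR]
lemmas smooth_family_inner = bounded_bilinear.smooth_family_prod[OF bounded_bilinear_inner]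

lemma smooth_family_bounded_linear:
  assumes L: "bounded_linear L" and f: "smooth_family S I f"
  shows "smooth_family S I (\<lambda>i x. L (f i x))"
proof -
  interpret L: bounded_linear L by fact
  \<comment> \<open>Application of \<open>L\<close> is presented as a product with the constant 1,
    which reduces the claim to the Leibniz rule for bilinear maps.\<close>
  have "bounded_bilinear (\<lambda>(a::real) y. a *\<^sub>R L y)"
    by (rule bounded_bilinear.comp[OF bounded_bilinear_scaleR bounded_linear_ident L])
  then have "smooth_family S I (\<lambda>i x. (\<lambda>(a::real) y. a *\<^sub>R L y) 1 (f i x))"
    by (rule bounded_bilinear.smooth_family_prod)
      (use f smooth_family_const[of S I "\<lambda>_. 1::real" 1] in \<open>auto simp: smooth_family_def\<close>)
  then show ?thesis by simp
qed

lemma smooth_family_uminus: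
  "smooth_family S I f \<Longrightarrow> smooth_family S I (\<lambda>i x. - f i x)"
  by (rule smooth_family_bounded_linear[OF bounded_linear_minus[OF bounded_linear_ident]])

lemma smooth_family_diff:
  assumes "smooth_family S I f" "smooth_family S I g"
  shows "smooth_family S I (\<lambda>i x. f i x - g i x)"
  using smooth_family_add[OF assms(1) smooth_family_uminus[OF assms(2)]] by simp

lemma smooth_family_sum:
  assumes "finite J" "open S" "\<And>j. j \<in> J \<Longrightarrow> smooth_family S I (\<lambda>i. f i j)"
  shows "smooth_family S I (\<lambda>i x. \<Sum>j\<in>J. f i j x)"
  using assms(1,3)
proof (induction J)
  case empty
  show ?case by (simp add: smooth_family_const[where C = 0] assms(2))
next
  case (insert j J)
  then have "smooth_family S I (\<lambda>i x. f i j x + (\<Sum>j\<in>J. f i j x))"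
    by (intro smooth_family_add) auto
  then show ?case using insert.hyps by simp
qed

lemma smooth_family_imp_continuous_on:
  assumes "smooth_family S I f" "i \<in> I"
  shows "continuous_on S (f i)"
proof -
  have "equi_Ck (Suc 0) S (f ` I)" using assms unfolding smooth_family_def by simp
  then obtain F where "\<And>g x. g \<in> f ` I \<Longrightarrow> x \<in> S \<Longrightarrow> (g has_derivative F g x) (at x)"
    by (rule equi_Ck_SucE) (rule that)
  then have "\<And>x. x \<in> S \<Longrightarrow> (f i has_derivative F (f i) x) (at x)" using assms(2) by simp
  then show ?thesis
    by (rule has_derivative_continuous_on[OF has_derivative_at_withinI])
qed

section \<open>Composition with functions of one variable\<close>

lemma smooth_family_equi_Ck: "smooth_family S I f \<Longrightarrow> equi_Ck m S (f ` I)"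
  by (simp add: smooth_family_def)

lemma smooth_familyI: "open S \<Longrightarrow> (\<And>m. equi_Ck m S (f ` I)) \<Longrightarrow> smooth_family S I f"
  by (simp add: smooth_family_def)

lemma smooth_family_open: "smooth_family S I f \<Longrightarrow> open S"
  by (simp add: smooth_family_def)

text \<open>One step of the chain rule. The outer function \<open>g\<close> may vary with
  \<open>h\<close> and is not controlled itself; only its derivative along the inner function has to
  lie in a family of order \<open>m\<close>. This freedom is used for logarithms whose scale depends
  on the index.\<close>

lemma equi_Ck_Suc_comp:
  fixes F :: "('a::real_normed_vector \<Rightarrow> 'b::real_normed_field) set"
  assumes S: "open S" and F: "equi_Ck (Suc m) S F" and H: "loc_bdd S H" and K: "equi_Ck m S K"
    and comp: "\<And>h. h \<in> H \<Longrightarrow> \<exists>f\<in>F. \<exists>k\<in>K. \<exists>g. \<forall>x\<in>S. h x = g (f x) \<and>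
       (g has_field_derivative k x) (at (f x))"
  shows "equi_Ck (Suc m) S H"
proof -
  obtain F' f' where F': "loc_bdd S F" "equi_Ck m S F'"
    "\<And>f x. f \<in> F \<Longrightarrow> x \<in> S \<Longrightarrow> (f has_derivative f' f x) (at x)"
    "\<And>f h. f \<in> F \<Longrightarrow> norm h \<le> 1 \<Longrightarrow> \<exists>g\<in>F'. \<forall>x\<in>S. g x = f' f x h"
    using F by (rule equi_Ck_SucE) (rule that)
  have "\<forall>h\<in>H. \<exists>p. fst p \<in> F \<and> snd p \<in> K \<and> (\<exists>g. \<forall>x\<in>S. h x = g (fst p x) \<and>
       (g has_field_derivative snd p x) (at (fst p x)))"
    using comp by (metis fst_conv snd_conv)
  from bchoice[OF this] obtain p where p: "\<forall>h\<in>H. fst (p h) \<in> F \<and> snd (p h) \<in> K \<and>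
      (\<exists>g. \<forall>x\<in>S. h x = g (fst (p h) x) \<and> (g has_field_derivative snd (p h) x) (at (fst (p h) x)))"
    by (rule exE)
  define G where "G = {\<lambda>x. k x * g x |k g. k \<in> K \<and> g \<in> F'}"
  have G: "equi_Ck m S G"
    by (rule bounded_bilinear.equi_Ck_prod[OF bounded_bilinear_mult S K F'(2)])
      (unfold G_def, blast)
  show ?thesis
  proof (rule equi_Ck_SucI[OF H G, where f' = "\<lambda>h x v. snd (p h) x * f' (fst (p h)) x v"])
    fix h x assume h: "h \<in> H" and x: "x \<in> S"
    obtain g where g: "\<forall>x\<in>S. h x = g (fst (p h) x) \<and>
        (g has_field_derivative snd (p h) x) (at (fst (p h) x))"
      using p h by blast
    have 1: "(g has_derivative (*) (snd (p h) x)) (at (fst (p h) x))"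
      using g x by (simp add: has_field_derivative_def)
    have 2: "(fst (p h) has_derivative f' (fst (p h)) x) (at x)"
      using p h x by (intro F'(3)) auto
    show "(h has_derivative (\<lambda>v. snd (p h) x * f' (fst (p h)) x v)) (at x)"
      by (rule has_derivative_transform_within_open[OF has_derivative_compose[OF 2 1] S x])
        (use g in auto)
  next
    fix h and v :: 'a assume h: "h \<in> H" and v: "norm v \<le> 1"
    have "fst (p h) \<in> F" "snd (p h) \<in> K" using p h by auto
    moreover obtain q where q: "q \<in> F'" "\<forall>x\<in>S. q x = f' (fst (p h)) x v"
      using F'(4) v calculation(1) by blast
    ultimately show "\<exists>g\<in>G. \<forall>x\<in>S. g x = snd (p h) x * f' (fst (p h)) x v"
      unfolding G_def by (intro bexI[of _ "\<lambda>x. snd (p h) x * q x"] CollectI exI conjI) simp_all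
  qed
qed

text \<open>\<open>G\<close> is a class of outer functions closed under differentiation. Stating the
  induction for all of its members at once is what lets the order increase.\<close>

lemma smooth_family_comp:
  fixes f :: "'i \<Rightarrow> 'a::real_normed_vector \<Rightarrow> 'b::real_normed_field"
  assumes f: "smooth_family S I f" and g: "g \<in> G"
    and bd: "\<And>g. g \<in> G \<Longrightarrow> loc_bdd S ((\<lambda>i x. g (f i x)) ` I)"
    and der: "\<And>g. g \<in> G \<Longrightarrow>
      \<exists>g'\<in>G. \<forall>i\<in>I. \<forall>x\<in>S. (g has_field_derivative g' (f i x)) (at (f i x))"
  shows "smooth_family S I (\<lambda>i x. g (f i x))"
proof (rule smooth_familyI)
  show S: "open S" using f by (rule smooth_family_open)
  fix m
  show "equi_Ck m S ((\<lambda>i x. g (f i x)) ` I)" using g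
  proof (induction m arbitrary: g)
    case 0
    then show ?case using bd by simp
  next
    case (Suc m)
    obtain g' where g': "g' \<in> G"
      "\<forall>i\<in>I. \<forall>x\<in>S. (g has_field_derivative g' (f i x)) (at (f i x))"
      using der[OF Suc.prems] by blast
    show ?case
    proof (rule equi_Ck_Suc_comp[OF S smooth_family_equi_Ck[OF f] bd[OF Suc.prems] Suc.IH[OF
        g'(1)]])
      fix h assume "h \<in> (\<lambda>i x. g (f i x)) ` I"
      then obtain i where i: "i \<in> I" "h = (\<lambda>x. g (f i x))" by blast
      then show "\<exists>k\<in>f ` I. \<exists>l\<in>(\<lambda>i x. g' (f i x)) ` I. \<exists>g. \<forall>x\<in>S. h x = g (k x) \<and>
          (g has_field_derivative l x) (at (k x))"
        using g'(2) by (intro bexI[of _ "f i"] bexI[of _ "\<lambda>x. g' (f i x)"] exI[of _ g]) auto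
    qed
  qed
qed

lemma loc_bdd_family:
  assumes "\<And>i x. i \<in> I \<Longrightarrow> x \<in> S \<Longrightarrow> norm (f i x) \<le> B"
  shows "loc_bdd S (f ` I)"
  by (rule loc_bddI) (intro exI[of _ 1] conjI exI[of _ B], use assms in auto)

lemma smooth_family_powr:
  fixes f :: "'i \<Rightarrow> 'a::real_normed_vector \<Rightarrow> real"
  assumes f: "smooth_family S I f" and c: "0 < c"
    and bds: "\<And>i x. i \<in> I \<Longrightarrow> x \<in> S \<Longrightarrow> c \<le> f i x \<and> f i x \<le> C"
  shows "smooth_family S I (\<lambda>i x. f i x powr a)"
proof -
  \<comment> \<open>The factor 1 exhibits the power as a member of the class of all multiples of
    powers, which is closed under differentiation.\<close>
  have "smooth_family S I (\<lambda>i x. (\<lambda>t. 1 * t powr a) (f i x))"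
  proof (rule smooth_family_comp[OF f, where G = "{\<lambda>t. b * t powr a |a b. True}"])
    fix g :: "real \<Rightarrow> real" assume "g \<in> {\<lambda>t. b * t powr a |a b. True}"
    then obtain a b where g: "g = (\<lambda>t. b * t powr a)" by blast
    have "norm (g (f i x)) \<le> \<bar>b\<bar> * (c powr a + C powr a)" if "i \<in> I" "x \<in> S" for i x
    proof -
      \<comment> \<open>A power is largest at \<open>C\<close> or at \<open>c\<close> according to
        the sign of the exponent; the sum covers both cases.\<close>
      have "f i x powr a \<le> c powr a + C powr a"
      proof (cases "a \<ge> 0")
        case True
        then have "f i x powr a \<le> C powr a" using bds[OF that] c by (intro powr_mono2) auto
        then show ?thesis by (simp add: add_increasing)
      next
        case False
        then have "f i x powr a \<le> c powr a" using bds[OF that] c by (intro powr_mono2') auto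
        then show ?thesis by (simp add: add_increasing2)
      qed
      then show ?thesis by (simp add: g abs_mult mult_left_mono)
    qed
    then show "loc_bdd S ((\<lambda>i x. g (f i x)) ` I)" by (rule loc_bdd_family)
    have "(g has_field_derivative (b * a) * f i x powr (a - 1)) (at (f i x))" if "i \<in> I" "x \<in> S" for
        i x
      using DERIV_cmult[OF has_real_derivative_powr, of "f i x" b a] bds[OF that] c
      by (simp add: g mult.assoc)
    then show "\<exists>g'\<in>{\<lambda>t. b * t powr a |a b. True}. \<forall>i\<in>I. \<forall>x\<in>S.
        (g has_field_derivative g' (f i x)) (at (f i x))"
      by (intro bexI[of _ "\<lambda>t. (b * a) * t powr (a - 1)"]) blast+
  qed blast
  then show ?thesis by simp
qed

lemma smooth_family_inverse:
  fixes f :: "'i \<Rightarrow> 'a::real_normed_vector \<Rightarrow> 'b::real_normed_field"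
  assumes f: "smooth_family S I f" and c: "0 < c"
    and bds: "\<And>i x. i \<in> I \<Longrightarrow> x \<in> S \<Longrightarrow> c \<le> norm (f i x)"
  shows "smooth_family S I (\<lambda>i x. inverse (f i x))"
proof -
  have "smooth_family S I (\<lambda>i x. (\<lambda>t. 1 * inverse t ^ 1) (f i x))"
  proof (rule smooth_family_comp[OF f, where G = "{\<lambda>t. b * inverse t ^ n |b n. True}"])
    fix g :: "'b \<Rightarrow> 'b" assume "g \<in> {\<lambda>t. b * inverse t ^ n |b n. True}"
    then obtain b n where g: "g = (\<lambda>t. b * inverse t ^ n)" by blast
    have "norm (g (f i x)) \<le> norm b * inverse c ^ n" if "i \<in> I" "x \<in> S" for i x
      unfolding g norm_mult norm_power norm_inverse
      by (intro mult_left_mono power_mono le_imp_inverse_le) (use bds[OF that] c in auto)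
    then show "loc_bdd S ((\<lambda>i x. g (f i x)) ` I)" by (rule loc_bdd_family)
    have "(g has_field_derivative (- b * of_nat n) * inverse (f i x) ^ Suc n) (at (f i x))"
      if "i \<in> I" "x \<in> S" for i x
    proof -
      have nz: "f i x \<noteq> 0" using bds[OF that] c by auto
      have 1: "(g has_field_derivative
          b * (of_nat n * (- (inverse (f i x) ^ Suc (Suc 0)) * inverse (f i x) ^ (n - Suc 0)))) (at
              (f i x))"
        unfolding g by (intro DERIV_cmult DERIV_power DERIV_inverse nz)
      \<comment> \<open>For \<open>n = 0\<close> both sides vanish; otherwise the exponents 2 and
        \<open>n - 1\<close> add up to \<open>Suc n\<close>.\<close>
      have 2: "b * (of_nat n * (- (inverse (f i x) ^ Suc (Suc 0)) * inverse (f i x) ^ (n - Suc 0)))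
          = (- b * of_nat n) * inverse (f i x) ^ Suc n"
        by (cases n) simp_all
      show ?thesis using 1 unfolding 2 .
    qed
    then show "\<exists>g'\<in>{\<lambda>t. b * inverse t ^ n |b n. True}. \<forall>i\<in>I. \<forall>x\<in>S.
        (g has_field_derivative g' (f i x)) (at (f i x))"
      by (intro bexI[of _ "\<lambda>t. (- b * of_nat n) * inverse t ^ Suc n"]) blast+
  qed blast
  then show ?thesis by simp
qed

lemma smooth_family_exp:
  fixes f :: "'i \<Rightarrow> 'a::real_normed_vector \<Rightarrow> complex"
  assumes f: "smooth_family S I f"
  shows "smooth_family S I (\<lambda>i x. exp (f i x))"
proof (rule smooth_family_comp[OF f, where G = "{exp}"])
  fix g :: "complex \<Rightarrow> complex" assume g: "g \<in> {exp}"
  note bd = equi_Ck_loc_bdd[OF smooth_family_equi_Ck[OF f]]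
  show "loc_bdd S ((\<lambda>i x. g (f i x)) ` I)"
    by (rule loc_bdd_comp2[OF bd bd, where b = "\<lambda>s t. exp s"])
      (use g in \<open>auto simp: norm_exp intro!: complex_Re_le_cmod\<close>)
  show "\<exists>g'\<in>{exp}. \<forall>i\<in>I. \<forall>x\<in>S. (g has_field_derivative g' (f i x)) (at (f i x))"
    using g by (auto intro: DERIV_exp)
qed simp

text \<open>The scales \<open>d i\<close> may be unbounded. The estimates remain uniform because, as
  a function of \<open>z = p i x\<close>, the remainder is at most
  \<open>2 * (norm z)\<^sup>2\<close> and has derivative \<open>- z / (1 + z / d i)\<close>: the
  factor \<open>(d i)\<^sup>2\<close> is exactly compensated by the quadratic order of the
  remainder.\<close>

lemma smooth_family_Ln_remainder:
  fixes p :: "'i \<Rightarrow> 'a::real_normed_vector \<Rightarrow> complex"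
  assumes p: "smooth_family S I p" and c: "0 < c" "\<And>i. i \<in> I \<Longrightarrow> c \<le> d i"
    and pd: "\<And>i x. i \<in> I \<Longrightarrow> x \<in> S \<Longrightarrow> norm (p i x) \<le> d i / 2"
  shows "smooth_family S I (\<lambda>i x. of_real ((d i)\<^sup>2) * (Ln (1 + p i x / of_real (d i)) - p i x /
      of_real (d i)))"
    (is "smooth_family S I ?h")
proof (rule smooth_familyI)
  show S: "open S" using p by (rule smooth_family_open)
  have dpos: "d i > 0" if "i \<in> I" for i using c that by fastforce
  have half: "norm (p i x / of_real (d i)) \<le> 1 / 2" if "i \<in> I" "x \<in> S" for i x
    using pd[OF that] dpos[OF that(1)] by (simp add: norm_divide divide_simps)
  have low: "1 / 2 \<le> norm (1 + p i x / of_real (d i))" if "i \<in> I" "x \<in> S" for i x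
    using half[OF that] norm_triangle_ineq2[of 1 "- (p i x / of_real (d i))"] by simp
  have cinv: "norm (inverse (complex_of_real (d i))) \<le> inverse c" if "i \<in> I" for i
    using c(1) c(2)[OF that] dpos[OF that] by (simp add: norm_inverse le_imp_inverse_le)
  have scaled: "smooth_family S I (\<lambda>i x. p i x * inverse (of_real (d i)))"
    by (intro smooth_family_mult p smooth_family_const[OF S]) (rule cinv)
  have "smooth_family S I (\<lambda>_ _. 1 :: complex)"
    using smooth_family_const[OF S, of I "\<lambda>_. 1 :: complex" 1] by simp
  from smooth_family_add[OF this scaled]
  have "smooth_family S I (\<lambda>i x. inverse (1 + p i x * inverse (of_real (d i))))"
  proof (rule smooth_family_inverse)
    show "0 < (1 / 2 :: real)" by simp
    show "1 / 2 \<le> norm (1 + p i x * inverse (of_real (d i)))" if "i \<in> I" "x \<in> S" for i x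
      using low[OF that] by (simp only: divide_inverse[of "p i x"])
  qed
  from smooth_family_mult[OF smooth_family_uminus[OF p] this]
  have K: "smooth_family S I (\<lambda>i x. - p i x * inverse (1 + p i x * inverse (of_real (d i))))"
    (is "smooth_family S I ?k") .
  have bd: "loc_bdd S (?h ` I)"
  proof (rule loc_bdd_comp2[where b = "\<lambda>s t. 2 * s\<^sup>2"])
    show "loc_bdd S (p ` I)" "loc_bdd S (p ` I)"
      using equi_Ck_loc_bdd[OF smooth_family_equi_Ck[OF p]] by blast+
  next
    have *: "norm (?h i x) \<le> 2 * (norm (p i x))\<^sup>2" if i: "i \<in> I" and x: "x \<in> S" for i x
    proof -
      let ?z = "p i x / of_real (d i)"
      have "norm (Ln (1 + ?z) - ?z) \<le> (norm ?z)\<^sup>2 / (1 - norm ?z)"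
        using half[OF i x] by (intro Ln_approx_linear) simp
      also have "\<dots> \<le> (norm ?z)\<^sup>2 / (1 / 2)"
        using half[OF i x] by (intro divide_left_mono) auto
      finally have "norm (?h i x) \<le> (d i)\<^sup>2 * ((norm ?z)\<^sup>2 / (1 / 2))"
        by (simp only: norm_mult norm_of_real power2_eq_square abs_mult_self_eq abs_mult) (rule
            mult_left_mono, auto)
      also have "\<dots> = 2 * (norm (p i x))\<^sup>2"
        using dpos[OF i] by (simp add: norm_divide power_divide)
      finally show ?thesis .
    qed
    fix h assume "h \<in> ?h ` I"
    then obtain i where i: "i \<in> I" "h = ?h i" by blast
    show "\<exists>f\<in>p ` I. \<exists>g\<in>p ` I. \<forall>x\<in>S. norm (h x) \<le> 2 * (norm (f x))\<^sup>2"
      using * i by (intro bexI[of _ "p i"]) auto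
  qed auto
  fix m show "equi_Ck m S (?h ` I)"
  \<comment> \<open>The family of derivatives is already known to be smooth of all orders, so a
    single use of the chain rule suffices.\<close>
  proof (rule equi_Ck_SucD, rule equi_Ck_Suc_comp[OF S smooth_family_equi_Ck[OF p] bd
      smooth_family_equi_Ck[OF K]])
    fix h assume "h \<in> ?h ` I"
    then obtain i where i: "i \<in> I" "h = ?h i" by blast
    let ?g = "\<lambda>z. of_real ((d i)\<^sup>2) * (Ln (1 + z / of_real (d i)) - z / of_real (d i))"
    have "(?g has_field_derivative ?k i x) (at (p i x))" if x: "x \<in> S" for x
    proof -
      let ?w = "1 + p i x / of_real (d i)"
      have "\<bar>Re (p i x / of_real (d i))\<bar> \<le> 1 / 2"
        using abs_Re_le_cmod half[OF i(1) x] by (rule order_trans)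
      then have "Re ?w > 0" unfolding plus_complex.sel one_complex.sel by linarith
      moreover from this have "?w \<noteq> 0" by (metis zero_complex.sel(1) less_irrefl)
      ultimately have nz: "?w \<notin> \<real>\<^sub>\<le>\<^sub>0" "?w \<noteq> 0"
        unfolding complex_nonpos_Reals_iff by (simp_all only: not_le[symmetric] simp_thms)
      have d0: "complex_of_real (d i) \<noteq> 0" using dpos[OF i(1)] by simp
      have lin: "((\<lambda>z. z / of_real (d i)) has_field_derivative 1 / of_real (d i)) (at (p i x))"
        by (rule DERIV_cdivide[OF DERIV_ident])
      have "((\<lambda>z. 1 + z / of_real (d i)) has_field_derivative 1 / of_real (d i)) (at (p i x))"
        using DERIV_add[OF DERIV_const lin, of 1] by simp
      from DERIV_chain2[OF has_field_derivative_Ln[OF nz(1)] this]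
      have "((\<lambda>z. Ln (1 + z / of_real (d i))) has_field_derivative inverse ?w * (1 / of_real (d i)))
          (at (p i x))" .
      from DERIV_cmult[OF DERIV_diff[OF this lin]]
      have "(?g has_field_derivative of_real ((d i)\<^sup>2) * (inverse ?w * (1 / of_real (d i)) - 1 /
          of_real (d i))) (at (p i x))" .
      moreover have "of_real ((d i)\<^sup>2) * (inverse ?w * (1 / of_real (d i)) - 1 / of_real (d i)) = ?k
          i x"
      proof -
        have "inverse ?w - 1 = - (p i x / of_real (d i)) * inverse ?w"
          using nz(2) by (simp add: field_simps)
        then have e1: "of_real (d i) * (inverse ?w - 1) = - p i x * inverse ?w" using d0 by simp
        have e2: "D\<^sup>2 * (W * (1 / D) - 1 / D) = D * (W - 1)" if "D \<noteq> 0" for D W :: complex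
          using that by (simp add: power2_eq_square field_simps)
        show ?thesis using e1 unfolding of_real_power e2[OF d0] by (simp only: divide_inverse)
      qed
      ultimately show ?thesis by simp
    qed
    with i show "\<exists>f\<in>p ` I. \<exists>k\<in>?k ` I. \<exists>g. \<forall>x\<in>S. h x = g (f x) \<and> (g has_field_derivative k x) (at (f
        x))"
      by (intro bexI[of _ "p i"] bexI[of _ "?k i"] exI[of _ ?g]) auto
  qed
qed

section \<open>From uniform families to Frechet smoothness in operator norm\<close>

lemma loc_bdd_at:
  assumes "loc_bdd S F" "x \<in> S"
  obtains C where "C \<ge> 0" "\<And>f. f \<in> F \<Longrightarrow> norm (f x) \<le> C"
proof -
  obtain d C where "d > 0" "C \<ge> 0" "\<And>y f. y \<in> S \<Longrightarrow> dist y x < d \<Longrightarrow> f \<in> F \<Longrightarrow> norm (f y) \<le> C"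
    using assms by (rule loc_bddE) (rule that)
  then show ?thesis using assms(2) by (intro that[of C]) auto
qed

lemma linear_bound_from_ball:
  assumes "linear L" "\<And>h. norm h \<le> 1 \<Longrightarrow> norm (L h) \<le> C"
  shows "norm (L v) \<le> C * norm v"
proof -
  have "norm (L (sgn v)) \<le> C" by (intro assms(2)) (simp add: norm_sgn)
  moreover have "L v = norm v *\<^sub>R L (sgn v)"
    by (cases "v = 0") (simp_all add: linear_scale[OF assms(1), symmetric] linear_0[OF assms(1)]
        sgn_div_norm)
  ultimately show ?thesis
    using mult_left_mono[of "norm (L (sgn v))" C "norm v"] by (simp add: mult.commute)
qed

text \<open>The uniform second order bound is what makes series of functions differentiable.\<close>

lemma equi_Ck_remainder:
  fixes F :: "('a::real_normed_vector \<Rightarrow> 'b::real_normed_vector) set"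
  assumes S: "open S" and F: "equi_Ck (Suc (Suc 0)) S F" and x: "x \<in> S"
  obtains d C where "d > 0" "C \<ge> 0"
    "\<And>f f' y. f \<in> F \<Longrightarrow> (f has_derivative f') (at x) \<Longrightarrow> dist y x < d \<Longrightarrow>
        y \<in> S \<and> norm (f y - f x - f' (y - x)) \<le> C * (norm (y - x))\<^sup>2"
proof -
  obtain F' f' where F': "loc_bdd S F" "equi_Ck (Suc 0) S F'"
    "\<And>f x. f \<in> F \<Longrightarrow> x \<in> S \<Longrightarrow> (f has_derivative f' f x) (at x)"
    "\<And>f h. f \<in> F \<Longrightarrow> norm h \<le> 1 \<Longrightarrow> \<exists>g\<in>F'. \<forall>x\<in>S. g x = f' f x h"
    using F by (rule equi_Ck_SucE) (rule that)
  obtain F'' g' where F'': "loc_bdd S F'" "equi_Ck 0 S F''"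
    "\<And>f x. f \<in> F' \<Longrightarrow> x \<in> S \<Longrightarrow> (f has_derivative g' f x) (at x)"
    "\<And>f h. f \<in> F' \<Longrightarrow> norm h \<le> 1 \<Longrightarrow> \<exists>g\<in>F''. \<forall>x\<in>S. g x = g' f x h"
    using F'(2) by (rule equi_Ck_SucE) (rule that)
  obtain e C where e: "e > 0" "C \<ge> 0"
    "\<And>y f. y \<in> S \<Longrightarrow> dist y x < e \<Longrightarrow> f \<in> F'' \<Longrightarrow> norm (f y) \<le> C"
    using equi_Ck_loc_bdd[OF F''(2)] x by (rule loc_bddE) (rule that)
  obtain r where r: "r > 0" "ball x r \<subseteq> S" using S x openE by blast
  define d where "d = min e r"
  have d: "d > 0" "\<And>y. dist y x < d \<Longrightarrow> y \<in> S \<and> dist y x < e"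
    using e r by (auto simp: d_def dist_commute subset_iff)
  \<comment> \<open>Near \<open>x\<close> the second derivatives in unit directions are bounded by
    \<open>C\<close>, which makes the first derivatives Lipschitz with the same constant.\<close>
  have lip: "norm (g y - g x) \<le> C * norm (y - x)" if g: "g \<in> F'" and y: "dist y x < d" for g y
  proof (rule differentiable_bound[where S = "ball x d" and f' = "g' g"])
    fix z assume "z \<in> ball x d"
    then have "dist z x < d" by (simp add: dist_commute)
    then have z: "z \<in> S" "dist z x < e" using d(2) by blast+
    show der: "(g has_derivative g' g z) (at z within ball x d)"
      by (rule has_derivative_at_withinI[OF F''(3)[OF g z(1)]])
    have "norm (g' g z v) \<le> C * norm v" for v
    proof (rule linear_bound_from_ball)
      show "linear (g' g z)" using F''(3)[OF g z(1)] by (rule has_derivative_linear)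
      fix h :: 'a assume "norm h \<le> 1"
      then obtain k where "k \<in> F''" "\<forall>x\<in>S. k x = g' g x h" using F''(4) g by blast
      then show "norm (g' g z h) \<le> C" using e(3) z by metis
    qed
    then show "onorm (g' g z) \<le> C" by (rule onorm_bound[OF e(2)])
  qed (use y d in \<open>auto simp: dist_commute\<close>)
  have "norm (f y - f x - D (y - x)) \<le> C * (norm (y - x))\<^sup>2"
    if f: "f \<in> F" and D: "(f has_derivative D) (at x)" and y: "dist y x < d" for f D y
  proof -
    have D: "D = f' f x" using D F'(3)[OF f x] by (rule has_derivative_unique)
    have lin: "linear (f' f z)" if "z \<in> S" for z using F'(3)[OF f that] by (rule
        has_derivative_linear)
    \<comment> \<open>On this ball the derivative of \<open>f - D\<close> has norm at most
      \<open>C * norm (y - x)\<close>; the mean value inequality contributes the second factor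
      \<open>norm (y - x)\<close>.\<close>
    let ?B = "cball x (norm (y - x))"
    have B: "z \<in> S \<and> dist z x < d" if "z \<in> ?B" for z
    proof -
      have "dist z x < d" using that y by (simp add: dist_commute dist_norm norm_minus_commute)
      then show ?thesis using d(2) by blast
    qed
    have "norm ((f y - D y) - (f x - D x)) \<le> (C * norm (y - x)) * norm (y - x)"
    proof (rule differentiable_bound[where S = ?B and f' = "\<lambda>z v. f' f z v - f' f x v"])
      fix z assume z: "z \<in> ?B"
      show "((\<lambda>z. f z - D z) has_derivative (\<lambda>v. f' f z v - f' f x v)) (at z within ?B)"
        unfolding D
        by (intro has_derivative_diff has_derivative_at_withinI[OF F'(3)[OF f]]
            has_derivative_bounded_linear has_derivative_bounded_linear[OF F'(3)[OF f x]]
            bounded_linear_imp_has_derivative)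
          (use B z in auto)
      have "norm (f' f z v - f' f x v) \<le> C * norm (y - x) * norm v" for v
      proof (rule linear_bound_from_ball)
        show "linear (\<lambda>v. f' f z v - f' f x v)" using B[OF z] x by (intro linear_compose_sub lin)
            auto
        fix h :: 'a assume "norm h \<le> 1"
        then obtain k where k: "k \<in> F'" "\<forall>x\<in>S. k x = f' f x h" using F'(4) f by blast
        have "norm (k z - k x) \<le> C * norm (z - x)" using B[OF z] by (intro lip k) auto
        also have "\<dots> \<le> C * norm (y - x)"
          using z e by (intro mult_left_mono) (auto simp: dist_commute dist_norm norm_minus_commute)
        finally show "norm (f' f z h - f' f x h) \<le> C * norm (y - x)" using k B[OF z] x by simp
      qed
      then show "onorm (\<lambda>v. f' f z v - f' f x v) \<le> C * norm (y - x)"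
        by (rule onorm_bound[rotated]) (use e in simp)
    qed (auto simp: dist_norm norm_minus_commute)
    then show ?thesis
      unfolding D linear_diff[OF lin[OF x]] by (simp add: power2_eq_square algebra_simps)
  qed
  then show ?thesis using d by (intro that[of d C]) (use e in auto)
qed

text \<open>The witness for \<open>D\<close> in \<open>smooth_on\<close>. The head of the list is
  the direction differentiated last, as the clauses on \<open>D (h # vs)\<close> demand.\<close>

primrec iter_D :: "('a::real_normed_vector \<Rightarrow> 'b::real_normed_vector) \<Rightarrow> 'a list \<Rightarrow> 'a \<Rightarrow> 'b" where
  "iter_D f [] = f"
| "iter_D f (h # vs) = (\<lambda>x. frechet_derivative (iter_D f vs) (at x) h)"

lemma equi_Ck_frechet_derivative:
  fixes F :: "('a::real_normed_vector \<Rightarrow> 'b::real_normed_vector) set"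
  assumes S: "open S" and F: "equi_Ck (Suc m) S F"
  shows "equi_Ck m S {\<lambda>x. frechet_derivative f (at x) h |f h. f \<in> F \<and> norm h \<le> R}"
proof -
  obtain F' f' where F': "loc_bdd S F" "equi_Ck m S F'"
    "\<And>f x. f \<in> F \<Longrightarrow> x \<in> S \<Longrightarrow> (f has_derivative f' f x) (at x)"
    "\<And>f h. f \<in> F \<Longrightarrow> norm h \<le> 1 \<Longrightarrow> \<exists>g\<in>F'. \<forall>x\<in>S. g x = f' f x h"
    using F by (rule equi_Ck_SucE) (rule that)
  \<comment> \<open>\<open>equi_Ck\<close> controls directions of norm at most 1. Longer ones are
    rescaled by \<open>M\<close>, which is kept at least 1 so that it is invertible.\<close>
  define M where "M = max R 1"
  have "equi_Ck m S {\<lambda>_::'a. M}" by (rule equi_Ck_const[OF S, of _ M]) (auto intro!: exI[of _ M]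
      simp: M_def)
  then show ?thesis
  proof (rule bounded_bilinear.equi_Ck_prod[OF bounded_bilinear_scaleR S _ F'(2)])
    fix k assume "k \<in> {\<lambda>x. frechet_derivative f (at x) h |f h. f \<in> F \<and> norm h \<le> R}"
    then obtain f h where f: "f \<in> F" "norm h \<le> R" "k = (\<lambda>x. frechet_derivative f (at x) h)" by blast
    have M: "M > 0" "R \<le> M" by (auto simp: M_def)
    have "norm (h /\<^sub>R M) \<le> 1" using f(2) M by (simp add: divide_simps)
    then obtain g where g: "g \<in> F'" "\<forall>x\<in>S. g x = f' f x (h /\<^sub>R M)" using F'(4) f(1) by blast
    have "k x = M *\<^sub>R g x" if x: "x \<in> S" for x
    proof -
      have d: "(f has_derivative f' f x) (at x)" using F'(3) f(1) x by blast
      have "M *\<^sub>R g x = f' f x (M *\<^sub>R (h /\<^sub>R M))"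
        using g(2) x linear_scale[OF has_derivative_linear[OF d]] by metis
      then show ?thesis using M frechet_derivative_at[OF d] f(3) by simp
    qed
    with g(1) show "\<exists>f\<in>{\<lambda>_. M}. \<exists>g\<in>F'. \<forall>x\<in>S. k x = f x *\<^sub>R g x"
      by (intro bexI[of _ "\<lambda>_. M"] bexI[of _ g]) auto
  qed
qed

lemma equi_Ck_iter_D:
  assumes S: "open S" and F: "\<And>m. equi_Ck m S F"
  shows "equi_Ck m S {iter_D f vs |f vs. f \<in> F \<and> length vs = l \<and> (\<forall>v\<in>set vs. norm v \<le> R)}"
proof (induction l arbitrary: m)
  case 0
  have "{iter_D f vs |f vs. f \<in> F \<and> length vs = 0 \<and> (\<forall>v\<in>set vs. norm v \<le> R)} = F" by auto
  then show ?case using F by simp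
next
  case (Suc l)
  show ?case
  proof (rule equi_Ck_subset[OF equi_Ck_frechet_derivative[OF S Suc.IH, of m R] S])
    fix h assume "h \<in> {iter_D f vs |f vs. f \<in> F \<and> length vs = Suc l \<and> (\<forall>v\<in>set vs. norm v \<le> R)}"
    then obtain f w ws where "f \<in> F" "length ws = l" "\<forall>v\<in>set (w # ws). norm v \<le> R"
      "h = iter_D f (w # ws)"
      by (auto simp: length_Suc_conv)
    then have "h \<in> {\<lambda>x. frechet_derivative f (at x) h |f h.
      f \<in> {iter_D f vs |f vs. f \<in> F \<and> length vs = l \<and> (\<forall>v\<in>set vs. norm v \<le> R)} \<and> norm h \<le> R}"
      by (intro CollectI exI[of _ "iter_D f ws"] exI[of _ w]) auto
    then show "\<exists>k\<in>{\<lambda>x. frechet_derivative f (at x) h |f h.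
      f \<in> {iter_D f vs |f vs. f \<in> F \<and> length vs = l \<and> (\<forall>v\<in>set vs. norm v \<le> R)} \<and> norm h \<le> R}.
      \<forall>x\<in>S. h x = k x" by (intro bexI[of _ h] ballI refl)
  qed
qed

lemma iter_D_has_derivative:
  assumes S: "open S" and F: "\<And>m. equi_Ck m S {f}" and x: "x \<in> S"
  shows "(iter_D f vs has_derivative (\<lambda>h. iter_D f (h # vs) x)) (at x)"
proof -
  \<comment> \<open>Any common bound for the directions will do.\<close>
  define R where "R = sum_list (map norm vs)"
  have R: "\<forall>v\<in>set vs. norm v \<le> R"
    unfolding R_def by (auto intro!: member_le_sum_list)
  obtain F' where "\<And>g. g \<in> {iter_D g vs |g ws. g \<in> {f} \<and> ws = vs} \<Longrightarrow> (g has_derivative F' g) (at x)"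
  proof -
    obtain G f' where "\<And>g x. g \<in> {iter_D g ws |g ws. g \<in> {f} \<and> length ws = length vs \<and> (\<forall>v\<in>set ws.
        norm v \<le> R)}
        \<Longrightarrow> x \<in> S \<Longrightarrow> (g has_derivative f' g x) (at x)"
      using equi_Ck_iter_D[OF S F, where m = "Suc 0" and l = "length vs" and R = R]
      by (rule equi_Ck_SucE) (rule that)
    then show ?thesis using x R by (intro that[of "\<lambda>g. f' g x"]) blast
  qed
  then have "(iter_D f vs has_derivative F' (iter_D f vs)) (at x)" by blast
  then have "iter_D f vs differentiable at x" by (rule differentiableI)
  then show ?thesis by (simp add: frechet_derivative_works)
qed

text \<open>The bounds in \<open>smooth_on\<close> range over all directions, those of the families
  over bounded directions only; homogeneity in every slot connects the two. Taking
  \<open>map2\<close> with a projection cuts both lists to their common length, so no condition on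
  the lengths arises.\<close>

lemma iter_D_scale:
  assumes S: "open S" and F: "\<And>m. equi_Ck m S {f}"
  shows "x \<in> S \<Longrightarrow> iter_D f (map2 (*\<^sub>R) cs vs) x = prod_list (map2 (\<lambda>c _. c) cs vs) *\<^sub>R iter_D f (map2
      (\<lambda>_ v. v) cs vs) x"
proof (induction cs vs arbitrary: x rule: list_induct2')
  case (4 c cs v vs)
  let ?p = "prod_list (map2 (\<lambda>c _. c) cs vs)" and ?v = "map2 (\<lambda>_ v. v) cs vs"
  have "(iter_D f (map2 (*\<^sub>R) cs vs) has_derivative (\<lambda>h. ?p *\<^sub>R iter_D f (h # ?v) x)) (at x)"
    by (rule has_derivative_transform_within_open[OF has_derivative_scaleR_right
          [OF iter_D_has_derivative[OF S F 4(2)]] S 4(2)])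
      (simp add: 4(1))
  from fun_cong[OF frechet_derivative_at[OF this], of "c *\<^sub>R v"]
  have "iter_D f (map2 (*\<^sub>R) (c # cs) (v # vs)) x = ?p *\<^sub>R iter_D f ((c *\<^sub>R v) # ?v) x"
    by simp
  also have "\<dots> = ?p *\<^sub>R c *\<^sub>R iter_D f (v # ?v) x"
    using linear_scale[OF has_derivative_linear[OF iter_D_has_derivative[OF S F 4(2)]]] by metis
  finally show ?case by (simp add: mult.commute)
qed auto

lemma iter_D_normalize:
  fixes f :: "'a::real_normed_vector \<Rightarrow> 'b::real_normed_vector"
  assumes S: "open S" and F: "\<And>m. equi_Ck m S {f}" and x: "x \<in> S"
  shows "iter_D f vs x = prod_list (map norm vs) *\<^sub>R iter_D f (map sgn vs) x"
    and "iter_D f (h # vs) x = prod_list (map norm vs) *\<^sub>R iter_D f (h # map sgn vs) x"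
proof -
  have a: "map2 (*\<^sub>R) (map norm vs) (map sgn vs) = vs" for vs :: "'a list"
  proof (induction vs)
    case (Cons v vs)
    then show ?case by (cases "v = 0") (simp_all add: sgn_div_norm)
  qed simp
  have b: "map2 (\<lambda>c _. c) (map norm vs) (map sgn vs) = map norm vs"
    "map2 (\<lambda>_ v. v) (map norm vs) (map sgn vs) = map sgn vs" for vs :: "'a list"
    by (induction vs) auto
  show "iter_D f vs x = prod_list (map norm vs) *\<^sub>R iter_D f (map sgn vs) x"
    using iter_D_scale[OF S F x, of "map norm vs" "map sgn vs"] by (simp only: a b)
  show "iter_D f (h # vs) x = prod_list (map norm vs) *\<^sub>R iter_D f (h # map sgn vs) x"
    using iter_D_scale[OF S F x, of "1 # map norm vs" "h # map sgn vs"]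
    by (simp only: list.map zip_Cons_Cons case_prod_conv a b scaleR_one prod_list.Cons mult_1)
qed

text \<open>Uniform control near each point is enough: \<open>iter_D f\<close> does not depend on
  the neighbourhood, and every clause of \<open>smooth_on\<close> is local.\<close>

lemma smooth_onI:
  fixes f :: "'a::real_normed_vector \<Rightarrow> 'b::real_normed_vector"
  assumes "\<And>x. x \<in> S \<Longrightarrow> \<exists>U. x \<in> U \<and> U \<subseteq> S \<and> smooth_family U {()} (\<lambda>_. f)"
  shows "smooth_on S f"
  unfolding smooth_on_def
proof (intro exI[of _ "iter_D f"] ballI conjI allI impI)
  fix x assume "x \<in> S"
  then obtain U where U: "x \<in> U" "U \<subseteq> S" and sf: "smooth_family U {()} (\<lambda>_. f)"
    using assms by blast
  then have U3: "open U" and F: "\<And>m. equi_Ck m U {f}"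
    using smooth_family_equi_Ck[OF sf] smooth_family_open by auto
  note U = U U3
  note D = iter_D_has_derivative[OF U(3) F] and N = iter_D_normalize[OF U(3) F]
  define Fam where "Fam l = {iter_D g vs |g vs. g \<in> {f} \<and> length vs = l \<and> (\<forall>v\<in>set vs. norm v \<le> 1)}"
      for l
  have Fam: "equi_Ck m U (Fam l)" for m l unfolding Fam_def by (rule equi_Ck_iter_D[OF U(3) F])
  have inFam: "iter_D f (map sgn vs) \<in> Fam (length vs)" for vs
    unfolding Fam_def by (auto simp: norm_sgn intro!: exI[of _ f] exI[of _ "map sgn vs"])
  have P0: "prod_list (map norm vs) \<ge> 0" for vs :: "'a list"
    by (induction vs) auto
  show "iter_D f [] x = f x" by simp
  show "linear (\<lambda>h. iter_D f (h # vs) x)" for vs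
    by (rule has_derivative_linear[OF D[OF U(1)]])
  show "\<exists>C. \<forall>vs. length vs = m \<longrightarrow> norm (iter_D f vs x) \<le> C * prod_list (map norm vs)" for m
  proof -
    obtain C where C: "C \<ge> 0" "\<And>g. g \<in> Fam m \<Longrightarrow> norm (g x) \<le> C"
      using equi_Ck_loc_bdd[OF Fam[of 0]] U(1) by (rule loc_bdd_at) (rule that)
    have "norm (iter_D f vs x) \<le> C * prod_list (map norm vs)" if "length vs = m" for vs
    proof -
      have "norm (iter_D f vs x) = prod_list (map norm vs) * norm (iter_D f (map sgn vs) x)"
        unfolding N(1)[OF U(1), of vs] using P0[of vs] by simp
      also have "\<dots> \<le> prod_list (map norm vs) * C"
        using C(2) inFam[of vs] that P0[of vs] by (intro mult_left_mono) auto
      finally show ?thesis by (simp add: mult.commute)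
    qed
    then show ?thesis by blast
  qed
  fix m and e :: real assume e: "e > 0"
  obtain d C where d: "d > 0" "C \<ge> 0"
    "\<And>g g' y. g \<in> Fam m \<Longrightarrow> (g has_derivative g') (at x) \<Longrightarrow> dist y x < d \<Longrightarrow>
        y \<in> U \<and> norm (g y - g x - g' (y - x)) \<le> C * (norm (y - x))\<^sup>2"
    using U(3) Fam[of "Suc (Suc 0)" m] U(1) by (rule equi_Ck_remainder) (rule that)
  \<comment> \<open>Makes the remainder \<open>C * (norm (y - x))\<^sup>2\<close> at most
    \<open>e * norm (y - x)\<close>; the added 1 allows \<open>C = 0\<close>. The bound by
    \<open>d\<close> also places \<open>y\<close> in \<open>U\<close>.\<close>
  define d' where "d' = min d (e / (C + 1))"
  show "\<exists>d>0. \<forall>y\<in>S. norm (y - x) < d \<longrightarrow> (\<forall>vs. length vs = m \<longrightarrow>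
        norm (iter_D f vs y - iter_D f vs x - iter_D f ((y - x) # vs) x)
          \<le> e * norm (y - x) * prod_list (map norm vs))"
  proof (intro exI[of _ d'] conjI ballI impI allI)
    show "d' > 0" using d e by (simp add: d'_def)
    fix y and vs :: "'a list" assume y: "norm (y - x) < d'" and vs: "length vs = m"
    let ?g = "iter_D f (map sgn vs)" and ?P = "prod_list (map norm vs)"
    have "dist y x < d" using y by (simp add: d'_def dist_norm)
    from d(3)[OF _ D[OF U(1)] this, of "map sgn vs"] inFam[of vs] vs
    have yU: "y \<in> U" and r: "norm (?g y - ?g x - iter_D f ((y - x) # map sgn vs) x) \<le> C * (norm (y -
        x))\<^sup>2"
      by auto
    have "C * norm (y - x) \<le> C * (e / (C + 1))" using y d by (intro mult_left_mono) (auto simp: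
        d'_def)
    also have "\<dots> \<le> e" using d(2) e by (simp add: field_simps)
    finally have "C * norm (y - x) * norm (y - x) \<le> e * norm (y - x)" by (intro mult_right_mono)
        auto
    with r have r': "norm (?g y - ?g x - iter_D f ((y - x) # map sgn vs) x) \<le> e * norm (y - x)"
      by (simp add: power2_eq_square mult.assoc)
    have "norm (iter_D f vs y - iter_D f vs x - iter_D f ((y - x) # vs) x)
      = ?P * norm (?g y - ?g x - iter_D f ((y - x) # map sgn vs) x)"
      unfolding N(1)[OF U(1), of vs] N(1)[OF yU, of vs] N(2)[OF U(1), of _ vs]
      using P0[of vs] by (simp add: scaleR_diff_right[symmetric])
    also have "\<dots> \<le> ?P * (e * norm (y - x))" by (intro mult_left_mono r' P0)
    finally show "norm (iter_D f vs y - iter_D f vs x - iter_D f ((y - x) # vs) x)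
      \<le> e * norm (y - x) * prod_list (map norm vs)" by (simp add: mult.commute)
  qed
qed

section \<open>The space of square summable families\<close>

lemma l2H_summable: "(\<lambda>k. (norm (l2H_apply v k))\<^sup>2) summable_on UNIV"
  using l2H_apply[of v] by simp

lemma l2H_eqI: "(\<And>k. l2H_apply v k = l2H_apply w k) \<Longrightarrow> v = w"
  by (metis ext l2H_apply_inject)

lemma l2H_apply_Abs: "(\<lambda>k. (norm (f k))\<^sup>2) summable_on UNIV \<Longrightarrow> l2H_apply (Abs_l2H f) = f"
  by (simp add: Abs_l2H_inverse)

lemma l2H_norm_sq: "(norm v)\<^sup>2 = (\<Sum>\<^sub>\<infinity>k. (norm (l2H_apply v k))\<^sup>2)"
  by (simp add: power2_norm_eq_inner inner_l2H_def)

lemma norm_l2H_apply_le: "norm (l2H_apply v k) \<le> norm v"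
proof -
  have "(\<Sum>j\<in>{k}. (norm (l2H_apply v j))\<^sup>2) \<le> (norm v)\<^sup>2"
    unfolding l2H_norm_sq by (rule finite_sum_le_infsum[OF l2H_summable]) auto
  then show ?thesis by (simp add: power2_le_iff_abs_le)
qed

lemma l2H_norm_mono:
  assumes "C \<ge> 0" "\<And>k. norm (l2H_apply v k) \<le> C * norm (l2H_apply w k)"
  shows "norm v \<le> C * norm w"
proof (rule power2_le_imp_le)
  have "(norm v)\<^sup>2 \<le> (\<Sum>\<^sub>\<infinity>k. C\<^sup>2 * (norm (l2H_apply w k))\<^sup>2)"
    unfolding l2H_norm_sq
  proof (rule infsum_mono)
    show "(norm (l2H_apply v k))\<^sup>2 \<le> C\<^sup>2 * (norm (l2H_apply w k))\<^sup>2" for k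
      using power_mono[OF assms(2)[of k], of 2] by (simp add: power_mult_distrib)
  qed (intro l2H_summable summable_on_cmult_right)+
  also have "\<dots> = C\<^sup>2 * (norm w)\<^sup>2"
    unfolding l2H_norm_sq by (rule infsum_cmult_right) (rule l2H_summable)
  finally show "(norm v)\<^sup>2 \<le> (C * norm w)\<^sup>2" by (simp add: power_mult_distrib)
qed (use assms in auto)

lemma bounded_linear_l2H_apply: "bounded_linear (\<lambda>v. l2H_apply v k)"
  by (rule bounded_linear_intro[of _ 1])
    (auto simp: plus_l2H.rep_eq scaleR_l2H.rep_eq norm_l2H_apply_le)

definition l2H_diag :: "('k \<Rightarrow> quat \<Rightarrow> quat) \<Rightarrow> 'k l2H \<Rightarrow> 'k l2H" where
  "l2H_diag M v = Abs_l2H (\<lambda>k. M k (l2H_apply v k))"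

lemma
  assumes lin: "\<And>k. linear (M k)" and bd: "\<And>k q. norm (M k q) \<le> C * norm q"
  shows l2H_apply_diag: "l2H_apply (l2H_diag M v) k = M k (l2H_apply v k)"
    and bounded_linear_l2H_diag: "bounded_linear (l2H_diag M)"
proof -
  have ap: "l2H_apply (l2H_diag M v) k = M k (l2H_apply v k)" for v k
  proof -
    have "(\<lambda>k. (norm (M k (l2H_apply v k)))\<^sup>2) summable_on UNIV"
    proof (rule summable_on_comparison_test)
      show "(\<lambda>k. C\<^sup>2 * (norm (l2H_apply v k))\<^sup>2) summable_on UNIV"
        by (intro summable_on_cmult_right l2H_summable)
      show "(norm (M k (l2H_apply v k)))\<^sup>2 \<le> C\<^sup>2 * (norm (l2H_apply v k))\<^sup>2" for k
        using power_mono[OF bd[of k "l2H_apply v k"], of 2] by (simp add: power_mult_distrib)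
    qed auto
    then show ?thesis by (simp add: l2H_diag_def l2H_apply_Abs)
  qed
  show "l2H_apply (l2H_diag M v) k = M k (l2H_apply v k)" by (rule ap)
  show "bounded_linear (l2H_diag M)"
  proof (rule bounded_linear_intro[of _ "\<bar>C\<bar>"])
    fix v w :: "'a l2H" and r :: real
    show "l2H_diag M (v + w) = l2H_diag M v + l2H_diag M w"
      by (rule l2H_eqI) (simp add: ap plus_l2H.rep_eq linear_add[OF lin])
    show "l2H_diag M (r *\<^sub>R v) = r *\<^sub>R l2H_diag M v"
      by (rule l2H_eqI) (simp add: ap scaleR_l2H.rep_eq linear_scale[OF lin])
    have "norm (l2H_diag M v) \<le> \<bar>C\<bar> * norm v"
    proof (rule l2H_norm_mono)
      fix k
      have "C * norm (l2H_apply v k) \<le> \<bar>C\<bar> * norm (l2H_apply v k)" by (intro mult_right_mono) auto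
      then show "norm (l2H_apply (l2H_diag M v) k) \<le> \<bar>C\<bar> * norm (l2H_apply v k)"
        unfolding ap using bd[of k "l2H_apply v k"] by linarith
    qed auto
    then show "norm (l2H_diag M v) \<le> norm v * \<bar>C\<bar>" by (simp add: mult.commute)
  qed
qed

lemma infsum_tail_less:
  fixes f :: "'k \<Rightarrow> real"
  assumes "f summable_on UNIV" "e > 0"
  obtains F where "finite F" "infsum f (- F) < e"
proof -
  obtain F where F: "finite F" "dist (sum f F) (infsum f UNIV) \<le> e / 2"
    using has_sum_finite_approximation[OF has_sum_infsum[OF assms(1)], of "e / 2"] assms(2) by auto
  have "infsum f UNIV = infsum f (F \<union> - F)" by simp
  also have "\<dots> = infsum f F + infsum f (- F)"
    by (rule infsum_Un_disjoint) (use F assms(1) in \<open>auto intro: summable_on_subset_banach\<close>)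
  finally have "infsum f (- F) = infsum f UNIV - sum f F" using F by simp
  also have "\<dots> \<le> e / 2" using F(2) unfolding dist_real_def by linarith
  finally show ?thesis using assms(2) F(1) by (intro that[of F]) auto
qed

lemma l2H_countable_dense:
  obtains D :: "'k::countable l2H set"
  where "countable D" "\<And>v e. e > 0 \<Longrightarrow> \<exists>w\<in>D. dist w v < e"
proof -
  obtain Q :: "quat set" where Q: "countable Q" "\<And>X. open X \<Longrightarrow> X \<noteq> {} \<Longrightarrow> \<exists>q\<in>Q. q \<in> X"
    by (rule countable_dense_setE) (rule that)
  \<comment> \<open>Finitely supported families with values in \<open>Q\<close> are dense. Coding
    them by association lists reduces their countability to that of lists over a countable
    set.\<close>
  define f where "f xs = (Abs_l2H (\<lambda>k. case map_of xs k of None \<Rightarrow> 0 | Some q \<Rightarrow> q) :: 'k l2H)" for xs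
  have "\<exists>w\<in>f ` lists (UNIV \<times> Q). dist w v < e" if e: "e > 0" for v :: "'k l2H" and e
  proof -
    obtain F where F: "finite F" "infsum (\<lambda>k. (norm (l2H_apply v k))\<^sup>2) (- F) < e\<^sup>2 / 2"
      using infsum_tail_less[OF l2H_summable[of v], of "e\<^sup>2 / 2"] e by auto
    \<comment> \<open>Each of the \<open>card F\<close> coordinates may use up \<open>r\<close> of
      the squared distance, at most \<open>e\<^sup>2 / 2\<close> altogether; the tail outside
      \<open>F\<close> uses less than the other half. The added 1 covers empty
      \<open>F\<close>.\<close>
    define r where "r = e\<^sup>2 / (2 * (real (card F) + 1))"
    have r: "r > 0" unfolding r_def using e by simp
    have "\<exists>q\<in>Q. q \<in> ball (l2H_apply v k) (sqrt r)" for k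
      using r by (intro Q(2)) auto
    then have "\<forall>k. \<exists>q. q \<in> Q \<and> dist (l2H_apply v k) q < sqrt r" by (auto simp: Bex_def)
    from choice[OF this] obtain q where q: "\<forall>k. q k \<in> Q \<and> dist (l2H_apply v k) (q k) < sqrt r"
      by (rule exE)
    obtain ks where ks: "set ks = F" using finite_list[OF F(1)] by blast
    define g where "g k = (if k \<in> F then q k else 0)" for k
    have mo: "(\<lambda>k. case map_of (map (\<lambda>k. (k, q k)) ks) k of None \<Rightarrow> 0 | Some q \<Rightarrow> q) = g"
      by (auto simp: map_of_map_restrict restrict_map_def ks g_def fun_eq_iff)
    have gs: "(\<lambda>k. (norm (g k))\<^sup>2) summable_on UNIV"
    proof -
      have "(\<lambda>k. (norm (g k))\<^sup>2) summable_on F" using F(1) by simp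
      then show ?thesis
        by (subst summable_on_cong_neutral[where T = F and g = "\<lambda>k. (norm (g k))\<^sup>2"]) (auto simp:
            g_def)
    qed
    let ?w = "f (map (\<lambda>k. (k, q k)) ks)"
    have w: "l2H_apply ?w k = g k" for k
      unfolding f_def mo by (simp add: l2H_apply_Abs gs)
    let ?h = "\<lambda>k. (norm (l2H_apply (?w - v) k))\<^sup>2"
    have hs: "?h summable_on A" for A
      by (rule summable_on_subset_banach[OF l2H_summable]) simp
    have "(norm (?w - v))\<^sup>2 = infsum ?h (F \<union> - F)" by (simp add: l2H_norm_sq)
    also have "\<dots> = infsum ?h F + infsum ?h (- F)"
      by (rule infsum_Un_disjoint[OF hs hs]) simp
    also have "infsum ?h (- F) = infsum (\<lambda>k. (norm (l2H_apply v k))\<^sup>2) (- F)"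
      by (rule infsum_cong) (simp add: minus_l2H.rep_eq w g_def)
    also have "infsum ?h F = sum ?h F" using F(1) by simp
    also have "sum ?h F \<le> (\<Sum>k\<in>F. r)"
    proof (rule sum_mono)
      fix k assume "k \<in> F"
      then have "norm (l2H_apply (?w - v) k) < sqrt r"
        using q by (simp add: minus_l2H.rep_eq w g_def dist_norm norm_minus_commute)
      then have "?h k \<le> (sqrt r)\<^sup>2" by (intro power_mono) auto
      then show "?h k \<le> r" using r by simp
    qed
    also have "(\<Sum>k\<in>F. r) \<le> e\<^sup>2 / 2"
      using e by (simp add: r_def field_simps)
    finally have "(norm (?w - v))\<^sup>2 < e\<^sup>2" using F(2) by simp
    then have "dist ?w v < e" unfolding dist_norm by (rule power2_less_imp_less) (use e in simp)
    moreover have "map (\<lambda>k. (k, q k)) ks \<in> lists (UNIV \<times> Q)" using q by (auto simp: lists_eq_set)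
    ultimately show ?thesis by blast
  qed
  moreover have "countable (f ` lists (UNIV \<times> Q))"
    by (intro countable_image countable_lists countable_SIGMA Q(1)) simp
  ultimately show ?thesis by (intro that) blast+
qed

lemma second_countable_l2H: "second_countable (euclidean :: 'k::countable l2H topology)"
proof -
  obtain D :: "'k l2H set" where D: "countable D" "\<And>v e. e > 0 \<Longrightarrow> \<exists>w\<in>D. dist w v < e"
    by (rule l2H_countable_dense) (rule that)
  let ?B = "(\<lambda>(d, n). ball d (inverse (real (Suc n)))) ` (D \<times> (UNIV :: nat set))"
  show ?thesis unfolding second_countable_def
  proof (intro exI[of _ ?B] conjI ballI allI impI)
    show "countable ?B" by (intro countable_image countable_SIGMA D(1)) simp
    show "openin euclidean V" if "V \<in> ?B" for V using that by (auto simp: open_openin[symmetric])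
    fix U and x :: "'k l2H" assume U: "openin euclidean U \<and> x \<in> U"
    then obtain e where e: "e > 0" "ball x e \<subseteq> U" by (metis open_openin openE)
    obtain n where n: "inverse (real (Suc n)) < e / 2" using reals_Archimedean[of "e / 2"] e by auto
    obtain d where d: "d \<in> D" "dist d x < inverse (real (Suc n))" using D(2)[of "inverse (real (Suc
        n))" x] by auto
    have "ball d (inverse (real (Suc n))) \<subseteq> U"
    proof
      fix y assume "y \<in> ball d (inverse (real (Suc n)))"
      then have "dist x y < e" using d(2) n dist_triangle[of x y d] by (auto simp: dist_commute)
      then show "y \<in> U" using e by auto
    qed
    then show "\<exists>V\<in>?B. x \<in> V \<and> V \<subseteq> U"
      using d by (intro bexI[of _ "ball d (inverse (real (Suc n)))"]) auto
  qed
qed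

lemma l2H_apply_coord: "x \<in> M_aff \<Lambda> \<Longrightarrow> l2H_apply (coord \<Lambda> x) k = x k - \<Lambda> k"
  by (simp add: coord_def M_aff_def l2H_apply_Abs)

section \<open>Families with square summable weights\<close>

definition weighted :: "('k \<Rightarrow> real) \<Rightarrow> ('k \<Rightarrow> quat) \<Rightarrow> 'k l2H" where
  "weighted c v = Abs_l2H (\<lambda>k. c k *\<^sub>R v k)"

lemma
  assumes c: "(\<lambda>k. (c k)\<^sup>2) summable_on UNIV" and v: "\<And>k. norm (v k) \<le> C"
  shows l2H_apply_weighted: "l2H_apply (weighted c v) k = c k *\<^sub>R v k"
    and norm_weighted_le: "norm (weighted c v) \<le> C * sqrt (\<Sum>\<^sub>\<infinity>k. (c k)\<^sup>2)"
proof -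
  have C: "C \<ge> 0" using v[of undefined] norm_ge_zero order_trans by blast
  have le: "(norm (c k *\<^sub>R v k))\<^sup>2 \<le> C\<^sup>2 * (c k)\<^sup>2" for k
  proof -
    have "(norm (v k))\<^sup>2 \<le> C\<^sup>2" using v[of k] by (intro power_mono) auto
    then have "(c k)\<^sup>2 * (norm (v k))\<^sup>2 \<le> (c k)\<^sup>2 * C\<^sup>2" by (intro mult_left_mono) auto
    then show ?thesis by (simp add: power_mult_distrib mult.commute)
  qed
  have s: "(\<lambda>k. C\<^sup>2 * (c k)\<^sup>2) summable_on UNIV" by (intro summable_on_cmult_right c)
  have ss: "(\<lambda>k. (norm (c k *\<^sub>R v k))\<^sup>2) summable_on UNIV"
    by (rule summable_on_comparison_test[OF s le]) auto
  show ap: "l2H_apply (weighted c v) k = c k *\<^sub>R v k" for k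
    using ss by (simp add: weighted_def l2H_apply_Abs)
  have "(norm (weighted c v))\<^sup>2 \<le> (\<Sum>\<^sub>\<infinity>k. C\<^sup>2 * (c k)\<^sup>2)"
    unfolding l2H_norm_sq ap by (rule infsum_mono[OF ss s le])
  also have "\<dots> = C\<^sup>2 * (\<Sum>\<^sub>\<infinity>k. (c k)\<^sup>2)" by (rule infsum_cmult_right) (rule c)
  finally have "norm (weighted c v) \<le> sqrt (C\<^sup>2 * (\<Sum>\<^sub>\<infinity>k. (c k)\<^sup>2))" by (rule real_le_rsqrt)
  then show "norm (weighted c v) \<le> C * sqrt (\<Sum>\<^sub>\<infinity>k. (c k)\<^sup>2)" using C by (simp add: real_sqrt_mult)
qed

text \<open>Differentiating coordinatewise gives the derivative of the whole vector only if the
  remainders are small uniformly in the coordinate. A uniform second order bound provides this,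
  which explains the loss of two orders.\<close>

lemma equi_Ck_weighted:
  fixes F :: "('a::real_normed_vector \<Rightarrow> quat) set" and c :: "'k \<Rightarrow> real"
  assumes S: "open S" and c: "(\<lambda>k. (c k)\<^sup>2) summable_on UNIV"
    and F: "equi_Ck (Suc (Suc m)) S F"
    and H: "\<And>h. h \<in> H \<Longrightarrow> \<exists>g. (\<forall>k. g k \<in> F) \<and> (\<forall>x\<in>S. h x = weighted c (\<lambda>k. g k x))"
  shows "equi_Ck m S H"
  using F H
proof (induction m arbitrary: F H)
  define N where "N = sqrt (\<Sum>\<^sub>\<infinity>k. (c k)\<^sup>2)"
  have N: "N \<ge> 0" unfolding N_def by (simp add: infsum_nonneg)
  note nle = norm_weighted_le[OF c, folded N_def] and ap = l2H_apply_weighted[OF c]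
  have bd: "loc_bdd S H" if F: "loc_bdd S F"
    and H: "\<And>h. h \<in> H \<Longrightarrow> \<exists>g. (\<forall>k. g k \<in> F) \<and> (\<forall>x\<in>S. h x = weighted c (\<lambda>k. g k x))"
    for F :: "('a \<Rightarrow> quat) set" and H
  proof (rule loc_bddI)
    fix x assume x: "x \<in> S"
    obtain d C where d: "d > 0" "\<And>y f. y \<in> S \<Longrightarrow> dist y x < d \<Longrightarrow> f \<in> F \<Longrightarrow> norm (f y) \<le> C"
      using F x by (rule loc_bddE) (rule that)
    have "norm (h y) \<le> C * N" if "y \<in> S" "dist y x < d" "h \<in> H" for h y
    proof -
      obtain g where g: "\<forall>k. g k \<in> F" "\<forall>x\<in>S. h x = weighted c (\<lambda>k. g k x)" using H \<open>h \<in> H\<close> by blast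
      show ?thesis using nle[of "\<lambda>k. g k y" C] g that d(2) by simp
    qed
    then show "\<exists>d>0. \<exists>C. \<forall>y\<in>S. dist y x < d \<longrightarrow> (\<forall>f\<in>H. norm (f y) \<le> C)"
      using d(1) by blast
  qed
  {
    case 0
    show ?case using bd[OF equi_Ck_loc_bdd[OF 0(1)] 0(2)] by simp
  next
    case (Suc m)
    obtain F' f' where F: "loc_bdd S F" "equi_Ck (Suc (Suc m)) S F'"
      "\<And>f x. f \<in> F \<Longrightarrow> x \<in> S \<Longrightarrow> (f has_derivative f' f x) (at x)"
      "\<And>f h. f \<in> F \<Longrightarrow> norm h \<le> 1 \<Longrightarrow> \<exists>g\<in>F'. \<forall>x\<in>S. g x = f' f x h"
      using Suc.prems(1) by (rule equi_Ck_SucE) (rule that)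
    have "\<forall>h\<in>H. \<exists>g. (\<forall>k. g k \<in> F) \<and> (\<forall>x\<in>S. h x = weighted c (\<lambda>k. g k x))" using Suc.prems(2) by
        blast
    from bchoice[OF this] obtain g where
      g: "\<forall>h\<in>H. (\<forall>k. g h k \<in> F) \<and> (\<forall>x\<in>S. h x = weighted c (\<lambda>k. g h k x))"
      by (rule exE)
    have F2: "equi_Ck (Suc (Suc 0)) S F"
    proof -
      have "equi_Ck (Suc (Suc n)) S F \<Longrightarrow> equi_Ck (Suc (Suc 0)) S F" for n
        by (induction n) (simp, metis equi_Ck_SucD)
      then show ?thesis using Suc.prems(1) by blast
    qed
    define G where "G = {\<lambda>x. weighted c (\<lambda>k. p k x) |p. \<forall>k. p k \<in> F'}"
    have "equi_Ck m S G" by (rule Suc.IH[OF F(2)]) (auto simp: G_def)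
    note G = this
    show ?case
    proof (rule equi_Ck_SucI[OF bd[OF F(1) Suc.prems(2)] G,
          where f' = "\<lambda>h x v. weighted c (\<lambda>k. f' (g h k) x v)"])
      fix h and v :: 'a assume h: "h \<in> H" and v: "norm v \<le> 1"
      have "\<forall>k. \<exists>p. p \<in> F' \<and> (\<forall>x\<in>S. p x = f' (g h k) x v)" using F(4) g h v by blast
      from choice[OF this] obtain p where p: "\<forall>k. p k \<in> F' \<and> (\<forall>x\<in>S. p k x = f' (g h k) x v)"
        by (rule exE)
      show "\<exists>q\<in>G. \<forall>x\<in>S. q x = weighted c (\<lambda>k. f' (g h k) x v)"
        unfolding G_def using p by (intro bexI[of _ "\<lambda>x. weighted c (\<lambda>k. p k x)"] CollectI exI
            conjI) auto
    next
      fix h x assume h: "h \<in> H" and x: "x \<in> S"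
      have der: "(g h k has_derivative f' (g h k) x) (at x)" for k using F(3) g h x by blast
      have lin: "linear (f' (g h k) x)" for k using der by (rule has_derivative_linear)
      obtain C1 where C1: "C1 \<ge> 0" "\<And>f. f \<in> F' \<Longrightarrow> norm (f x) \<le> C1"
        using equi_Ck_loc_bdd[OF F(2)] x by (rule loc_bdd_at) (rule that)
      have d1: "norm (f' (g h k) x v) \<le> C1 * norm v" for k v
      proof (rule linear_bound_from_ball[OF lin])
        fix w :: 'a assume "norm w \<le> 1"
        then obtain p where "p \<in> F'" "\<forall>x\<in>S. p x = f' (g h k) x w" using F(4) g h by blast
        then show "norm (f' (g h k) x w) \<le> C1" using C1(2) x by metis
      qed
      obtain C0 d0 where C0: "d0 > 0" "\<And>y f. y \<in> S \<Longrightarrow> dist y x < d0 \<Longrightarrow> f \<in> F \<Longrightarrow> norm (f y) \<le> C0"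
        using F(1) x by (rule loc_bddE) (rule that)
      obtain d2 C2 where C2: "d2 > 0" "C2 \<ge> 0"
        "\<And>f f' y. f \<in> F \<Longrightarrow> (f has_derivative f') (at x) \<Longrightarrow> dist y x < d2 \<Longrightarrow>
          y \<in> S \<and> norm (f y - f x - f' (y - x)) \<le> C2 * (norm (y - x))\<^sup>2"
        using S F2 x by (rule equi_Ck_remainder) (rule that)
      let ?L = "\<lambda>v. weighted c (\<lambda>k. f' (g h k) x v)"
      note apL = ap[OF d1]
      have bl: "bounded_linear ?L"
      proof (rule bounded_linear_intro[of _ "C1 * N"])
        show "?L (v + w) = ?L v + ?L w" for v w
          by (rule l2H_eqI, unfold apL plus_l2H.rep_eq) (simp add: linear_add[OF lin]
              scaleR_add_right)
        show "?L (r *\<^sub>R v) = r *\<^sub>R ?L v" for r v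
          by (rule l2H_eqI, unfold apL scaleR_l2H.rep_eq) (simp add: linear_scale[OF lin])
        show "norm (?L v) \<le> norm v * (C1 * N)" for v
          using nle[OF d1] by (simp add: mult_ac)
      qed
      show "(h has_derivative ?L) (at x)"
        unfolding has_derivative_at_alt
      proof (intro conjI bl allI impI)
        fix e :: real assume e: "e > 0"
        \<comment> \<open>Within \<open>d0\<close> the coefficients are bounded, so that
          \<open>weighted\<close> has the expected coordinates; within \<open>d2\<close> the
          quadratic remainder holds uniformly in \<open>k\<close>; the last bound turns that
          remainder into \<open>e * norm (y - x)\<close>.\<close>
        define d where "d = min (min d0 d2) (e / (C2 * N + 1))"
        have dpos: "d > 0" using e C0 C2 N by (simp add: d_def add_nonneg_pos)
        show "\<exists>d>0. \<forall>y. norm (y - x) < d \<longrightarrow> norm (h y - h x - ?L (y - x)) \<le> e * norm (y - x)"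
        proof (intro exI[of _ d] conjI allI impI dpos)
          fix y assume y: "norm (y - x) < d"
          then have yd: "dist y x < d0" "dist y x < d2" "norm (y - x) \<le> e / (C2 * N + 1)"
            by (auto simp: d_def dist_norm)
          have yS: "y \<in> S" and rem: "\<And>k. norm (g h k y - g h k x - f' (g h k) x (y - x)) \<le> C2 *
              (norm (y - x))\<^sup>2"
            using C2(3)[OF _ der yd(2)] g h by blast+
          have bdy: "norm (g h k y) \<le> C0" and bdx: "norm (g h k x) \<le> C0" for k
            using C0 g h yS yd x by (auto simp: dist_commute)
          have "h y - h x - ?L (y - x) = weighted c (\<lambda>k. g h k y - g h k x - f' (g h k) x (y - x))"
          proof (rule l2H_eqI)
            fix k
            have "l2H_apply (h y) k = c k *\<^sub>R g h k y" "l2H_apply (h x) k = c k *\<^sub>R g h k x"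
              using g h x yS ap[of "\<lambda>k. g h k y", OF bdy] ap[of "\<lambda>k. g h k x", OF bdx] by simp_all
            then show "l2H_apply (h y - h x - ?L (y - x)) k =
                l2H_apply (weighted c (\<lambda>k. g h k y - g h k x - f' (g h k) x (y - x))) k"
              by (simp add: apL ap[OF rem] minus_l2H.rep_eq scaleR_diff_right)
          qed
          then have "norm (h y - h x - ?L (y - x)) \<le> C2 * (norm (y - x))\<^sup>2 * N"
            using nle[OF rem] by simp
          also have "\<dots> = (C2 * N * norm (y - x)) * norm (y - x)" by (simp add: power2_eq_square)
          also have "\<dots> \<le> e * norm (y - x)"
          proof (rule mult_right_mono)
            have "C2 * N * norm (y - x) \<le> C2 * N * (e / (C2 * N + 1))"
              using yd C2 N by (intro mult_left_mono) auto
            also have "\<dots> \<le> e"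
              using C2(2) N e by (simp add: divide_simps add_nonneg_pos)
            finally show "C2 * N * norm (y - x) \<le> e" .
          qed simp
          finally show "norm (h y - h x - ?L (y - x)) \<le> e * norm (y - x)" .
        qed
      qed
    qed
  }
qed

lemma smooth_family_weighted:
  fixes c :: "'k \<Rightarrow> real"
  assumes f: "smooth_family S UNIV (f :: 'k \<Rightarrow> 'a::real_normed_vector \<Rightarrow> quat)"
    and c: "(\<lambda>k. (c k)\<^sup>2) summable_on UNIV"
  shows "smooth_family S I (\<lambda>_ x. weighted c (\<lambda>k. f k x))"
proof (rule smooth_familyI)
  show S: "open S" using f by (rule smooth_family_open)
  fix m
  show "equi_Ck m S ((\<lambda>_ x. weighted c (\<lambda>k. f k x)) ` I)"
    by (rule equi_Ck_weighted[OF S c smooth_family_equi_Ck[OF f]]) (auto intro!: exI[of _ f])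
qed

section \<open>The Hopf map\<close>

text \<open>Half of this is the hyperKaehler moment map, up to a constant, of the circle acting on
  the quaternions from the left. Between unit spheres it is the Hopf fibration.\<close>

definition hopf :: "quat \<Rightarrow> quat" where
  "hopf x = qcnj x \<odot> qi \<odot> x"

lemma hopf_eq: "hopf x = (\<i> * of_real ((norm (fst x))\<^sup>2 - (norm (snd x))\<^sup>2), 2 * \<i> * cnj (fst x) *
    snd x)"
  unfolding hopf_def qmul_def qcnj_def qi_def qcomplex_def
  by (simp add: complex_norm_square[symmetric] algebra_simps)

lemma norm_qi: "norm qi = 1"
  by (simp add: qi_def qcomplex_def norm_prod_def)

lemma norm_qcnj: "norm (qcnj q) = norm q"
  by (simp add: qcnj_def norm_prod_def)

lemma norm_hopf: "norm (hopf x) = (norm x)\<^sup>2"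
  by (simp add: hopf_def norm_qmul norm_qi norm_qcnj power2_eq_square)

lemma hopf_ImH: "hopf x \<in> ImH"
  by (simp add: hopf_eq ImH_def)

lemma qcomplex_qmul: "qcomplex g \<odot> x = (g * fst x, g * snd x)"
  by (simp add: qcomplex_def qmul_def)

lemma hopf_phase: "norm g = 1 \<Longrightarrow> hopf (qcomplex g \<odot> x) = hopf x"
  by (simp add: hopf_eq qcomplex_qmul norm_mult mult_ac complex_norm_square[symmetric])

lemma hopf_qmul: "hopf (x \<odot> y) = qcnj y \<odot> hopf x \<odot> y"
  by (simp add: hopf_def qcnj_qmul qmul_assoc)

text \<open>The fibres are circle orbits. The first component of the image gives the difference of
  the squared absolute values of the two complex coordinates, the norm gives their sum, and the
  second component fixes their relative phase. The common phase is read off from a nonzero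
  coordinate.\<close>

lemma hopf_eq_iff_phase:
  assumes "hopf x = hopf y"
  obtains g where "norm g = 1" "y = qcomplex g \<odot> x"
proof -
  obtain a b c d where xy: "x = (a, b)" "y = (c, d)" by (metis prod.exhaust)
  have 1: "(norm a)\<^sup>2 - (norm b)\<^sup>2 = (norm c)\<^sup>2 - (norm d)\<^sup>2"
  proof -
    have "complex_of_real ((norm a)\<^sup>2 - (norm b)\<^sup>2) = of_real ((norm c)\<^sup>2 - (norm d)\<^sup>2)"
      using assms unfolding hopf_eq xy by (simp del: of_real_diff of_real_power)
    then show ?thesis using of_real_eq_iff by blast
  qed
  have 2: "cnj a * b = cnj c * d"
    using assms unfolding hopf_eq xy by simp
  have "(norm x)\<^sup>2 = (norm y)\<^sup>2" using assms norm_hopf by metis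
  then have 3: "(norm a)\<^sup>2 + (norm b)\<^sup>2 = (norm c)\<^sup>2 + (norm d)\<^sup>2"
    by (simp add: xy norm_prod_def)
  have "(norm a)\<^sup>2 = (norm c)\<^sup>2" "(norm b)\<^sup>2 = (norm d)\<^sup>2" using 1 3 by linarith+
  then have n: "norm a = norm c" "norm b = norm d" by (simp_all add: power2_eq_iff_nonneg)
  show ?thesis
  proof (cases "a = 0")
    case False
    define g where "g = c / a"
    have "norm a \<noteq> 0" using False by simp
    then have g: "norm g = 1" using n by (simp add: g_def norm_divide)
    have gg: "cnj g * g = 1" using g by (metis complex_norm_square mult.commute of_real_1 power_one)
    have c: "c = g * a" using False by (simp add: g_def)
    have "cnj a * b = cnj a * (cnj g * d)" using 2 c by (simp add: mult_ac)
    then have "b = cnj g * d" using False by simp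
    then have "g * b = (cnj g * g) * d" by (simp add: mult_ac)
    then have "d = g * b" using gg by simp
    then show ?thesis using that[OF g] c by (simp add: xy qcomplex_qmul)
  next
    case True
    then have c: "c = 0" using n by simp
    show ?thesis
    proof (cases "b = 0")
      case True
      then show ?thesis using that[of 1] \<open>a = 0\<close> c n by (simp add: xy qcomplex_qmul)
    next
      case False
      have "norm b \<noteq> 0" using False by simp
      then have "norm (d / b) = 1" using n by (simp add: norm_divide)
      then show ?thesis using that[of "d / b"] False \<open>a = 0\<close> c by (simp add: xy qcomplex_qmul)
    qed
  qed
qed

text \<open>The Hermitian product of the two-dimensional complex space underlying the quaternions on which
  the circle acts by left multiplication.\<close>

definition herm :: "quat \<Rightarrow> quat \<Rightarrow> complex" where
  "herm x y = fst (x \<odot> qcnj y)"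

lemma herm_eq: "herm x y = fst x * cnj (fst y) + snd x * cnj (snd y)"
  by (simp add: herm_def qmul_def qcnj_def)

lemma herm_phase: "herm (qcomplex g \<odot> x) y = g * herm x y"
  by (simp add: herm_eq qcomplex_qmul algebra_simps)

lemma herm_self: "herm x x = of_real ((norm x)\<^sup>2)"
  by (simp add: herm_eq norm_prod_def complex_norm_square del: of_real_power)

lemma herm_add: "herm (x + y) z = herm x z + herm y z"
  by (simp add: herm_eq algebra_simps)

lemma herm_diff: "herm (x - y) z = herm x z - herm y z"
  by (simp add: herm_eq algebra_simps)

lemma herm_scaleR: "herm (r *\<^sub>R x) z = of_real r * herm x z"
  by (simp add: herm_eq scaleR_conv_of_real algebra_simps)

lemma norm_fst_le_quat: "norm (fst q) \<le> norm (q :: quat)"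
  by (simp add: norm_prod_def real_le_rsqrt)

lemma norm_herm_le: "norm (herm x y) \<le> norm x * norm y"
  unfolding herm_def using norm_fst_le_quat[of "x \<odot> qcnj y"] by (simp add: norm_qmul norm_qcnj)

text \<open>The two points differ by a phase that is also a quotient of positive numbers, hence
  equal to 1.\<close>

lemma hopf_gauge_unique:
  assumes "hopf x = hopf y" "herm x z = of_real s" "0 < s" "herm y z = of_real t" "0 < t"
  shows "x = y"
proof -
  obtain g where g: "norm g = 1" "y = qcomplex g \<odot> x" using assms(1) by (rule hopf_eq_iff_phase)
  have "of_real t = g * of_real s" using assms(2,4) g(2) by (simp add: herm_phase)
  then have gr: "g = of_real (t / s)" using assms(3) by (simp add: field_simps)
  then have "\<bar>t / s\<bar> = 1" using g(1) by (simp only: norm_of_real)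
  then have "g = 1" using gr assms(3,5) by simp
  then show ?thesis using g(2) by (simp add: qcomplex_qmul)
qed

text \<open>For \<open>y = x \<odot> q\<close> the left side is \<open>herm y x\<close>. Thus the
  product is positive once \<open>q\<close> is orthogonal to \<open>hopf x\<close> and has positive
  real part, provided \<open>x\<close> is nonzero.\<close>

lemma herm_conj:
  "fst (x \<odot> q \<odot> qcnj x) = of_real ((norm x)\<^sup>2 * Re (fst q)) + \<i> * of_real (q \<bullet> hopf x)"
proof -
  obtain a b c d where "x = (Complex a b, Complex c d)" by (metis complex.exhaust prod.exhaust)
  moreover obtain e f g h where "q = (Complex e f, Complex g h)" by (metis complex.exhaust
      prod.exhaust)
  ultimately show ?thesis
    by (simp add: hopf_eq qmul_def qcnj_def complex_eq_iff norm_prod_def cmod_power2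
        inner_complex_def)
      (simp add: algebra_simps power2_eq_square)
qed

text \<open>For unit imaginary \<open>p\<close>, the quaternion \<open>hopf_sec p e\<close> conjugates \<open>p\<close> to \<open>p + e\<close>; among the
  quaternions doing so it is singled out by being orthogonal to \<open>p\<close> with positive real part.\<close>

definition hopf_sec :: "quat \<Rightarrow> quat \<Rightarrow> quat" where
  "hopf_sec p e = (let r = norm (p + e) in
     (1 / sqrt (2 * (r + 1 + p \<bullet> e))) *\<^sub>R (qcomplex (of_real (1 + r)) - p \<odot> e))"

lemma qmul_distribs:
  "(p + q) \<odot> r = p \<odot> r + q \<odot> r" "r \<odot> (p + q) = r \<odot> p + r \<odot> q"
  "(p - q) \<odot> r = p \<odot> r - q \<odot> r" "r \<odot> (p - q) = r \<odot> p - r \<odot> q"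
  "(k *\<^sub>R p) \<odot> q = k *\<^sub>R (p \<odot> q)" "p \<odot> (k *\<^sub>R q) = k *\<^sub>R (p \<odot> q)"
  by (simp_all add: qmul_def scaleR_conv_of_real algebra_simps)

lemma qcomplex_real_qmul:
  "qcomplex (of_real k) \<odot> q = k *\<^sub>R q" "q \<odot> qcomplex (of_real k) = k *\<^sub>R q"
  by (simp_all add: qmul_def qcomplex_def scaleR_conv_of_real prod_eq_iff)

lemma ImH_qmul_anticommutator:
  assumes "p \<in> ImH" "q \<in> ImH"
  shows "p \<odot> q + q \<odot> p = qcomplex (of_real (- 2 * (p \<bullet> q)))"
  using assms
  by (simp add: ImH_def qmul_def qcomplex_def prod_eq_iff complex_eq_iff inner_prod_def
      inner_complex_def)

lemma ImH_qmul_self: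
  assumes "p \<in> ImH"
  shows "p \<odot> p = qcomplex (of_real (- (norm p)\<^sup>2))"
proof -
  have "2 *\<^sub>R (p \<odot> p) = qcomplex (of_real (- 2 * (p \<bullet> p)))"
    using ImH_qmul_anticommutator[OF assms assms] by (simp add: scaleR_2)
  also have "\<dots> = 2 *\<^sub>R qcomplex (of_real (- (norm p)\<^sup>2))"
    by (simp add: qcomplex_def power2_norm_eq_inner scaleR_conv_of_real)
  finally show ?thesis by simp
qed

lemma ImH_qmul_re: "p \<in> ImH \<Longrightarrow> q \<in> ImH \<Longrightarrow> Re (fst (p \<odot> q)) = - (p \<bullet> q)"
  by (simp add: ImH_def qmul_def inner_prod_def inner_complex_def)

lemma ImH_qmul_orth: "p \<in> ImH \<Longrightarrow> q \<in> ImH \<Longrightarrow> (p \<odot> q) \<bullet> p = 0"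
  by (simp add: ImH_def qmul_def inner_prod_def inner_complex_def algebra_simps)

text \<open>With \<open>q = p + e\<close> the relation p p = -1 turns \<open>y\<close> into
  \<open>r - p \<odot> q\<close>, up to scale the familiar quaternion that rotates the direction of
  \<open>p\<close> into that of \<open>q\<close>. The conjugate of \<open>y\<close> times
  \<open>p\<close> is then \<open>r *\<^sub>R p + q\<close>, and the rest is the anticommutator of
  imaginary quaternions.\<close>

lemma qmul_ImH_identity:
  assumes p: "p \<in> ImH" "norm p = 1" and e: "e \<in> ImH" and r: "r = norm (p + e)"
  defines "y \<equiv> qcomplex (of_real (1 + r)) - p \<odot> e"
  shows "qcnj y \<odot> p \<odot> y = (2 * (r + 1 + p \<bullet> e)) *\<^sub>R (p + e)"
    and "y \<bullet> p = 0" and "Re (fst y) = r + 1 + p \<bullet> e"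
proof -
  define q where "q = p + e"
  have q: "q \<in> ImH" using p e by (simp add: q_def ImH_def)
  have pp: "p \<odot> p = qcomplex (of_real (- 1))" using ImH_qmul_self[OF p(1)] p(2) by simp
  have qq: "q \<odot> q = qcomplex (of_real (- (r\<^sup>2)))" using ImH_qmul_self[OF q] r by (simp add: q_def)
  define m where "m = p \<bullet> q"
  have m: "m = 1 + p \<bullet> e"
    using p(2) by (simp add: m_def q_def inner_add_right power2_norm_eq_inner[symmetric])
  have "p \<odot> q + q \<odot> p = qcomplex (of_real (- 2 * m))"
    unfolding m_def by (rule ImH_qmul_anticommutator[OF p(1) q])
  then have qp: "q \<odot> p = qcomplex (of_real (- 2 * m)) - p \<odot> q" by (metis add_diff_cancel_left')
  have y: "y = qcomplex (of_real r) - p \<odot> q"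
    by (simp add: y_def q_def qmul_distribs pp) (simp add: qcomplex_def prod_eq_iff)
  have yc: "qcnj y = qcomplex (of_real r) - q \<odot> p"
  proof -
    have "qcnj y = qcomplex (of_real r) - qcnj (p \<odot> q)"
      unfolding y by (simp add: qcnj_def qcomplex_def prod_eq_iff)
    also have "qcnj (p \<odot> q) = (- q) \<odot> (- p)"
      using p(1) q by (simp only: qcnj_qmul ImH_iff)
    also have "\<dots> = q \<odot> p" by (simp add: qmul_def)
    finally show ?thesis .
  qed
  have "qcnj y \<odot> p = r *\<^sub>R p + q"
    unfolding yc qmul_distribs qmul_assoc pp qcomplex_real_qmul by simp
  then have "qcnj y \<odot> p \<odot> y = (r *\<^sub>R p + q) \<odot> (qcomplex (of_real r) - p \<odot> q)"
    unfolding y by simp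
  also have "\<dots> = (r * r) *\<^sub>R p + r *\<^sub>R q - r *\<^sub>R ((p \<odot> p) \<odot> q) - (q \<odot> p) \<odot> q"
    by (simp add: qmul_distribs qcomplex_real_qmul qmul_assoc algebra_simps)
  also have "(q \<odot> p) \<odot> q = (- 2 * m) *\<^sub>R q + r\<^sup>2 *\<^sub>R p"
    unfolding qp qmul_distribs qmul_assoc qq qcomplex_real_qmul by simp
  also have "(p \<odot> p) \<odot> q = - q" unfolding pp qcomplex_real_qmul by simp
  also have "(r * r) *\<^sub>R p + r *\<^sub>R q - r *\<^sub>R - q - ((- 2 * m) *\<^sub>R q + r\<^sup>2 *\<^sub>R p) = (2 * (r + m)) *\<^sub>R
      q"
    by (simp add: power2_eq_square algebra_simps) (simp add: scaleR_2[symmetric] mult.commute)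
  finally show "qcnj y \<odot> p \<odot> y = (2 * (r + 1 + p \<bullet> e)) *\<^sub>R (p + e)"
    by (simp add: m q_def add.assoc)
  have "qcomplex (of_real (1 + r)) \<bullet> p = 0"
    using p(1) by (simp add: qcomplex_def ImH_def inner_prod_def inner_complex_def)
  then show "y \<bullet> p = 0" by (simp only: y_def inner_diff_left ImH_qmul_orth[OF p(1) e])
  have "Re (fst y) = 1 + r - Re (fst (p \<odot> e))" by (simp add: y_def qcomplex_def)
  then show "Re (fst y) = r + 1 + p \<bullet> e" by (simp add: ImH_qmul_re[OF p(1) e])
qed

text \<open>The bound on \<open>e\<close> keeps the quantity \<open>r + 1 + p \<bullet> e\<close>
  under the square root positive, so that dividing by the root normalises the previous
  identity.\<close>

lemma hopf_sec:
  assumes p: "p \<in> ImH" "norm p = 1" and e: "e \<in> ImH" "norm e \<le> 1 / 2"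
  shows "qcnj (hopf_sec p e) \<odot> p \<odot> hopf_sec p e = p + e"
    and "hopf_sec p e \<bullet> p = 0" and "0 < Re (fst (hopf_sec p e))"
proof -
  define r where "r = norm (p + e)"
  define y where "y = qcomplex (of_real (1 + r)) - p \<odot> e"
  define c where "c = r + 1 + p \<bullet> e"
  have "\<bar>p \<bullet> e\<bar> \<le> 1 / 2" using Cauchy_Schwarz_ineq2[of p e] p e by simp
  then have c: "c > 0" unfolding c_def r_def using norm_ge_zero[of "p + e"] by linarith
  have s: "hopf_sec p e = (1 / sqrt (2 * c)) *\<^sub>R y"
    by (simp add: hopf_sec_def Let_def r_def y_def c_def)
  note id = qmul_ImH_identity[OF p e(1) r_def, folded y_def c_def]
  have sc: "qcnj (k *\<^sub>R y) \<odot> p \<odot> (k *\<^sub>R y) = (k * k) *\<^sub>R (qcnj y \<odot> p \<odot> y)" for k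
    by (simp add: qmul_def qcnj_def scaleR_conv_of_real algebra_simps)
  have "(1 / sqrt (2 * c)) * (1 / sqrt (2 * c)) = 1 / (2 * c)"
    using c by simp
  then show "qcnj (hopf_sec p e) \<odot> p \<odot> hopf_sec p e = p + e"
    unfolding s sc id(1) using c by simp
  show "hopf_sec p e \<bullet> p = 0" by (simp add: s id(2))
  show "0 < Re (fst (hopf_sec p e))" using c id(3) by (simp add: s)
qed

text \<open>Right multiplication by \<open>h\<close> conjugates \<open>hopf x\<close> by
  \<open>h\<close>, so after division by \<open>(norm x)\<^sup>2\<close> the problem is the one
  solved by \<open>hopf_sec\<close>. Its orthogonality and positivity become the gauge condition
  through \<open>herm_conj\<close>.\<close>

lemma hopf_section:
  assumes x: "x \<noteq> 0" and d: "d \<in> ImH" "norm d \<le> (norm x)\<^sup>2 / 2"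
  defines "y \<equiv> x \<odot> hopf_sec (hopf x /\<^sub>R (norm x)\<^sup>2) (d /\<^sub>R (norm x)\<^sup>2)"
  shows "hopf y = hopf x + d" "\<exists>s>0. herm y x = of_real s"
proof -
  define n where "n = (norm x)\<^sup>2"
  have n: "n > 0" using x by (simp add: n_def)
  define p where "p = hopf x /\<^sub>R n"
  define e where "e = d /\<^sub>R n"
  have p: "p \<in> ImH" "norm p = 1" using n hopf_ImH[of x] by (auto simp: p_def ImH_def norm_hopf
      n_def)
  have e: "e \<in> ImH" "norm e \<le> 1 / 2" using d n by (auto simp: e_def ImH_def n_def divide_simps)
  note hs = hopf_sec[OF p e]
  have hx: "hopf x = n *\<^sub>R p" using n by (simp add: p_def)
  have y: "y = x \<odot> hopf_sec p e" by (simp add: y_def p_def e_def n_def)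
  have "hopf y = n *\<^sub>R (qcnj (hopf_sec p e) \<odot> p \<odot> hopf_sec p e)"
    unfolding y hopf_qmul hx by (simp add: qmul_def scaleR_conv_of_real algebra_simps)
  also have "\<dots> = hopf x + d" unfolding hs(1) using n by (simp add: hx scaleR_add_right e_def)
  finally show "hopf y = hopf x + d" .
  have "herm y x = of_real (n * Re (fst (hopf_sec p e)))"
    unfolding herm_def y herm_conj using hs(2) by (simp add: hx n_def)
  then show "\<exists>s>0. herm y x = of_real s" using n hs(3) by (intro exI[of _ "n * Re (fst (hopf_sec p
      e))"]) simp
qed

section \<open>The lattice and the torus\<close>

lemma summable_on_finite_sum:
  fixes f :: "'i \<Rightarrow> 'a \<Rightarrow> real"
  assumes "finite I" "\<And>i. i \<in> I \<Longrightarrow> f i summable_on A"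
  shows "(\<lambda>k. \<Sum>i\<in>I. f i k) summable_on A"
  using assms by (induction I) (auto intro: summable_on_add)

lemma finite_ge_of_summable:
  fixes f :: "'a \<Rightarrow> real"
  assumes f: "f summable_on UNIV" "\<And>k. f k \<ge> 0" and e: "e > 0"
  shows "finite {k. e \<le> f k}"
proof (rule ccontr)
  assume inf: "infinite {k. e \<le> f k}"
  obtain n where n: "real n * e > infsum f UNIV" using reals_Archimedean3[OF e] by blast
  obtain F where F: "F \<subseteq> {k. e \<le> f k}" "finite F" "card F = n"
    using infinite_arbitrarily_large[OF inf] by blast
  have "real n * e = (\<Sum>k\<in>F. e)" using F by simp
  also have "\<dots> \<le> sum f F" by (rule sum_mono) (use F in auto)
  also have "\<dots> \<le> infsum f UNIV" by (rule finite_sum_le_infsum[OF f(1)]) (use F f(2) in auto)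
  finally show False using n by simp
qed

locale hk_setting =
  fixes u :: "'k::countable \<Rightarrow> int ^ 'n"
    and lam \<Lambda> :: "'k \<Rightarrow> quat"
    and \<beta> :: "('k \<Rightarrow> real) \<Rightarrow> real ^ 'n"
  assumes u_primitive: "\<And>k. primitive (u k)"
    and u_span: "span (range (\<lambda>k. real_vec (u k))) = UNIV"
    and lambda_Im: "\<And>k. lam k \<in> ImH"
    and flats_distinct: "inj (flat u lam)"
    and Lambda: "\<And>k. lam k = - (1/2) *\<^sub>R (qcnj (\<Lambda> k) \<odot> qi \<odot> \<Lambda> k)"
    and beta_continuous_linear: "continuous_linear_t lam \<beta>"
    and beta_u: "\<And>k. \<beta> (e_vec k) = real_vec (u k)"
    and flats_Suc_n: "\<And>F. F \<subseteq> range (flat u lam) \<Longrightarrow> card F = CARD('n) + 1 \<Longrightarrow> \<Inter> F = {}"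
    and flats_n: "\<And>K. card K = CARD('n) \<Longrightarrow> \<Inter> (flat u lam ` K) \<noteq> {} \<Longrightarrow> Z_basis_family u K"
begin

definition V :: "'k \<Rightarrow> real ^ 'n" where
  "V k = real_vec (u k)"

text \<open>\<open>C\<close> computes coordinates in the basis \<open>V (\<kappa> j)\<close>; its
  integrality on lattice vectors expresses that this basis generates the lattice. Indexing by the
  type \<open>'n\<close> lets coordinates be read with \<open>$\<close>.\<close>

definition frame :: "('n \<Rightarrow> 'k) \<Rightarrow> (real ^ 'n \<Rightarrow> real ^ 'n) \<Rightarrow> bool" where
  "frame \<kappa> C \<longleftrightarrow> linear C \<and> inj C \<and> (\<forall>j. C (V (\<kappa> j)) = axis j 1) \<and> (\<forall>w j. C (real_vec w) $ j \<in> \<int>)"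

lemma real_vec_add: "real_vec (v + w) = real_vec v + real_vec w"
  by (simp add: real_vec_def vec_eq_iff)

lemma real_vec_scale: "real_vec (c *s v) = of_int c *\<^sub>R real_vec v"
  by (simp add: real_vec_def vec_eq_iff)

lemma real_vec_sum: "real_vec (sum f A) = (\<Sum>a\<in>A. real_vec (f a))"
  by (induction A rule: infinite_finite_induct)
    (auto simp: real_vec_add, simp_all add: real_vec_def vec_eq_iff)

lemma norm_V_ge_1: "norm (V k) \<ge> 1"
proof -
  have "u k \<noteq> 0"
  proof
    assume "u k = 0"
    \<comment> \<open>The zero vector is twice itself, which primitivity excludes. A nonzero integer
      vector has a coordinate of absolute value at least 1.\<close>
    then have "u k = 2 *s (0 :: int ^ 'n)" by (simp add: vec_eq_iff)
    then show False using u_primitive[of k] unfolding primitive_def by fastforce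
  qed
  then obtain i where "u k $ i \<noteq> 0" by (auto simp: vec_eq_iff)
  then have "1 \<le> \<bar>u k $ i\<bar>" by linarith
  then have "1 \<le> \<bar>V k $ i\<bar>" by (simp add: V_def real_vec_def)
  also have "\<dots> \<le> norm (V k)" by (rule component_le_norm_cart)
  finally show ?thesis .
qed

lemma ImH_subspace: "subspace ImH"
  by (auto simp: subspace_def ImH_def)

lemma in_flat_iff: "a \<in> flat u lam k \<longleftrightarrow> linear a \<and> range a \<subseteq> ImH \<and> a (V k) = lam k"
  by (simp add: flat_def V_def)

lemma frame_of_Z_basis:
  assumes K: "card K = CARD('n)" "Z_basis_family u K" and inj: "inj_on V K"
    and ind: "independent (V ` K)" and spn: "span (V ` K) = UNIV"
  obtains \<kappa> C where "frame \<kappa> C" "range \<kappa> = K"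
proof -
  have fin: "finite K" using K(1) by (metis card.infinite zero_less_card_finite less_irrefl)
  then obtain \<kappa> where k: "bij_betw \<kappa> (UNIV :: 'n set) K"
    using K(1) by (metis finite_same_card_bij finite)
  have k1: "inj \<kappa>" "range \<kappa> = K" using k by (auto simp: bij_betw_def)
  define g where "g b = axis (inv \<kappa> (inv_into K V b)) (1::real)" for b
  obtain C where C: "linear C" "\<forall>b\<in>V ` K. C b = g b"
    using linear_independent_extend[OF ind] by blast
  have CV: "C (V (\<kappa> j)) = axis j 1" for j
  proof -
    have "\<kappa> j \<in> K" using k1 by auto
    then have "C (V (\<kappa> j)) = g (V (\<kappa> j))" using C(2) by blast
    then show ?thesis using \<open>\<kappa> j \<in> K\<close> inj k1 by (simp add: g_def)
  qed
  \<comment> \<open>Rebuilds a vector from its coordinates; as a left inverse of \<open>C\<close> it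
    gives injectivity.\<close>
  define E where "E v = (\<Sum>j\<in>UNIV. v $ j *\<^sub>R V (\<kappa> j))" for v :: "real ^ 'n"
  have lE: "linear E" unfolding E_def
    by (rule linearI) (simp_all add: scaleR_add_left sum.distrib scaleR_sum_right)
  have EV: "E (C v) = v" for v
  proof -
    have "(E \<circ> C) v = id v"
    proof (rule linear_eq_on_span[OF linear_compose[OF C(1) lE] linear_id])
      show "v \<in> span (V ` K)" by (simp add: spn)
      fix b assume "b \<in> V ` K"
      then obtain j where "b = V (\<kappa> j)" using k1 by auto
      then show "(E \<circ> C) b = id b"
        by (simp add: CV E_def axis_def if_distrib[of "\<lambda>x. x *\<^sub>R _"] cong: if_cong)
    qed
    then show ?thesis by simp
  qed
  then have injC: "inj C" by (metis injI)
  have "C (real_vec w) $ j \<in> \<int>" for w j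
  proof -
    obtain c where "w = (\<Sum>k\<in>K. c k *s u k)" using K(2) unfolding Z_basis_family_def by metis
    then have "C (real_vec w) = (\<Sum>k\<in>K. of_int (c k) *\<^sub>R C (V k))"
      by (simp add: real_vec_sum real_vec_scale V_def linear_sum[OF C(1)] linear_scale[OF C(1)])
    also have "\<dots> $ j = (\<Sum>k\<in>K. of_int (c k) * C (V k) $ j)" by simp
    also have "\<dots> \<in> \<int>"
    proof (rule Ints_sum)
      fix k assume "k \<in> K"
      then obtain i where "k = \<kappa> i" using k1 by auto
      then show "of_int (c k) * C (V k) $ j \<in> \<int>" by (simp add: CV axis_def)
    qed
    finally show ?thesis .
  qed
  then have "frame \<kappa> C" unfolding frame_def using C(1) injC CV by blast
  then show ?thesis using k1(2) by (rule that)
qed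

text \<open>Flats through a point have independent normals: otherwise they would also pass through a
  further point lying on \<open>n + 1\<close> flats.  Extending the normals to a basis, the corresponding
  \<open>n\<close> flats meet.\<close>

lemma exists_frame:
  assumes a: "linear a" "range a \<subseteq> ImH"
  obtains \<kappa> C where "frame \<kappa> C" "{k. a (V k) = lam k} \<subseteq> range \<kappa>"
proof -
  define Ka where "Ka = {k. a (V k) = lam k}"
  obtain B0 where B0: "B0 \<subseteq> V ` Ka" "independent B0" "V ` Ka \<subseteq> span B0"
    by (rule maximal_independent_subset)
  obtain B where B: "B0 \<subseteq> B" "B \<subseteq> range V" "independent B" "range V \<subseteq> span B"
    by (rule maximal_independent_subset_extend[of B0 "range V"]) (use B0 in auto)
  have spB: "span B = UNIV"
    using span_mono[OF B(4)] u_span unfolding V_def[abs_def] by (simp add: span_span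
        top.extremum_unique)
  have cB: "card B = CARD('n)"
    using dim_eq_card[of B UNIV] B(3) spB by (simp add: dim_UNIV)
  \<comment> \<open>A vector may be the normal of several parallel flats. For members of
    \<open>B0\<close> the chosen flat has to pass through \<open>a\<close>, since only then does the
    new point agree with \<open>a\<close> on \<open>B0\<close>.\<close>
  define pick where "pick b = (if b \<in> B0 then SOME k. k \<in> Ka \<and> V k = b else SOME k. V k = b)" for b
  have pick0: "pick b \<in> Ka \<and> V (pick b) = b" if "b \<in> B0" for b
  proof -
    have "\<exists>k. k \<in> Ka \<and> V k = b" using B0(1) that by blast
    from someI_ex[OF this] show ?thesis using that by (simp add: pick_def)
  qed
  have pick1: "V (pick b) = b" if "b \<in> B" for b
  proof (cases "b \<in> B0")
    case False
    have "\<exists>k. V k = b" using B(2) that by blast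
    from someI_ex[OF this] show ?thesis using False by (simp add: pick_def)
  qed (use pick0 in blast)
  define K where "K = pick ` B"
  have VK: "V ` K = B" using pick1 by (auto simp: K_def image_iff)
  have injV: "inj_on V K" using pick1 by (auto simp: K_def inj_on_def)
  have cK: "card K = CARD('n)" using card_image[OF injV] cB VK by simp
  \<comment> \<open>The common point of the \<open>n\<close> chosen flats; their normals form a
    basis, so their values can be prescribed.\<close>
  obtain a' where a': "linear a'" "\<forall>b\<in>B. a' b = lam (pick b)"
    using linear_independent_extend[OF B(3), of "\<lambda>b. lam (pick b)"] by (elim exE conjE) (rule that)
  have im: "a' v \<in> ImH" for v
  proof -
    have "a' ` span B = span (a' ` B)" by (rule linear_span_image[OF a'(1), symmetric])
    also have "\<dots> \<subseteq> ImH" by (rule span_minimal[OF _ ImH_subspace]) (use a'(2) lambda_Im in auto)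
    finally show ?thesis using spB by auto
  qed
  have onK: "a' \<in> flat u lam k" if kK: "k \<in> K" for k
  proof -
    obtain b where "b \<in> B" "k = pick b" using kK by (auto simp: K_def)
    then show ?thesis using a' im pick1 by (auto simp: in_flat_iff)
  qed
  have onKa: "a' \<in> flat u lam k" if "k \<in> Ka" for k
  proof -
    have "a' (V k) = a (V k)"
    proof (rule linear_eq_on_span[OF a'(1) a(1)])
      show "V k \<in> span B0" using B0(3) that by auto
      fix b assume "b \<in> B0"
      then show "a' b = a b" using a'(2) B(1) pick0[of b] by (auto simp: Ka_def)
    qed
    then show ?thesis using that im a'(1) by (auto simp: in_flat_iff Ka_def)
  qed
  have "Ka \<subseteq> K"
  proof (rule ccontr)
    assume "\<not> Ka \<subseteq> K"
    then obtain k where k: "k \<in> Ka" "k \<notin> K" by blast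
    have finK: "finite K" using cK by (metis card.infinite zero_less_card_finite less_irrefl)
    \<comment> \<open>As the flats are distinct, adding the index \<open>k\<close> yields
      \<open>n + 1\<close> flats through \<open>a'\<close>, against the first condition.\<close>
    have "card (flat u lam ` insert k K) = card (insert k K)"
      by (rule card_image) (rule inj_on_subset[OF flats_distinct], simp)
    also have "\<dots> = CARD('n) + 1" using k finK cK by simp
    finally have "\<Inter> (flat u lam ` insert k K) = {}" by (intro flats_Suc_n) auto
    then show False using onK onKa[OF k(1)] by auto
  qed
  moreover have "Z_basis_family u K"
  proof (rule flats_n[OF cK])
    show "\<Inter> (flat u lam ` K) \<noteq> {}" using onK by blast
  qed
  then obtain \<kappa> C where "frame \<kappa> C" "range \<kappa> = K"
    by (rule frame_of_Z_basis[OF cK _ injV]) (use B(3) spB VK that in auto)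
  ultimately show ?thesis by (intro that[of \<kappa> C]) (auto simp: Ka_def)
qed

section \<open>The map \<open>\<beta>\<close> as a convergent series\<close>

lemma t_alg_summable: "t \<in> t_alg lam \<Longrightarrow> (\<lambda>k. (1 + norm (lam k)) * (t k)\<^sup>2) summable_on UNIV"
  by (simp add: t_alg_def)

lemma t_alg_scale: "t \<in> t_alg lam \<Longrightarrow> (\<lambda>k. c * t k) \<in> t_alg lam"
  using summable_on_cmult_right[of "\<lambda>k. (1 + norm (lam k)) * (t k)\<^sup>2" UNIV "c\<^sup>2"]
  by (simp add: t_alg_def power_mult_distrib mult_ac)

lemma t_alg_le:
  assumes "t \<in> t_alg lam" "\<And>k. (f k)\<^sup>2 \<le> C * (t k)\<^sup>2"
  shows "f \<in> t_alg lam"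
  unfolding t_alg_def mem_Collect_eq
proof (rule summable_on_comparison_test)
  show "(\<lambda>k. C * ((1 + norm (lam k)) * (t k)\<^sup>2)) summable_on UNIV"
    by (intro summable_on_cmult_right t_alg_summable assms)
  fix k
  show "(1 + norm (lam k)) * (f k)\<^sup>2 \<le> C * ((1 + norm (lam k)) * (t k)\<^sup>2)"
    using mult_left_mono[OF assms(2)[of k], of "1 + norm (lam k)"] by (simp add: mult_ac)
qed simp

lemma t_alg_finite: "finite {k. t k \<noteq> 0} \<Longrightarrow> t \<in> t_alg lam"
proof -
  assume F: "finite {k. t k \<noteq> 0}"
  have "(\<lambda>k. (1 + norm (lam k)) * (t k)\<^sup>2) summable_on {k. t k \<noteq> 0}" using F by simp
  then show ?thesis unfolding t_alg_def mem_Collect_eq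
    by (rule summable_on_cong_neutral[THEN iffD1, rotated -1]) auto
qed

lemma t_alg_add:
  assumes "s \<in> t_alg lam" "t \<in> t_alg lam"
  shows "(\<lambda>k. s k + t k) \<in> t_alg lam"
  unfolding t_alg_def mem_Collect_eq
proof (rule summable_on_comparison_test)
  show "(\<lambda>k. 2 * ((1 + norm (lam k)) * (s k)\<^sup>2) + 2 * ((1 + norm (lam k)) * (t k)\<^sup>2)) summable_on
      UNIV"
    by (intro summable_on_cmult_right summable_on_add t_alg_summable assms)
  fix k
  have "(s k + t k)\<^sup>2 \<le> 2 * (s k)\<^sup>2 + 2 * (t k)\<^sup>2"
    using sum_squares_bound[of "s k" "t k"] by (simp add: power2_sum)
  from mult_left_mono[OF this, of "1 + norm (lam k)"]
  show "(1 + norm (lam k)) * (s k + t k)\<^sup>2 \<le> 2 * ((1 + norm (lam k)) * (s k)\<^sup>2) + 2 * ((1 + norm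
      (lam k)) * (t k)\<^sup>2)"
    by (simp add: algebra_simps)
qed simp

lemma t_alg_uminus: "t \<in> t_alg lam \<Longrightarrow> (\<lambda>k. - t k) \<in> t_alg lam"
  by (simp add: t_alg_def)

lemma beta_add: "s \<in> t_alg lam \<Longrightarrow> t \<in> t_alg lam \<Longrightarrow> \<beta> (\<lambda>k. s k + t k) = \<beta> s + \<beta> t"
  using beta_continuous_linear by (simp add: continuous_linear_t_def)

lemma beta_scale: "t \<in> t_alg lam \<Longrightarrow> \<beta> (\<lambda>k. c * t k) = c *\<^sub>R \<beta> t"
  using beta_continuous_linear by (simp add: continuous_linear_t_def)

lemma beta_uminus: "t \<in> t_alg lam \<Longrightarrow> \<beta> (\<lambda>k. - t k) = - \<beta> t"
  using beta_scale[of t "-1"] by simp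

lemma beta_bound:
  obtains C where "C \<ge> 0" "\<And>t. t \<in> t_alg lam \<Longrightarrow> norm (\<beta> t) \<le> C * t_norm lam t"
proof -
  obtain C where C: "\<forall>t\<in>t_alg lam. norm (\<beta> t) \<le> C * t_norm lam t"
    using beta_continuous_linear unfolding continuous_linear_t_def by blast
  have "norm (\<beta> t) \<le> \<bar>C\<bar> * t_norm lam t" if "t \<in> t_alg lam" for t
  proof -
    have "C * t_norm lam t \<le> \<bar>C\<bar> * t_norm lam t"
      by (intro mult_right_mono) (auto simp: t_norm_def infsum_nonneg)
    then show ?thesis using C that by force
  qed
  then show ?thesis by (intro that[of "\<bar>C\<bar>"]) auto
qed

lemma beta_finite:
  assumes "finite F"
  shows "\<beta> (\<lambda>k. if k \<in> F then t k else 0) = (\<Sum>k\<in>F. t k *\<^sub>R V k)"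
  using assms
proof (induction F)
  case empty
  show ?case using beta_scale[of "\<lambda>_. 0" 0] t_alg_finite[of "\<lambda>_. 0"] by simp
next
  case (insert a F)
  have e: "e_vec a \<in> t_alg lam" by (rule t_alg_finite) (simp add: e_vec_def)
  have "(\<lambda>k. if k \<in> insert a F then t k else 0) = (\<lambda>k. t a * e_vec a k + (if k \<in> F then t k else
      0))"
    using insert.hyps by (auto simp: e_vec_def fun_eq_iff)
  then have "\<beta> (\<lambda>k. if k \<in> insert a F then t k else 0)
      = \<beta> (\<lambda>k. t a * e_vec a k) + \<beta> (\<lambda>k. if k \<in> F then t k else 0)"
    using beta_add[OF t_alg_scale[OF e, of "t a"] t_alg_finite[of "\<lambda>k. if k \<in> F then t k else 0"]]
      insert.hyps by simp
  then show ?case using insert beta_scale[OF e, of "t a"] by (simp add: beta_u V_def)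
qed

text \<open>The error of a finite partial sum is \<open>\<beta>\<close> of the remaining tail, which
  continuity bounds by the weighted norm of that tail.\<close>

lemma beta_has_sum:
  assumes t: "t \<in> t_alg lam"
  shows "((\<lambda>k. t k *\<^sub>R V k) has_sum \<beta> t) UNIV"
proof -
  obtain C where C: "C \<ge> 0" "\<And>t. t \<in> t_alg lam \<Longrightarrow> norm (\<beta> t) \<le> C * t_norm lam t"
    by (rule beta_bound) (rule that)
  let ?f = "\<lambda>k. (1 + norm (lam k)) * (t k)\<^sup>2"
  note sf = t_alg_summable[OF t]
  have "((\<lambda>F. C * sqrt (infsum ?f UNIV - sum ?f F)) \<longlongrightarrow> C * sqrt (infsum ?f UNIV - infsum ?f UNIV))
      (finite_subsets_at_top UNIV)"
    by (intro tendsto_intros infsum_tendsto sf)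
  then have lim: "((\<lambda>F. C * sqrt (infsum ?f UNIV - sum ?f F)) \<longlongrightarrow> 0) (finite_subsets_at_top UNIV)" by
      simp
  have bd: "norm ((\<Sum>k\<in>F. t k *\<^sub>R V k) - \<beta> t) \<le> C * sqrt (infsum ?f UNIV - sum ?f F)" if F: "finite
      F" for F
  proof -
    let ?r = "\<lambda>k. if k \<in> F then 0 else t k" and ?s = "\<lambda>k. if k \<in> F then t k else 0"
    have r: "?r \<in> t_alg lam" by (rule t_alg_le[OF t, of _ 1]) auto
    have s: "?s \<in> t_alg lam" by (rule t_alg_finite) (use F in auto)
    have "(\<lambda>k. ?s k + ?r k) = t" by auto
    then have "\<beta> t = (\<Sum>k\<in>F. t k *\<^sub>R V k) + \<beta> ?r" using beta_add[OF s r] beta_finite[OF F] by simp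
    then have "norm ((\<Sum>k\<in>F. t k *\<^sub>R V k) - \<beta> t) \<le> C * t_norm lam ?r" using C(2)[OF r] by simp
    also have "t_norm lam ?r = sqrt (infsum ?f (- F))"
      unfolding t_norm_def by (intro arg_cong[where f = sqrt] infsum_cong_neutral) auto
    also have "infsum ?f (- F) = infsum ?f UNIV - sum ?f F"
    proof -
      have "infsum ?f (F \<union> - F) = infsum ?f F + infsum ?f (- F)"
        by (rule infsum_Un_disjoint) (use F sf in \<open>auto intro: summable_on_subset_banach\<close>)
      then show ?thesis using F by simp
    qed
    finally show ?thesis .
  qed
  have "((\<lambda>F. (\<Sum>k\<in>F. t k *\<^sub>R V k) - \<beta> t) \<longlongrightarrow> 0) (finite_subsets_at_top UNIV)"
    by (rule Lim_null_comparison[OF _ lim]) (auto simp: eventually_finite_subsets_at_top intro!: bd)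
  then show ?thesis unfolding has_sum_def by (simp add: LIM_zero_iff)
qed

text \<open>A duality argument: each coordinate of \<open>\<beta>\<close> is a bounded functional
  for the weighted norm, and the sum is the squared dual norm of its coefficients. Testing on the
  truncation of \<open>V k $ i / (1 + norm (lam k))\<close> gives \<open>s \<le> C * sqrt s\<close>
  for every partial sum \<open>s\<close>, so \<open>s \<le> C\<^sup>2\<close>.\<close>

lemma summable_V: "(\<lambda>k. (norm (V k))\<^sup>2 / (1 + norm (lam k))) summable_on UNIV"
proof -
  obtain C where C: "C \<ge> 0" "\<And>t. t \<in> t_alg lam \<Longrightarrow> norm (\<beta> t) \<le> C * t_norm lam t"
    by (rule beta_bound) (rule that)
  have wpos: "1 + norm (lam k) > 0" for k by (simp add: add_pos_nonneg)
  have comp: "(\<lambda>k. (V k $ i)\<^sup>2 / (1 + norm (lam k))) summable_on UNIV" for i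
  proof (rule nonneg_bdd_above_summable_on)
    show "bdd_above (sum (\<lambda>k. (V k $ i)\<^sup>2 / (1 + norm (lam k))) ` {F. F \<subseteq> UNIV \<and> finite F})"
    proof (rule bdd_aboveI)
      fix s assume "s \<in> sum (\<lambda>k. (V k $ i)\<^sup>2 / (1 + norm (lam k))) ` {F. F \<subseteq> UNIV \<and> finite F}"
      then obtain F where F: "finite F" "s = (\<Sum>k\<in>F. (V k $ i)\<^sup>2 / (1 + norm (lam k)))" by auto
      let ?t = "\<lambda>k. V k $ i / (1 + norm (lam k))" and ?s = "\<lambda>k. if k \<in> F then V k $ i / (1 + norm
          (lam k)) else 0"
      have s: "?s \<in> t_alg lam" by (rule t_alg_finite) (use F in auto)
      have s0: "s \<ge> 0" unfolding F(2) using wpos by (intro sum_nonneg divide_nonneg_nonneg) (auto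
          intro: less_imp_le)
      have "\<beta> ?s $ i = (\<Sum>k\<in>F. ?t k *\<^sub>R V k) $ i" by (simp add: beta_finite[OF F(1)])
      also have "\<dots> = s" unfolding F(2) by (simp add: power2_eq_square)
      finally have "s \<le> norm (\<beta> ?s)" using component_le_norm_cart[of "\<beta> ?s" i] by linarith
      also have "\<dots> \<le> C * t_norm lam ?s" by (rule C(2)[OF s])
      also have "t_norm lam ?s = sqrt s"
      proof -
        have "(\<Sum>\<^sub>\<infinity>k. (1 + norm (lam k)) * (?s k)\<^sup>2) = (\<Sum>\<^sub>\<infinity>k\<in>F. (V k $ i)\<^sup>2 / (1 + norm (lam k)))"
        proof (rule infsum_cong_neutral)
          fix k assume "k \<in> UNIV \<inter> F"
          then show "(1 + norm (lam k)) * (?s k)\<^sup>2 = (V k $ i)\<^sup>2 / (1 + norm (lam k))"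
            using wpos[of k] by (simp add: power2_eq_square)
        qed auto
        then show ?thesis using F by (simp add: t_norm_def)
      qed
      finally have "sqrt s * sqrt s \<le> C * sqrt s" using s0 by simp
      then have "sqrt s \<le> C" using C(1) s0 mult_right_le_imp_le[of "sqrt s" "sqrt s" C]
        by (cases "s = 0") auto
      then show "s \<le> C\<^sup>2" using s0 sqrt_le_D by blast
    qed
  qed (use wpos in \<open>auto intro!: divide_nonneg_nonneg intro: less_imp_le\<close>)
  have "(\<lambda>k. (norm (V k))\<^sup>2 / (1 + norm (lam k))) = (\<lambda>k. \<Sum>i\<in>UNIV. (V k $ i)\<^sup>2 / (1 + norm (lam k)))"
    by (auto simp: norm_vec_def L2_set_def sum_nonneg sum_divide_distrib)
  then show ?thesis using comp by (simp add: summable_on_finite_sum)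
qed

text \<open>Since \<open>V k\<close> has norm at least 1, every index with
  \<open>norm (lam k) \<le> R\<close> contributes at least a fixed amount to the convergent sum in
  \<open>summable_V\<close>.\<close>

lemma finite_lam_le: "finite {k. norm (lam k) \<le> R}"
proof -
  have e: "1 / (1 + \<bar>R\<bar>) > 0" by (simp add: add_pos_nonneg)
  have "1 / (1 + \<bar>R\<bar>) \<le> (norm (V k))\<^sup>2 / (1 + norm (lam k))" if "norm (lam k) \<le> R" for k
  proof -
    have "1 \<le> (norm (V k))\<^sup>2" using norm_V_ge_1[of k] by (rule one_le_power)
    then show ?thesis using that by (intro frac_le) (auto simp: add_pos_nonneg)
  qed
  then have "{k. norm (lam k) \<le> R} \<subseteq> {k. 1 / (1 + \<bar>R\<bar>) \<le> (norm (V k))\<^sup>2 / (1 + norm (lam k))}"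
    by blast
  then show ?thesis
    by (rule finite_subset) (rule finite_ge_of_summable[OF summable_V _ e], simp add:
        add_nonneg_nonneg)
qed

end

lemma norm_one_minus_exp_le: "norm (1 - exp (\<i> * complex_of_real t)) \<le> \<bar>t\<bar>"
  using dist_exp_i_1[of t] abs_sin_x_le_abs_x[of "t / 2"] by (simp add: norm_minus_commute)

lemma exp_i_eq_1_iff: "exp (\<i> * complex_of_real t) = 1 \<longleftrightarrow> (\<exists>n::int. t = 2 * pi * of_int n)"
  by (auto simp: exp_eq_1 mult_ac)

lemma act_apply: "act g x k = qcomplex (g k) \<odot> x k"
  by (simp add: act_def)

lemma norm_qcomplex: "norm (qcomplex c) = norm c"
  by (simp add: qcomplex_def norm_prod_def)

lemma M_aff_iff_coord: "x \<in> M_aff \<Lambda> \<longleftrightarrow> (\<lambda>k. (norm (x k - \<Lambda> k))\<^sup>2) summable_on UNIV"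
  by (simp add: M_aff_def)

lemma M_aff_trans:
  assumes "x \<in> M_aff \<Lambda>" "(\<lambda>k. (norm (y k - x k))\<^sup>2) summable_on UNIV"
  shows "y \<in> M_aff \<Lambda>"
  using l2H_add[OF assms(2) assms(1)[unfolded M_aff_iff_coord]] by (simp add: M_aff_def)

lemma M_aff_diff:
  assumes "x \<in> M_aff \<Lambda>" "y \<in> M_aff \<Lambda>"
  shows "(\<lambda>k. (norm (x k - y k))\<^sup>2) summable_on UNIV"
  using l2H_summable[of "coord \<Lambda> x - coord \<Lambda> y"] assms by (simp add: minus_l2H.rep_eq
      l2H_apply_coord)

definition of_coord :: "('k \<Rightarrow> quat) \<Rightarrow> 'k l2H \<Rightarrow> 'k \<Rightarrow> quat" where
  "of_coord \<Lambda> v = (\<lambda>k. \<Lambda> k + l2H_apply v k)"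

lemma of_coord_M_aff: "of_coord \<Lambda> v \<in> M_aff \<Lambda>"
  by (simp add: M_aff_def of_coord_def l2H_summable)

lemma coord_of_coord: "coord \<Lambda> (of_coord \<Lambda> v) = v"
  by (rule l2H_eqI) (simp add: l2H_apply_coord of_coord_M_aff, simp add: of_coord_def)

lemma of_coord_coord: "x \<in> M_aff \<Lambda> \<Longrightarrow> of_coord \<Lambda> (coord \<Lambda> x) = x"
  by (simp add: of_coord_def l2H_apply_coord fun_eq_iff)

lemma norm_diff_le_coord:
  "x \<in> M_aff \<Lambda> \<Longrightarrow> y \<in> M_aff \<Lambda> \<Longrightarrow> norm (x k - y k) \<le> norm (coord \<Lambda> x - coord \<Lambda> y)"
  using norm_l2H_apply_le[of "coord \<Lambda> x - coord \<Lambda> y" k] by (simp add: minus_l2H.rep_eq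
      l2H_apply_coord)

section \<open>Moment values and the growth of points\<close>

context hk_setting
begin

definition mu :: "('k \<Rightarrow> quat) \<Rightarrow> 'k \<Rightarrow> quat" where
  "mu x k = lam k + (1 / 2) *\<^sub>R hopf (x k)"

lemma moment_eq: "moment lam x t = (\<Sum>\<^sub>\<infinity>k. t k *\<^sub>R mu x k)"
  by (simp add: moment_def mu_def hopf_def)

lemma lam_hopf: "lam k = - (1 / 2) *\<^sub>R hopf (\<Lambda> k)"
  using Lambda by (simp add: hopf_def)

lemma norm_Lambda_sq: "(norm (\<Lambda> k))\<^sup>2 = 2 * norm (lam k)"
  by (simp add: lam_hopf norm_hopf)

lemma mu_ImH: "mu x k \<in> ImH"
  using lambda_Im[of k] hopf_ImH[of "x k"] by (simp add: mu_def ImH_def)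

lemma M_aff_bound:
  assumes "x \<in> M_aff \<Lambda>"
  obtains M where "M \<ge> 0" "\<And>k. norm (x k - \<Lambda> k) \<le> M"
  using norm_l2H_apply_le[of "coord \<Lambda> x"] l2H_apply_coord[OF assms] by (metis norm_ge_zero)

lemma sq_add_le: "(a + b)\<^sup>2 \<le> 2 * a\<^sup>2 + 2 * (b::real)\<^sup>2"
  using sum_squares_bound[of a b] by (simp add: power2_sum)

text \<open>Here \<open>(norm (\<Lambda> k))\<^sup>2 = 2 * norm (lam k)\<close> and
  \<open>x - \<Lambda>\<close> is bounded. This bound makes the torus preserve the affine space: the
  displacement \<open>(g k - 1) x k\<close> is controlled by the weighted condition on
  \<open>g\<close>.\<close>

lemma norm_sq_le_weight:
  assumes "x \<in> M_aff \<Lambda>"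
  obtains c where "c > 0" "\<And>k. (norm (x k))\<^sup>2 \<le> c * (1 + norm (lam k))"
proof -
  obtain M where M: "M \<ge> 0" "\<And>k. norm (x k - \<Lambda> k) \<le> M" using assms by (rule M_aff_bound) (rule that)
  have "(norm (x k))\<^sup>2 \<le> (4 + 2 * M\<^sup>2) * (1 + norm (lam k))" for k
  proof -
    have "norm (x k) \<le> norm (\<Lambda> k) + M" using M(2)[of k] norm_triangle_sub[of "x k" "\<Lambda> k"] by simp
    then have "(norm (x k))\<^sup>2 \<le> (norm (\<Lambda> k) + M)\<^sup>2" by (rule power_mono) simp
    also have "\<dots> \<le> 4 * norm (lam k) + 2 * M\<^sup>2"
      using sq_add_le[of "norm (\<Lambda> k)" M] by (simp add: norm_Lambda_sq)
    also have "\<dots> \<le> (4 + 2 * M\<^sup>2) * (1 + norm (lam k))"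
      using M by (simp add: algebra_simps)
    finally show ?thesis .
  qed
  then show ?thesis by (rule that[rotated]) (simp add: add_pos_nonneg)
qed

lemma lam_le_norm_sq:
  assumes "x \<in> M_aff \<Lambda>"
  obtains c where "c > 0" "\<And>k. norm (lam k) \<le> (norm (x k))\<^sup>2 + c"
proof -
  obtain M where M: "M \<ge> 0" "\<And>k. norm (x k - \<Lambda> k) \<le> M" using assms by (rule M_aff_bound) (rule that)
  have "norm (lam k) \<le> (norm (x k))\<^sup>2 + (M\<^sup>2 + 1)" for k
  proof -
    have "norm (\<Lambda> k) \<le> norm (x k) + M" using M(2)[of k] norm_triangle_sub[of "\<Lambda> k" "x k"]
      by (simp add: norm_minus_commute)
    then have "(norm (\<Lambda> k))\<^sup>2 \<le> (norm (x k) + M)\<^sup>2" by (rule power_mono) simp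
    also have "\<dots> \<le> 2 * (norm (x k))\<^sup>2 + 2 * M\<^sup>2" by (rule sq_add_le)
    finally show ?thesis by (simp add: norm_Lambda_sq)
  qed
  then show ?thesis by (rule that[rotated]) (simp add: add_nonneg_pos)
qed

lemma finite_norm_le:
  assumes "x \<in> M_aff \<Lambda>"
  shows "finite {k. norm (x k) \<le> R}"
proof -
  obtain c where c: "\<And>k. norm (lam k) \<le> (norm (x k))\<^sup>2 + c"
    using assms by (rule lam_le_norm_sq) (rule that)
  have "{k. norm (x k) \<le> R} \<subseteq> {k. norm (lam k) \<le> R\<^sup>2 + c}"
  proof clarify
    fix k assume "norm (x k) \<le> R"
    then have "(norm (x k))\<^sup>2 \<le> R\<^sup>2" by (rule power_mono) simp
    then show "norm (lam k) \<le> R\<^sup>2 + c" using c[of k] by linarith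
  qed
  then show ?thesis using finite_lam_le finite_subset by blast
qed

text \<open>The reverse comparison. It holds as soon as \<open>x k\<close> has norm greater than 1,
  which excludes finitely many indices; those among them outside \<open>K\<close> have nonzero
  coordinates and are absorbed into the constant by the sum \<open>b\<close>.\<close>

lemma weight_le_norm_sq:
  assumes x: "x \<in> M_aff \<Lambda>" and K: "{k. x k = 0} \<subseteq> K"
  obtains c where "c > 0" "\<And>k. k \<notin> K \<Longrightarrow> 1 + norm (lam k) \<le> c * (norm (x k))\<^sup>2"
proof -
  obtain c where c: "c > 0" "\<And>k. norm (lam k) \<le> (norm (x k))\<^sup>2 + c"
    using x by (rule lam_le_norm_sq) (rule that)
  define F where "F = {k. norm (x k) \<le> 1} - K"
  have F: "finite F" using finite_norm_le[OF x] by (simp add: F_def)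
  define b where "b = (\<Sum>k\<in>F. (1 + norm (lam k)) / (norm (x k))\<^sup>2)"
  have b: "b \<ge> 0" unfolding b_def by (intro sum_nonneg) simp
  have "1 + norm (lam k) \<le> (2 + c + b) * (norm (x k))\<^sup>2" if k: "k \<notin> K" for k
  proof (cases "k \<in> F")
    case True
    have nz: "norm (x k) > 0" using K k by auto
    have "(1 + norm (lam k)) / (norm (x k))\<^sup>2 \<le> b"
      unfolding b_def by (rule member_le_sum[OF True]) (auto simp: F)
    then have "1 + norm (lam k) \<le> b * (norm (x k))\<^sup>2" using nz by (simp add: divide_le_eq)
    also have "\<dots> \<le> (2 + c + b) * (norm (x k))\<^sup>2" using c by (intro mult_right_mono) auto
    finally show ?thesis .
  next
    case False
    then have "1 \<le> norm (x k)" using k by (simp add: F_def)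
    then have 1: "1 \<le> (norm (x k))\<^sup>2" by (rule one_le_power)
    have "1 + norm (lam k) \<le> (norm (x k))\<^sup>2 + (1 + c) * 1" using c(2)[of k] by simp
    also have "\<dots> \<le> (norm (x k))\<^sup>2 + (1 + c) * (norm (x k))\<^sup>2"
      using 1 c by (intro add_left_mono mult_left_mono) auto
    also have "\<dots> \<le> (2 + c + b) * (norm (x k))\<^sup>2" using b by (simp add: algebra_simps)
    finally show ?thesis .
  qed
  then show ?thesis using b c(1) by (intro that[of "2 + c + b"]) auto
qed

section \<open>The torus action and its orbits\<close>

lemma exp_t_T_group:
  assumes "t \<in> t_alg lam"
  shows "exp_t t \<in> T_group lam"
proof -
  have "(\<lambda>k. (1 + norm (lam k)) * (norm (1 - exp_t t k))\<^sup>2) summable_on UNIV"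
  proof (rule summable_on_comparison_test[OF t_alg_summable[OF assms]])
    fix k
    have "(norm (1 - exp_t t k))\<^sup>2 \<le> \<bar>t k\<bar>\<^sup>2"
      unfolding exp_t_def by (intro power_mono norm_one_minus_exp_le) simp
    then show "(1 + norm (lam k)) * (norm (1 - exp_t t k))\<^sup>2 \<le> (1 + norm (lam k)) * (t k)\<^sup>2"
      by (intro mult_left_mono) auto
  qed simp
  then show ?thesis by (simp add: T_group_def exp_t_def)
qed

lemma act_M_aff:
  assumes g: "g \<in> T_group lam" and x: "x \<in> M_aff \<Lambda>"
  shows "act g x \<in> M_aff \<Lambda>"
proof (rule M_aff_trans[OF x])
  obtain c where c: "c > 0" "\<And>k. (norm (x k))\<^sup>2 \<le> c * (1 + norm (lam k))"
    using x by (rule norm_sq_le_weight) (rule that)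
  show "(\<lambda>k. (norm (act g x k - x k))\<^sup>2) summable_on UNIV"
  proof (rule summable_on_comparison_test)
    show "(\<lambda>k. c * ((1 + norm (lam k)) * (norm (1 - g k))\<^sup>2)) summable_on UNIV"
      by (intro summable_on_cmult_right) (use g in \<open>simp add: T_group_def\<close>)
    fix k
    have "act g x k - x k = qcomplex (g k - 1) \<odot> x k"
      by (simp add: act_apply qcomplex_qmul prod_eq_iff algebra_simps)
    then have "(norm (act g x k - x k))\<^sup>2 = (norm (1 - g k))\<^sup>2 * (norm (x k))\<^sup>2"
      by (simp add: norm_qmul norm_qcomplex power_mult_distrib norm_minus_commute)
    also have "\<dots> \<le> (norm (1 - g k))\<^sup>2 * (c * (1 + norm (lam k)))"
      by (intro mult_left_mono c) simp
    finally show "(norm (act g x k - x k))\<^sup>2 \<le> c * ((1 + norm (lam k)) * (norm (1 - g k))\<^sup>2)"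
      by (simp add: mult_ac)
  qed simp
qed

text \<open>Logarithms of the elements of \<open>N_group\<close>, so that the group law becomes
  addition. Besides the Lie algebra \<open>n_alg\<close> it contains angles that
  \<open>\<beta>\<close> sends to nonzero points of the lattice 2 pi Z^n.\<close>

definition n_lattice :: "('k \<Rightarrow> real) set" where
  "n_lattice = {t \<in> t_alg lam. \<exists>m. \<beta> t = (2 * pi) *\<^sub>R real_vec m}"

lemma N_group_eq: "N_group lam \<beta> = exp_t ` n_lattice"
  using exp_t_T_group by (auto simp: N_group_def n_lattice_def)

lemma n_lattice_add:
  assumes "s \<in> n_lattice" "t \<in> n_lattice"
  shows "(\<lambda>k. s k + t k) \<in> n_lattice"
proof -
  obtain m m' where "\<beta> s = (2 * pi) *\<^sub>R real_vec m" "\<beta> t = (2 * pi) *\<^sub>R real_vec m'"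
    using assms by (auto simp: n_lattice_def)
  then have "\<beta> (\<lambda>k. s k + t k) = (2 * pi) *\<^sub>R real_vec (m + m')"
    using assms by (simp add: n_lattice_def beta_add real_vec_add scaleR_add_right)
  then show ?thesis using assms t_alg_add unfolding n_lattice_def by blast
qed

lemma n_lattice_uminus:
  assumes "t \<in> n_lattice"
  shows "(\<lambda>k. - t k) \<in> n_lattice"
proof -
  obtain m where "\<beta> t = (2 * pi) *\<^sub>R real_vec m" using assms by (auto simp: n_lattice_def)
  moreover have "real_vec (- m) = - real_vec m" by (simp add: real_vec_def vec_eq_iff)
  ultimately have "\<beta> (\<lambda>k. - t k) = (2 * pi) *\<^sub>R real_vec (- m)"
    using assms by (simp add: n_lattice_def beta_uminus)
  then show ?thesis using assms t_alg_uminus unfolding n_lattice_def by blast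
qed

lemma n_alg_subset_n_lattice: "n_alg lam \<beta> \<subseteq> n_lattice"
proof
  fix t assume "t \<in> n_alg lam \<beta>"
  moreover have "real_vec 0 = (0 :: real ^ 'n)" by (simp add: real_vec_def vec_eq_iff)
  ultimately show "t \<in> n_lattice" unfolding n_alg_def n_lattice_def by (auto intro!: exI[of _ 0])
qed

lemma n_lattice_zero: "(\<lambda>_. 0) \<in> n_lattice"
proof -
  have "(\<lambda>_. 0) \<in> t_alg lam" by (rule t_alg_finite) simp
  then have "(\<lambda>_. 0) \<in> n_alg lam \<beta>" using beta_scale[of "\<lambda>_. 0" 0] by (simp add: n_alg_def)
  then show ?thesis using n_alg_subset_n_lattice by blast
qed

lemma exp_t_add: "exp_t (\<lambda>k. s k + t k) k = exp_t s k * exp_t t k"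
  by (simp add: exp_t_def ring_distribs exp_add)

lemma norm_exp_t: "norm (exp_t t k) = 1"
  by (simp add: exp_t_def)

lemma act_exp_t_add: "act (exp_t (\<lambda>k. s k + t k)) x = act (exp_t s) (act (exp_t t) x)"
  by (simp add: act_def qcomplex_qmul exp_t_add fun_eq_iff mult.assoc)

lemma act_exp_t_zero: "act (exp_t (\<lambda>_. 0)) x = x"
  by (simp add: act_def exp_t_def qcomplex_qmul fun_eq_iff)

abbreviation Orb :: "('k \<Rightarrow> quat) \<Rightarrow> ('k \<Rightarrow> quat) set" where
  "Orb \<equiv> orbit (N_group lam \<beta>)"

lemma orbit_iff: "y \<in> Orb x \<longleftrightarrow> (\<exists>t\<in>n_lattice. y = act (exp_t t) x)"
  by (auto simp: orbit_def N_group_eq)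

lemma orbit_refl: "x \<in> Orb x"
  unfolding orbit_iff using n_lattice_zero act_exp_t_zero by metis

lemma orbit_sym: "y \<in> Orb x \<Longrightarrow> x \<in> Orb y"
proof -
  assume "y \<in> Orb x"
  then obtain t where t: "t \<in> n_lattice" "y = act (exp_t t) x" by (auto simp: orbit_iff)
  have "act (exp_t (\<lambda>k. - t k)) y = act (exp_t (\<lambda>k. - t k + t k)) x"
    unfolding t(2) by (rule act_exp_t_add[symmetric])
  then have "x = act (exp_t (\<lambda>k. - t k)) y" by (simp add: act_exp_t_zero)
  then show ?thesis using n_lattice_uminus[OF t(1)] by (auto simp: orbit_iff)
qed

lemma orbit_trans: "y \<in> Orb x \<Longrightarrow> z \<in> Orb y \<Longrightarrow> z \<in> Orb x"
  unfolding orbit_iff using n_lattice_add act_exp_t_add by metis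

lemma orbit_eq_iff: "Orb x = Orb y \<longleftrightarrow> y \<in> Orb x"
  using orbit_refl orbit_sym orbit_trans by blast

lemma hopf_orbit: "y \<in> Orb x \<Longrightarrow> hopf (y k) = hopf (x k)"
  by (auto simp: orbit_iff act_apply hopf_phase norm_exp_t)

lemma mu_orbit: "y \<in> Orb x \<Longrightarrow> mu y = mu x"
  by (simp add: mu_def hopf_orbit fun_eq_iff)

lemma M_aff_orbit: "y \<in> Orb x \<Longrightarrow> x \<in> M_aff \<Lambda> \<Longrightarrow> y \<in> M_aff \<Lambda>"
  by (auto simp: orbit_iff n_lattice_def intro: act_M_aff exp_t_T_group)

lemma zero_level_M_aff: "x \<in> zero_level \<Lambda> lam \<beta> \<Longrightarrow> x \<in> M_aff \<Lambda>"
  by (simp add: zero_level_def)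

lemma zero_level_orbit: "y \<in> Orb x \<Longrightarrow> x \<in> zero_level \<Lambda> lam \<beta> \<Longrightarrow> y \<in> zero_level \<Lambda> lam \<beta>"
  by (simp add: zero_level_def moment_eq mu_orbit M_aff_orbit)

section \<open>Frames, the zero level and freeness of the action\<close>

lemma frame_linear: "frame \<kappa> C \<Longrightarrow> linear C"
  by (simp add: frame_def)

lemma frame_inj: "frame \<kappa> C \<Longrightarrow> inj \<kappa>"
proof (rule injI)
  fix i j assume f: "frame \<kappa> C" and "\<kappa> i = \<kappa> j"
  then have "axis i (1::real) = axis j 1" unfolding frame_def by metis
  then show "i = j" by (simp add: axis_eq_axis)
qed

lemma frame_V: "frame \<kappa> C \<Longrightarrow> C (V (\<kappa> j)) = axis j 1"
  by (simp add: frame_def)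

lemma frame_expand:
  assumes "frame \<kappa> C"
  shows "v = (\<Sum>j\<in>UNIV. C v $ j *\<^sub>R V (\<kappa> j))"
proof -
  have "C v = C (\<Sum>j\<in>UNIV. C v $ j *\<^sub>R V (\<kappa> j))"
    by (simp add: linear_sum[OF frame_linear[OF assms]] linear_scale[OF frame_linear[OF assms]]
        frame_V[OF assms] vec_eq_iff axis_def if_distrib[of "\<lambda>x. _ * x"] cong: if_cong)
  then show ?thesis using assms unfolding frame_def by (metis injD)
qed

text \<open>The moment values annihilate the kernel of \<open>\<beta>\<close> exactly when they
  factor through the vectors \<open>V k\<close> by a linear map. If they do, that map is moved out
  of the series for \<open>\<beta> t\<close>; conversely, finitely supported kernel elements already
  give all the relations.\<close>

lemma zero_level_iff:
  assumes fr: "frame \<kappa> C"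
  shows "x \<in> zero_level \<Lambda> lam \<beta> \<longleftrightarrow>
    x \<in> M_aff \<Lambda> \<and> (\<forall>k. mu x k = (\<Sum>j\<in>UNIV. C (V k) $ j *\<^sub>R mu x (\<kappa> j)))"
proof (intro iffI conjI allI)
  assume "x \<in> M_aff \<Lambda> \<and> (\<forall>k. mu x k = (\<Sum>j\<in>UNIV. C (V k) $ j *\<^sub>R mu x (\<kappa> j)))"
  then have x: "x \<in> M_aff \<Lambda>" and m: "\<And>k. mu x k = (\<Sum>j\<in>UNIV. C (V k) $ j *\<^sub>R mu x (\<kappa> j))" by blast+
  define L where "L v = (\<Sum>j\<in>UNIV. C v $ j *\<^sub>R mu x (\<kappa> j))" for v
  have "linear L" unfolding L_def
    by (rule linearI) (simp_all add: linear_add[OF frame_linear[OF fr]] linear_scale[OF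
        frame_linear[OF fr]]
        scaleR_add_left sum.distrib scaleR_sum_right)
  then have L: "bounded_linear L" "linear L" by (simp_all add: linear_conv_bounded_linear)
  have "moment lam x t = 0" if t: "t \<in> n_alg lam \<beta>" for t
  proof -
    have "((\<lambda>k. t k *\<^sub>R V k) has_sum 0) UNIV" using beta_has_sum[of t] t by (simp add: n_alg_def)
    from has_sum_bounded_linear[OF L(1) this]
    have "((\<lambda>k. t k *\<^sub>R mu x k) has_sum 0) UNIV"
      by (simp add: o_def linear_scale[OF L(2)] linear_0[OF L(2)] m[folded L_def, symmetric])
    then show ?thesis unfolding moment_eq by (rule infsumI)
  qed
  then show "x \<in> zero_level \<Lambda> lam \<beta>" using x by (simp add: zero_level_def)
next
  assume x: "x \<in> zero_level \<Lambda> lam \<beta>"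
  then show "x \<in> M_aff \<Lambda>" by (rule zero_level_M_aff)
  fix k
  define F where "F = insert k (range \<kappa>)"
  \<comment> \<open>The relation that expresses \<open>V k\<close> in the frame. It is written with
    sums of indicators so that \<open>k\<close> may itself belong to the frame, in which case
    \<open>t\<close> is zero.\<close>
  define t where "t i = (if i = k then 1 else 0) - (\<Sum>j\<in>UNIV. if i = \<kappa> j then C (V k) $ j else 0)"
      for i
  have F: "finite F" by (simp add: F_def)
  have t0: "t i = 0" if "i \<notin> F" for i
    using that by (auto simp: t_def F_def intro!: sum.neutral)
  have ts: "(\<lambda>i. if i \<in> F then t i else 0) = t" using t0 by auto
  have *: "(\<Sum>i\<in>F. t i *\<^sub>R w i) = w k - (\<Sum>j\<in>UNIV. C (V k) $ j *\<^sub>R w (\<kappa> j))" for w :: "'k \<Rightarrow>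
      'v::real_vector"
  proof -
    have "(\<Sum>i\<in>F. t i *\<^sub>R w i) = (\<Sum>i\<in>F. if i = k then w i else 0)
        - (\<Sum>i\<in>F. \<Sum>j\<in>UNIV. if i = \<kappa> j then C (V k) $ j *\<^sub>R w i else 0)"
      unfolding t_def scaleR_diff_left scaleR_sum_left sum_subtractf
      by (intro arg_cong2[where f = "(-)"] sum.cong refl) auto
    also have "(\<Sum>i\<in>F. if i = k then w i else 0) = w k" using F by (simp add: F_def)
    also have "(\<Sum>i\<in>F. \<Sum>j\<in>UNIV. if i = \<kappa> j then C (V k) $ j *\<^sub>R w i else 0)
        = (\<Sum>j\<in>UNIV. \<Sum>i\<in>F. if i = \<kappa> j then C (V k) $ j *\<^sub>R w i else 0)" by (rule sum.swap)
    also have "\<dots> = (\<Sum>j\<in>UNIV. C (V k) $ j *\<^sub>R w (\<kappa> j))"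
      using F by (intro sum.cong refl) (simp add: F_def)
    finally show ?thesis .
  qed
  have "t \<in> t_alg lam"
    by (rule t_alg_finite) (rule finite_subset[OF _ F], use t0 in auto)
  moreover have "\<beta> t = 0"
    using beta_finite[OF F, of t] unfolding ts * using frame_expand[OF fr, of "V k"] by simp
  ultimately have "moment lam x t = 0" using x by (simp add: zero_level_def n_alg_def)
  moreover have "moment lam x t = (\<Sum>i\<in>F. t i *\<^sub>R mu x i)"
  proof -
    have "moment lam x t = (\<Sum>\<^sub>\<infinity>i\<in>F. t i *\<^sub>R mu x i)"
      unfolding moment_eq by (rule infsum_cong_neutral) (use t0 in auto)
    then show ?thesis using F by simp
  qed
  ultimately show "mu x k = (\<Sum>j\<in>UNIV. C (V k) $ j *\<^sub>R mu x (\<kappa> j))" by (simp add: *)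
qed

lemma exists_frame_zeros:
  assumes x: "x \<in> zero_level \<Lambda> lam \<beta>"
  obtains \<kappa> C where "frame \<kappa> C" "{k. x k = 0} \<subseteq> range \<kappa>"
proof -
  \<comment> \<open>To form the linear map \<open>a\<close> from the moment values some frame must
    already be at hand; the zero map supplies one. The frame for \<open>x\<close> is then obtained
    from \<open>a\<close>.\<close>
  have "linear (\<lambda>_::real ^ 'n. 0 :: quat)" by (simp add: linear_iff)
  then obtain \<kappa>0 C0 where fr: "frame \<kappa>0 C0"
    by (rule exists_frame) (auto simp: ImH_def intro: that)
  define a where "a v = (\<Sum>j\<in>UNIV. C0 v $ j *\<^sub>R mu x (\<kappa>0 j))" for v
  have "linear a" unfolding a_def
    by (rule linearI) (simp_all add: linear_add[OF frame_linear[OF fr]] linear_scale[OF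
        frame_linear[OF fr]]
        scaleR_add_left sum.distrib scaleR_sum_right)
  moreover have "a v \<in> ImH" for v
    unfolding a_def by (intro subspace_sum[OF ImH_subspace] subspace_scale[OF ImH_subspace] mu_ImH)
  then have "range a \<subseteq> ImH" by (simp add: image_subset_iff)
  ultimately obtain \<kappa> C where "frame \<kappa> C" "{k. a (V k) = lam k} \<subseteq> range \<kappa>"
    by (rule exists_frame) (rule that)
  moreover have "{k. x k = 0} \<subseteq> {k. a (V k) = lam k}"
  proof clarify
    fix k assume "x k = 0"
    then have "mu x k = lam k" by (simp add: mu_def hopf_eq zero_prod_def)
    moreover have "mu x k = a (V k)" using x zero_level_iff[OF fr] unfolding a_def by blast
    ultimately show "a (V k) = lam k" by simp
  qed
  ultimately show ?thesis by (intro that[of \<kappa> C]) auto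
qed

text \<open>Off the frame the angles are multiples of 2 pi and almost all are zero. In the frame
  coordinate \<open>j\<close> of \<open>\<beta> t\<close>, the angle \<open>t (\<kappa> j)\<close>
  is therefore the only term not yet known to be an integer multiple of 2 pi, while the total is
  one.\<close>

lemma N_free:
  assumes fr: "frame \<kappa> C" and t: "t \<in> n_lattice" and one: "\<And>k. k \<notin> range \<kappa> \<Longrightarrow> exp_t t k = 1"
  shows "exp_t t k = 1"
proof (cases "k \<in> range \<kappa>")
  case True
  then obtain j where k: "k = \<kappa> j" by auto
  have ta: "t \<in> t_alg lam" using t by (simp add: n_lattice_def)
  obtain m where m: "\<beta> t = (2 * pi) *\<^sub>R real_vec m" using t by (auto simp: n_lattice_def)
  define F where "F = {k. t k \<noteq> 0} - range \<kappa>"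
  have int: "\<exists>n::int. t i = 2 * pi * of_int n" if "i \<notin> range \<kappa>" for i
    using one[OF that] unfolding exp_t_def exp_i_eq_1_iff .
  \<comment> \<open>A nonzero multiple of 2 pi contributes at least 1 to the convergent sum that
    defines the Lie algebra.\<close>
  have "F \<subseteq> {k. 1 \<le> (1 + norm (lam k)) * (t k)\<^sup>2}"
  proof
    fix i assume i: "i \<in> F"
    then obtain n :: int where n: "t i = 2 * pi * of_int n" "n \<noteq> 0" using int[of i] by (auto simp:
        F_def)
    have "1 \<le> 2 * pi" using pi_gt3 by simp
    moreover have "1 \<le> \<bar>real_of_int n\<bar>" using n(2) by linarith
    ultimately have "1 * 1 \<le> (2 * pi) * \<bar>real_of_int n\<bar>" by (intro mult_mono) auto
    then have "1 \<le> \<bar>t i\<bar>" unfolding n(1) abs_mult by simp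
    then have "1 \<le> (t i)\<^sup>2" using one_le_power[of "\<bar>t i\<bar>" 2] by simp
    then have "1 * 1 \<le> (1 + norm (lam i)) * (t i)\<^sup>2" by (intro mult_mono) auto
    then show "i \<in> {k. 1 \<le> (1 + norm (lam k)) * (t k)\<^sup>2}" by simp
  qed
  then have F: "finite F"
    by (rule finite_subset) (rule finite_ge_of_summable[OF t_alg_summable[OF ta]], auto)
  have bl: "bounded_linear (\<lambda>v. C v $ j)"
    using bounded_linear_compose[OF bounded_linear_vec_nth, of C] frame_linear[OF fr]
    by (simp add: linear_conv_bounded_linear)
  have "((\<lambda>i. C (t i *\<^sub>R V i) $ j) has_sum C (\<beta> t) $ j) UNIV"
    using has_sum_bounded_linear[OF bl beta_has_sum[OF ta]] by (simp add: o_def)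
  then have hs: "((\<lambda>i. t i * C (V i) $ j) has_sum C (\<beta> t) $ j) UNIV"
    by (simp add: linear_scale[OF frame_linear[OF fr]])
  have "((\<lambda>i. t i * C (V i) $ j) has_sum C (\<beta> t) $ j) (insert (\<kappa> j) F)"
  proof (rule has_sum_cong_neutral[THEN iffD1, OF _ _ _ hs])
    fix i assume "i \<in> UNIV - insert (\<kappa> j) F"
    then have "t i = 0 \<or> (\<exists>l. l \<noteq> j \<and> i = \<kappa> l)" by (auto simp: F_def)
    then show "t i * C (V i) $ j = 0" by (auto simp: frame_V[OF fr] axis_def)
  qed auto
  then have "C (\<beta> t) $ j = (\<Sum>i\<in>insert (\<kappa> j) F. t i * C (V i) $ j)"
    using F by (metis has_sum_finite_iff finite_insert)
  also have "\<dots> = t (\<kappa> j) + (\<Sum>i\<in>F. t i * C (V i) $ j)"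
    using F by (simp add: F_def frame_V[OF fr])
  finally have e: "t (\<kappa> j) = 2 * pi * C (real_vec m) $ j - (\<Sum>i\<in>F. t i * C (V i) $ j)"
    unfolding m by (simp add: linear_scale[OF frame_linear[OF fr]])
  have Z: "C (real_vec w) $ j \<in> \<int>" for w using fr by (simp add: frame_def)
  have "(\<Sum>i\<in>F. t i * C (V i) $ j) / (2 * pi) \<in> \<int>"
    unfolding sum_divide_distrib
  proof (rule Ints_sum)
    fix i assume "i \<in> F"
    then obtain n :: int where "t i = 2 * pi * of_int n" using int[of i] by (auto simp: F_def)
    then have "t i * C (V i) $ j / (2 * pi) = of_int n * C (V i) $ j" by simp
    then show "t i * C (V i) $ j / (2 * pi) \<in> \<int>" using Z[of "u i"] by (simp add: V_def)
  qed
  then have "C (real_vec m) $ j - (\<Sum>i\<in>F. t i * C (V i) $ j) / (2 * pi) \<in> \<int>"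
    using Z by (intro Ints_diff)
  then obtain n :: int where n: "C (real_vec m) $ j - (\<Sum>i\<in>F. t i * C (V i) $ j) / (2 * pi) = of_int
      n"
    by (elim Ints_cases)
  have "t (\<kappa> j) = 2 * pi * (C (real_vec m) $ j - (\<Sum>i\<in>F. t i * C (V i) $ j) / (2 * pi))"
    unfolding e by (simp add: field_simps)
  then have "t (\<kappa> j) = 2 * pi * of_int n" unfolding n .
  then show ?thesis unfolding k exp_t_def exp_i_eq_1_iff by blast
qed (rule one)

text \<open>Corrects the angles on a frame so that the result lies in the kernel of \<open>\<beta>\<close>.\<close>

definition lift :: "('n \<Rightarrow> 'k) \<Rightarrow> (real ^ 'n \<Rightarrow> real ^ 'n) \<Rightarrow> ('k \<Rightarrow> real) \<Rightarrow> 'k \<Rightarrow> real" where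
  "lift \<kappa> C \<theta> k = \<theta> k - (\<Sum>j\<in>UNIV. if k = \<kappa> j then C (\<beta> \<theta>) $ j else 0)"

lemma lift_off: "k \<notin> range \<kappa> \<Longrightarrow> lift \<kappa> C \<theta> k = \<theta> k"
  by (auto simp: lift_def intro!: sum.neutral)

lemma lift_on: "frame \<kappa> C \<Longrightarrow> lift \<kappa> C \<theta> (\<kappa> j) = \<theta> (\<kappa> j) - C (\<beta> \<theta>) $ j"
  using frame_inj[of \<kappa> C] by (simp add: lift_def inj_eq)

lemma lift_n_alg:
  assumes fr: "frame \<kappa> C" and t: "\<theta> \<in> t_alg lam"
  shows "lift \<kappa> C \<theta> \<in> n_alg lam \<beta>"
proof -
  define s where "s k = (\<Sum>j\<in>UNIV. if k = \<kappa> j then - C (\<beta> \<theta>) $ j else 0)" for k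
  have s0: "s k = 0" if "k \<notin> range \<kappa>" for k using that by (auto simp: s_def intro!: sum.neutral)
  have sk: "s (\<kappa> j) = - C (\<beta> \<theta>) $ j" for j using frame_inj[OF fr] by (simp add: s_def inj_eq)
  have ts: "(\<lambda>k. if k \<in> range \<kappa> then s k else 0) = s" using s0 by auto
  have sa: "s \<in> t_alg lam" by (rule t_alg_finite, rule finite_subset[of _ "range \<kappa>"]) (use s0 in
      auto)
  have l: "lift \<kappa> C \<theta> = (\<lambda>k. \<theta> k + s k)"
    by (auto simp: lift_def s_def sum_negf[symmetric] fun_eq_iff intro!: sum.cong)
  have "\<beta> s = (\<Sum>k\<in>range \<kappa>. s k *\<^sub>R V k)" using beta_finite[of "range \<kappa>" s] unfolding ts by simp
  also have "\<dots> = (\<Sum>j\<in>UNIV. s (\<kappa> j) *\<^sub>R V (\<kappa> j))" by (simp add: sum.reindex[OF frame_inj[OF fr]])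
  also have "\<dots> = - \<beta> \<theta>" using frame_expand[OF fr, of "\<beta> \<theta>"] by (simp add: sk sum_negf)
  finally show ?thesis unfolding l n_alg_def using beta_add[OF t sa] t_alg_add[OF t sa] by simp
qed

end

section \<open>Charts of the quotient\<close>

lemma bounded_bilinear_qmul: "bounded_bilinear (\<odot>)"
proof
  show "\<exists>K. \<forall>a b. norm (a \<odot> b) \<le> norm a * norm b * K" by (rule exI[of _ 1]) (simp add: norm_qmul)
qed (simp_all add: qmul_distribs)

lemma bounded_linear_qcomplex: "bounded_linear qcomplex"
  by (rule bounded_linear_intro[of _ 1])
    (simp_all add: norm_qcomplex, simp_all add: qcomplex_def)

text \<open>The operators are regarded as a bounded family of constants in the space of bounded
  operators, where evaluation is bilinear.\<close>

lemma smooth_family_linear_comp: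
  fixes L :: "'i \<Rightarrow> 'b::real_normed_vector \<Rightarrow> 'c::real_normed_vector"
  assumes f: "smooth_family S I f" and L: "\<And>i. i \<in> I \<Longrightarrow> linear (L i)"
    and bd: "\<And>i y. i \<in> I \<Longrightarrow> norm (L i y) \<le> B * norm y"
  shows "smooth_family S I (\<lambda>i x. L i (f i x))"
proof -
  have bl: "bounded_linear (L i)" if "i \<in> I" for i
    using L[OF that] bd[OF that] bounded_linear_intro[of "L i" B]
    by (simp add: linear_add linear_scale mult.commute)
  have "smooth_family S I (\<lambda>i x. Blinfun (L i))"
  proof (rule smooth_family_const[where C = "\<bar>B\<bar>"])
    fix i assume i: "i \<in> I"
    show "norm (Blinfun (L i)) \<le> \<bar>B\<bar>"
    proof (rule norm_blinfun_bound)
      fix y :: 'b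
      have "B * norm y \<le> \<bar>B\<bar> * norm y" by (intro mult_right_mono) auto
      then show "norm (blinfun_apply (Blinfun (L i)) y) \<le> \<bar>B\<bar> * norm y"
        using bd[OF i, of y] by (simp add: bounded_linear_Blinfun_apply[OF bl[OF i]])
    qed simp
  qed (rule smooth_family_open[OF f])
  from bounded_bilinear.smooth_family_prod[OF bounded_bilinear_blinfun_apply this f]
  show ?thesis by (rule smooth_family_cong) (simp add: bounded_linear_Blinfun_apply[OF bl])
qed

lemma smooth_family_norm_sq:
  fixes f :: "'i \<Rightarrow> 'a::real_normed_vector \<Rightarrow> 'b::real_inner"
  shows
  "smooth_family S I f \<Longrightarrow> smooth_family S I (\<lambda>i x. (norm (f i x))\<^sup>2)"
  using smooth_family_inner[of S I f f] by (simp add: power2_norm_eq_inner)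

lemma smooth_family_hopf:
  assumes "smooth_family S I f"
  shows "smooth_family S I (\<lambda>i x. hopf (f i x))"
proof -
  have q: "bounded_linear qcnj"
    by (rule bounded_linear_intro[of _ 1]) (simp_all add: norm_qcnj, simp_all add: qcnj_def
        scaleR_conv_of_real)
  have "smooth_family S I (\<lambda>i x. qcnj (f i x) \<odot> (qi \<odot> f i x))"
    by (intro bounded_bilinear.smooth_family_prod[OF bounded_bilinear_qmul] assms
        smooth_family_bounded_linear[OF q]
        smooth_family_bounded_linear[OF bounded_bilinear.bounded_linear_right[OF
            bounded_bilinear_qmul]])
  then show ?thesis by (simp add: hopf_def qmul_assoc)
qed

text \<open>The difference quotient of \<open>hopf_sec p\<close> at \<open>0\<close>, in a form that remains smooth at \<open>t = 0\<close>.\<close>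

definition hopf_sec_quot :: "quat \<Rightarrow> real \<Rightarrow> quat \<Rightarrow> quat" where
  "hopf_sec_quot p t z = (let s = p \<bullet> z; r = (1 + t * (2 * s + t * (norm z)\<^sup>2)) powr (1 / 2);
     R = (2 * s + t * (norm z)\<^sup>2) * inverse (1 + r); c = 2 * (r + 1 + t * s) in
     (c powr (- 1 / 2)) *\<^sub>R (qcomplex (of_real (R - 2 * (R + s) * inverse (2 + c powr (1 / 2)))) - p
         \<odot> z))"

text \<open>The radicand is the square of \<open>norm (p + t *\<^sub>R z)\<close>, which lies
  between 1 / 2 and 3 / 2.\<close>

lemma hopf_sec_bounds:
  assumes p: "norm p = 1" and z: "norm (t *\<^sub>R z) \<le> 1 / 2"
  shows "norm (p + t *\<^sub>R z) = (1 + t * (2 * (p \<bullet> z) + t * (norm z)\<^sup>2)) powr (1 / 2)"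
    and "1 / 4 \<le> 1 + t * (2 * (p \<bullet> z) + t * (norm z)\<^sup>2)"
    and "1 + t * (2 * (p \<bullet> z) + t * (norm z)\<^sup>2) \<le> 9 / 4"
    and "\<bar>t * (p \<bullet> z)\<bar> \<le> 1 / 2"
proof -
  have e: "(norm (p + t *\<^sub>R z))\<^sup>2 = 1 + t * (2 * (p \<bullet> z) + t * (norm z)\<^sup>2)"
  proof -
    have "(norm (p + t *\<^sub>R z))\<^sup>2 = (norm p)\<^sup>2 + 2 * (p \<bullet> (t *\<^sub>R z)) + (norm (t *\<^sub>R z))\<^sup>2"
      unfolding power2_norm_eq_inner by (simp add: inner_add_left inner_add_right inner_commute)
    then show ?thesis using p by (simp add: power_mult_distrib) (simp add: algebra_simps
        power2_eq_square)
  qed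
  have l: "1 / 2 \<le> norm (p + t *\<^sub>R z)" using norm_diff_ineq[of p "t *\<^sub>R z"] p z by linarith
  have u: "norm (p + t *\<^sub>R z) \<le> 3 / 2" using norm_triangle_ineq[of p "t *\<^sub>R z"] p z by linarith
  show "1 / 4 \<le> 1 + t * (2 * (p \<bullet> z) + t * (norm z)\<^sup>2)"
    using power_mono[OF l, of 2] e by (simp add: power2_eq_square)
  then have "(1 + t * (2 * (p \<bullet> z) + t * (norm z)\<^sup>2)) powr (1 / 2) = sqrt (1 + t * (2 * (p \<bullet> z) + t
      * (norm z)\<^sup>2))"
    by (intro powr_half_sqrt) linarith
  also have "\<dots> = norm (p + t *\<^sub>R z)" unfolding e[symmetric] by simp
  finally show "norm (p + t *\<^sub>R z) = (1 + t * (2 * (p \<bullet> z) + t * (norm z)\<^sup>2)) powr (1 / 2)" by (rule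
      sym)
  show "1 + t * (2 * (p \<bullet> z) + t * (norm z)\<^sup>2) \<le> 9 / 4"
    using power_mono[OF u, of 2] e by (simp add: power2_eq_square)
  have "\<bar>p \<bullet> (t *\<^sub>R z)\<bar> \<le> 1 / 2" using Cauchy_Schwarz_ineq2[of p "t *\<^sub>R z"] z unfolding p mult_1 by
      (rule order_trans)
  then show "\<bar>t * (p \<bullet> z)\<bar> \<le> 1 / 2" by simp
qed

text \<open>Division by \<open>t\<close> is avoided by rationalising twice: \<open>r - 1\<close> is
  \<open>(r\<^sup>2 - 1) / (r + 1)\<close> and \<open>sqrt c - 2\<close> is
  \<open>(c - 4) / (sqrt c + 2)\<close>, where both numerators carry the factor \<open>t\<close> and
  both denominators stay away from zero.\<close>

lemma hopf_sec_quot: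
  assumes p: "norm p = 1" and z: "norm (t *\<^sub>R z) \<le> 1 / 2"
  shows "hopf_sec p (t *\<^sub>R z) = qcomplex 1 + t *\<^sub>R hopf_sec_quot p t z"
proof -
  define s where "s = p \<bullet> z"
  define N where "N = (norm z)\<^sup>2"
  define r where "r = norm (p + t *\<^sub>R z)"
  define R where "R = (2 * s + t * N) * inverse (1 + r)"
  define c where "c = 2 * (r + 1 + t * s)"
  note b = hopf_sec_bounds[OF p z, folded s_def N_def r_def]
  have r0: "r \<ge> 0" by (simp add: r_def)
  have rr: "r * r = 1 + t * (2 * s + t * N)"
  proof -
    have "r = sqrt (1 + t * (2 * s + t * N))" unfolding b(1) by (rule powr_half_sqrt) (use b(2) in
        linarith)
    then show ?thesis using b(2) by simp
  qed
  have tR: "t * R = r - 1"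
  proof -
    have "t * (2 * s + t * N) = (r - 1) * (1 + r)" using rr by (simp add: algebra_simps)
    then show ?thesis using r0 by (simp add: R_def field_simps)
  qed
  have c: "c > 0" using b(4) r0 by (simp add: c_def)
  define w where "w = sqrt c"
  have w: "w > 0" "w * w = c" using c by (simp_all add: w_def)
  have key: "1 + r = w + t * (R - 2 * (R + s) * inverse (2 + w))"
  proof -
    have "t * (2 * (R + s)) = c - 4" using tR by (simp add: c_def algebra_simps)
    also have "\<dots> = (w - 2) * (2 + w)" using w by (simp add: algebra_simps)
    finally have "t * (2 * (R + s) * inverse (2 + w)) = w - 2" using w by (simp add: field_simps)
    then show ?thesis using tR by (simp add: algebra_simps)
  qed
  have q: "hopf_sec_quot p t z = (1 / w) *\<^sub>R (qcomplex (of_real (R - 2 * (R + s) * inverse (2 + w)))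
      - p \<odot> z)"
  proof -
    have "c powr (1 / 2) = w" unfolding w_def by (rule powr_half_sqrt) (use c in simp)
    then have "c powr (1 / 2) = w" "c powr (- 1 / 2) = 1 / w" by (simp_all add: powr_minus_divide)
    moreover have "hopf_sec_quot p t z = (c powr (- 1 / 2)) *\<^sub>R
        (qcomplex (of_real (R - 2 * (R + s) * inverse (2 + c powr (1 / 2)))) - p \<odot> z)"
      unfolding hopf_sec_quot_def Let_def R_def c_def b(1) unfolding s_def N_def by (rule refl)
    ultimately show ?thesis by simp
  qed
  have "hopf_sec p (t *\<^sub>R z) = (1 / w) *\<^sub>R (qcomplex (of_real (1 + r)) - t *\<^sub>R (p \<odot> z))"
    by (simp add: hopf_sec_def Let_def r_def c_def w_def s_def qmul_distribs)
  also have "\<dots> = (1 / w) *\<^sub>R (w *\<^sub>R qcomplex 1 + t *\<^sub>R (qcomplex (of_real (R - 2 * (R + s) * inverse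
      (2 + w))) - p \<odot> z))"
    unfolding key by (simp add: qcomplex_def scaleR_conv_of_real prod_eq_iff algebra_simps)
  also have "\<dots> = qcomplex 1 + t *\<^sub>R hopf_sec_quot p t z"
    using w(1) by (simp add: q scaleR_add_right mult.commute)
  finally show ?thesis .
qed

lemma smooth_family_hopf_sec_quot:
  assumes z: "smooth_family S I z" and p: "\<And>i. i \<in> I \<Longrightarrow> norm (p i) = 1"
    and t: "\<And>i. i \<in> I \<Longrightarrow> \<bar>t i\<bar> \<le> T" and tz: "\<And>i x. i \<in> I \<Longrightarrow> x \<in> S \<Longrightarrow> norm (t i *\<^sub>R z i x) \<le> 1 / 2"
  shows "smooth_family S I (\<lambda>i x. hopf_sec_quot (p i) (t i) (z i x))"
proof -
  have S: "open S" using z by (rule smooth_family_open)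
  have cp: "smooth_family S I (\<lambda>i x. p i)" by (rule smooth_family_const[OF S, of _ _ 1]) (simp add:
      p)
  have ct: "smooth_family S I (\<lambda>i x. t i)" by (rule smooth_family_const[OF S, of _ _ T]) (simp add:
      t)
  have cc: "smooth_family S I (\<lambda>i x. a)" for a :: real by (rule smooth_family_const[OF S, of _ _
      "\<bar>a\<bar>"]) simp
  define s where "s = (\<lambda>i x. p i \<bullet> z i x)"
  have s: "smooth_family S I s" unfolding s_def by (rule smooth_family_inner[OF cp z])
  define m where "m = (\<lambda>i x. 2 * s i x + t i * (norm (z i x))\<^sup>2)"
  have m: "smooth_family S I m" unfolding m_def
    by (intro smooth_family_add smooth_family_mult cc ct s smooth_family_norm_sq z)
  define r where "r = (\<lambda>i x. (1 + t i * m i x) powr (1 / 2))"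
  have b: "1 / 4 \<le> 1 + t i * m i x" "1 + t i * m i x \<le> 9 / 4" "\<bar>t i * s i x\<bar> \<le> 1 / 2"
    "r i x = norm (p i + t i *\<^sub>R z i x)" if "i \<in> I" "x \<in> S" for i x
    using hopf_sec_bounds[OF p[OF that(1)] tz[OF that]] by (simp_all add: s_def m_def r_def)
  have r: "smooth_family S I r" unfolding r_def
    by (rule smooth_family_powr[where c = "1 / 4" and C = "9 / 4"])
      (intro smooth_family_add smooth_family_mult cc ct m, simp, use b in blast)
  have rb: "0 \<le> r i x" "r i x \<le> 3 / 2" if "i \<in> I" "x \<in> S" for i x
  proof -
    show "0 \<le> r i x" by (simp add: r_def)
    have "r i x \<le> 1 + 1 / 2"
      unfolding b(4)[OF that] using norm_triangle_ineq[of "p i" "t i *\<^sub>R z i x"] p[OF that(1)] tz[OF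
          that] by linarith
    then show "r i x \<le> 3 / 2" by simp
  qed
  define R where "R = (\<lambda>i x. m i x * inverse (1 + r i x))"
  have R: "smooth_family S I R" unfolding R_def
  proof (rule smooth_family_mult[OF m], rule smooth_family_inverse[where c = 1])
    show "smooth_family S I (\<lambda>i x. 1 + r i x)" by (intro smooth_family_add cc r)
    show "1 \<le> norm (1 + r i x)" if "i \<in> I" "x \<in> S" for i x using rb(1)[OF that] by simp
  qed simp
  define c where "c = (\<lambda>i x. 2 * (r i x + 1 + t i * s i x))"
  have c: "smooth_family S I c" unfolding c_def by (intro smooth_family_add smooth_family_mult cc ct
      r s)
  \<comment> \<open>From \<open>0 \<le> r \<le> 3 / 2\<close> and
    \<open>\<bar>t * s\<bar> \<le> 1 / 2\<close> for \<open>c = 2 * (r + 1 + t * s)\<close>.\<close>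
  have cb: "1 \<le> c i x \<and> c i x \<le> 6" if "i \<in> I" "x \<in> S" for i x
  proof -
    have "- 1 / 2 \<le> t i * s i x" "t i * s i x \<le> 1 / 2" using b(3)[OF that] by (simp_all only:
        abs_le_iff) simp_all
    then show ?thesis using rb[OF that] unfolding c_def by (simp add: distrib_left)
  qed
  have cpow: "smooth_family S I (\<lambda>i x. c i x powr a)" for a
    by (rule smooth_family_powr[OF c, of 1 6]) (use cb in auto)
  have inv: "smooth_family S I (\<lambda>i x. inverse (2 + c i x powr (1 / 2)))"
  proof (rule smooth_family_inverse[where c = 2])
    show "smooth_family S I (\<lambda>i x. 2 + c i x powr (1 / 2))" by (intro smooth_family_add cc cpow)
  qed auto
  have "smooth_family S I (\<lambda>i x. complex_of_real (R i x - 2 * (R i x + s i x) * inverse (2 + c i x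
      powr (1 / 2))))"
    by (intro smooth_family_bounded_linear[OF bounded_linear_of_real] smooth_family_diff
        smooth_family_add smooth_family_mult cc R s inv)
  then have "smooth_family S I (\<lambda>i x. (c i x powr (- 1 / 2)) *\<^sub>R
      (qcomplex (of_real (R i x - 2 * (R i x + s i x) * inverse (2 + c i x powr (1 / 2)))) - p i \<odot> z
          i x))"
    by (intro smooth_family_scaleR cpow smooth_family_diff smooth_family_bounded_linear[OF
        bounded_linear_qcomplex]
        bounded_bilinear.smooth_family_prod[OF bounded_bilinear_qmul] cp z)
  then show ?thesis by (simp add: hopf_sec_quot_def Let_def s_def m_def r_def R_def c_def)
qed

section \<open>Gauge fixing relative to a base point\<close>

locale hk_chart = hk_setting u lam \<Lambda> \<beta>
  for u :: "'k::countable \<Rightarrow> int ^ 'n" and lam \<Lambda> :: "'k \<Rightarrow> quat" and \<beta> :: "('k \<Rightarrow> real) \<Rightarrow> real ^ 'n" +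
  fixes x0 :: "'k \<Rightarrow> quat" and \<kappa> :: "'n \<Rightarrow> 'k" and C :: "real ^ 'n \<Rightarrow> real ^ 'n"
  assumes x0: "x0 \<in> zero_level \<Lambda> lam \<beta>" and fr: "frame \<kappa> C" and zeros: "{k. x0 k = 0} \<subseteq> range \<kappa>"
begin

abbreviation K :: "'k set" where "K \<equiv> range \<kappa>"

lemma finK: "finite K" by simp

lemma x0_M_aff: "x0 \<in> M_aff \<Lambda>" using x0 by (rule zero_level_M_aff)

lemma x0_nz: "k \<notin> K \<Longrightarrow> x0 k \<noteq> 0" using zeros by auto

lemma linC: "linear C" using fr by (rule frame_linear)

definition gauged :: "('k \<Rightarrow> quat) \<Rightarrow> bool" where
  "gauged y \<longleftrightarrow> (\<forall>k. k \<notin> K \<longrightarrow> (\<exists>s>0. herm (y k) (x0 k) = of_real s))"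

text \<open>The points of the zero level whose orbit meets the gauge; nonvanishing is all that is
  required because phases off the frame can be prescribed.\<close>

definition gdom :: "('k \<Rightarrow> quat) set" where
  "gdom = {x \<in> zero_level \<Lambda> lam \<beta>. \<forall>k. k \<notin> K \<longrightarrow> herm (x k) (x0 k) \<noteq> 0}"

definition Phi :: "('k \<Rightarrow> quat) \<Rightarrow> quat ^ 'n" where
  "Phi x = (\<chi> j. (SOME y. y \<in> Orb x \<and> gauged y) (\<kappa> j))"

lemma gauged_x0: "gauged x0"
  unfolding gauged_def herm_self using x0_nz by (auto intro!: exI[of _ "(norm (x0 _))\<^sup>2"])

lemma gauged_nz: "gauged y \<Longrightarrow> k \<notin> K \<Longrightarrow> herm (y k) (x0 k) \<noteq> 0"
  by (auto simp: gauged_def)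

text \<open>Off the frame the connecting phase is a positive number of absolute value 1; freeness
  then settles the frame.\<close>

lemma gauged_unique:
  assumes "y \<in> Orb x" "gauged y" "y' \<in> Orb x" "gauged y'"
  shows "y = y'"
proof -
  have "y' \<in> Orb y" using assms(1,3) orbit_sym orbit_trans by blast
  then obtain t where t: "t \<in> n_lattice" "y' = act (exp_t t) y" by (auto simp: orbit_iff)
  have "exp_t t k = 1" if k: "k \<notin> K" for k
  proof -
    obtain s s' where s: "s > 0" "herm (y k) (x0 k) = of_real s" "s' > 0" "herm (y' k) (x0 k) =
        of_real s'"
      using assms(2,4) k unfolding gauged_def by blast
    have "of_real s' = exp_t t k * of_real s"
      using s(2,4) by (simp add: t(2) act_apply herm_phase)
    then have e: "exp_t t k = of_real (s' / s)" using s(1) by (simp add: field_simps)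
    then have "\<bar>s' / s\<bar> = 1" using norm_exp_t[of t k] by (simp only: norm_of_real)
    then show ?thesis using e s by simp
  qed
  then have "exp_t t k = 1" for k by (rule N_free[OF fr t(1)])
  then show ?thesis by (simp add: t(2) act_def qcomplex_qmul)
qed

lemma Phi_eqI: "y \<in> Orb x \<Longrightarrow> gauged y \<Longrightarrow> Phi x = (\<chi> j. y (\<kappa> j))"
proof -
  assume y: "y \<in> Orb x" "gauged y"
  have "(SOME y. y \<in> Orb x \<and> gauged y) = y"
    by (rule some_equality) (use y gauged_unique in auto)
  then show ?thesis by (simp add: Phi_def)
qed

lemma Phi_orbit: "y \<in> Orb x \<Longrightarrow> Phi y = Phi x"
  using orbit_eq_iff[of x y] by (simp add: Phi_def)

lemma Phi_x0: "Phi x0 = (\<chi> j. x0 (\<kappa> j))"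
  by (rule Phi_eqI[OF orbit_refl gauged_x0])

lemma gdom_orbit: "y \<in> Orb x \<Longrightarrow> x \<in> gdom \<Longrightarrow> y \<in> gdom"
  using zero_level_orbit[of y x] by (auto simp: gdom_def orbit_iff act_apply herm_phase exp_t_def)

lemma gauge_by:
  assumes t: "\<theta> \<in> t_alg lam" "\<And>j. \<theta> (\<kappa> j) = 0"
    and arg: "\<And>k. k \<notin> K \<Longrightarrow> \<exists>s>0. herm (x k) (x0 k) = of_real s * exp (\<i> * of_real (\<theta> k))"
  obtains y where "y \<in> Orb x" "gauged y"
    "\<And>j. y (\<kappa> j) = qcomplex (exp (\<i> * of_real (C (\<beta> \<theta>) $ j))) \<odot> x (\<kappa> j)"
proof -
  define t where "t = lift \<kappa> C (\<lambda>k. - \<theta> k)"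
  have tn: "t \<in> n_lattice"
    using lift_n_alg[OF fr t_alg_uminus[OF t(1)]] n_alg_subset_n_lattice by (auto simp: t_def)
  have "gauged (act (exp_t t) x)" unfolding gauged_def
  proof (intro allI impI)
    fix k assume k: "k \<notin> K"
    obtain s where s: "s > 0" "herm (x k) (x0 k) = of_real s * exp (\<i> * of_real (\<theta> k))" using arg[OF
        k] by blast
    have "herm (act (exp_t t) x k) (x0 k) = of_real s"
      using k s(2) by (simp add: act_apply herm_phase exp_t_def t_def lift_off exp_minus)
    then show "\<exists>s>0. herm (act (exp_t t) x k) (x0 k) = of_real s" using s(1) by blast
  qed
  moreover have "act (exp_t t) x (\<kappa> j) = qcomplex (exp (\<i> * of_real (C (\<beta> \<theta>) $ j))) \<odot> x (\<kappa> j)" for j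
    using beta_uminus[OF t(1)] linear_neg[OF linC]
    by (simp add: act_apply exp_t_def t_def lift_on[OF fr] t(2))
  ultimately show ?thesis using tn by (intro that[of "act (exp_t t) x"]) (auto simp: orbit_iff)
qed

text \<open>Off the frame the weight \<open>1 + norm (lam k)\<close> is at most a multiple of
  \<open>(norm (x0 k))\<^sup>2\<close>, so angles may be measured by the displacement
  \<open>\<bar>\<theta> k\<bar> * norm (x0 k)\<close> they cause.\<close>

lemma t_alg_by_x0:
  assumes v: "(\<lambda>k. (norm (v k))\<^sup>2) summable_on UNIV" and z: "\<And>k. k \<in> K \<Longrightarrow> \<theta> k = 0"
    and le: "\<And>k. k \<notin> K \<Longrightarrow> \<bar>\<theta> k\<bar> * norm (x0 k) \<le> B * norm (v k)"
  shows "\<theta> \<in> t_alg lam"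
proof -
  obtain c where c: "c > 0" "\<And>k. k \<notin> K \<Longrightarrow> 1 + norm (lam k) \<le> c * (norm (x0 k))\<^sup>2"
    using x0_M_aff zeros by (rule weight_le_norm_sq) (rule that)
  have s: "(\<lambda>k. (c * B\<^sup>2) * (norm (v k))\<^sup>2) summable_on UNIV" by (intro summable_on_cmult_right v)
  have le: "(1 + norm (lam k)) * (\<theta> k)\<^sup>2 \<le> (c * B\<^sup>2) * (norm (v k))\<^sup>2" for k
  proof (cases "k \<in> K")
    case False
    have "(1 + norm (lam k)) * (\<theta> k)\<^sup>2 \<le> (c * (norm (x0 k))\<^sup>2) * (\<theta> k)\<^sup>2"
      using c(2)[OF False] by (rule mult_right_mono) simp
    also have "\<dots> = c * (\<bar>\<theta> k\<bar> * norm (x0 k))\<^sup>2" by (simp add: power_mult_distrib)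
    also have "\<dots> \<le> c * (B * norm (v k))\<^sup>2"
      using le[OF False] c(1) by (intro mult_left_mono power_mono) auto
    finally show ?thesis by (simp add: power_mult_distrib)
  qed (use z c in auto)
  show ?thesis unfolding t_alg_def mem_Collect_eq
    by (rule summable_on_comparison_test[OF s le]) simp
qed

text \<open>Near 1 the logarithm is at most twice the distance to 1; elsewhere the trivial bound
  \<open>pi\<close> is at most \<open>2 * pi\<close> times that distance. Hence the constant
  \<open>2 * pi\<close>.\<close>

lemma Arg_le: "z \<noteq> 0 \<Longrightarrow> \<bar>Arg z\<bar> \<le> 2 * pi * norm (z - 1)"
proof (cases "norm (z - 1) < 1 / 2")
  case True
  assume "z \<noteq> 0"
  then have "\<bar>Arg z\<bar> \<le> norm (Ln (1 + (z - 1)))" using abs_Im_le_cmod[of "Ln z"] by (simp add: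
      Arg_eq_Im_Ln)
  also have "\<dots> \<le> 2 * norm (z - 1)" using True by (rule norm_Ln_le)
  also have "\<dots> \<le> 2 * pi * norm (z - 1)"
    using pi_ge_two by (intro mult_right_mono) auto
  finally show ?thesis .
next
  case False
  have "\<bar>Arg z\<bar> \<le> pi" using Arg_bounded[of z] by linarith
  also have "pi * 1 \<le> pi * (2 * norm (z - 1))" using False by (intro mult_left_mono) auto
  finally show ?thesis by simp
qed

definition Arg_herm :: "('k \<Rightarrow> quat) \<Rightarrow> 'k \<Rightarrow> real" where
  "Arg_herm x k = (if k \<in> K then 0 else Arg (herm (x k) (x0 k)))"

text \<open>Dividing the Hermitian product by \<open>(norm (x0 k))\<^sup>2\<close> leaves the
  argument alone and compares it with 1. Jumps of \<open>Arg\<close> are harmless here, where only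
  summability at a single point is claimed.\<close>

lemma Arg_herm_t_alg:
  assumes x: "x \<in> M_aff \<Lambda>" and nz: "\<And>k. k \<notin> K \<Longrightarrow> herm (x k) (x0 k) \<noteq> 0"
  shows "Arg_herm x \<in> t_alg lam"
proof (rule t_alg_by_x0[OF M_aff_diff[OF x x0_M_aff]])
  fix k assume k: "k \<notin> K"
  define n where "n = (norm (x0 k))\<^sup>2"
  have n: "n > 0" using x0_nz[OF k] by (simp add: n_def)
  let ?z = "herm (x k) (x0 k) / of_real n"
  have "?z - 1 = herm (x k - x0 k) (x0 k) / of_real n"
    using n by (simp add: herm_diff herm_self n_def[symmetric] diff_divide_distrib)
  then have "norm (?z - 1) = norm (herm (x k - x0 k) (x0 k)) / n" using n by (simp add: norm_divide)
  also have "\<dots> \<le> norm (x k - x0 k) * norm (x0 k) / n"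
    using n by (intro divide_right_mono norm_herm_le) simp
  finally have z1: "norm (?z - 1) \<le> norm (x k - x0 k) * norm (x0 k) / n" .
  have "Arg_herm x k = Arg ?z"
    using k n nz[OF k] by (simp add: Arg_herm_def Arg_divide_of_real)
  then have "\<bar>Arg_herm x k\<bar> \<le> 2 * pi * norm (?z - 1)" using Arg_le[of ?z] nz[OF k] n by simp
  also have "\<dots> \<le> 2 * pi * (norm (x k - x0 k) * norm (x0 k) / n)" using z1 by (intro mult_left_mono)
      auto
  finally have "\<bar>Arg_herm x k\<bar> * norm (x0 k) \<le> 2 * pi * (norm (x k - x0 k) * norm (x0 k) / n) * norm
      (x0 k)"
    by (intro mult_right_mono) auto
  also have "\<dots> = 2 * pi * norm (x k - x0 k)" using x0_nz[OF k] by (simp add: n_def power2_eq_square)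
  finally show "\<bar>Arg_herm x k\<bar> * norm (x0 k) \<le> (2 * pi) * norm (x k - x0 k)" .
qed (simp add: Arg_herm_def)

lemma exists_gauge:
  assumes x: "x \<in> M_aff \<Lambda>" and nz: "\<And>k. k \<notin> K \<Longrightarrow> herm (x k) (x0 k) \<noteq> 0"
  obtains y where "y \<in> Orb x" "gauged y"
proof (rule gauge_by[OF Arg_herm_t_alg[OF x nz]])
  fix k assume k: "k \<notin> K"
  have "herm (x k) (x0 k) = of_real (norm (herm (x k) (x0 k))) * exp (\<i> * of_real (Arg_herm x k))"
    using Arg_eq[OF nz[OF k]] k by (simp add: Arg_herm_def)
  then show "\<exists>s>0. herm (x k) (x0 k) = of_real s * exp (\<i> * of_real (Arg_herm x k))"
    using nz[OF k] by (intro exI[of _ "norm (herm (x k) (x0 k))"]) auto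
qed (auto simp: Arg_herm_def intro: that)

lemma gauged_determined:
  assumes x: "x \<in> zero_level \<Lambda> lam \<beta>" "gauged x" and y: "y \<in> zero_level \<Lambda> lam \<beta>" "gauged y"
    and e: "\<And>j. x (\<kappa> j) = y (\<kappa> j)"
  shows "x = y"
proof
  fix k
  have "mu x k = (\<Sum>j\<in>UNIV. C (V k) $ j *\<^sub>R mu x (\<kappa> j))" using x(1) zero_level_iff[OF fr] by blast
  also have "\<dots> = (\<Sum>j\<in>UNIV. C (V k) $ j *\<^sub>R mu y (\<kappa> j))" by (simp add: mu_def e)
  also have "\<dots> = mu y k" using y(1) zero_level_iff[OF fr] by metis
  finally have h: "hopf (x k) = hopf (y k)" by (simp add: mu_def)
  show "x k = y k"
  proof (cases "k \<in> K")
    case False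
    obtain s t where "s > 0" "herm (x k) (x0 k) = of_real s" "t > 0" "herm (y k) (x0 k) = of_real t"
      using x(2) y(2) False unfolding gauged_def by blast
    then show ?thesis using hopf_gauge_unique[OF h] by blast
  qed (use e in auto)
qed

lemma Phi_inj:
  assumes x: "x \<in> gdom" and y: "y \<in> gdom" and e: "Phi x = Phi y"
  shows "y \<in> Orb x"
proof -
  obtain x' where x': "x' \<in> Orb x" "gauged x'"
    using exists_gauge[of x] x zero_level_M_aff[of x] by (auto simp: gdom_def)
  obtain y' where y': "y' \<in> Orb y" "gauged y'"
    using exists_gauge[of y] y zero_level_M_aff[of y] by (auto simp: gdom_def)
  have "(\<chi> j. x' (\<kappa> j)) = (\<chi> j. y' (\<kappa> j))" using e Phi_eqI[OF x'] Phi_eqI[OF y'] by simp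
  then have "x' (\<kappa> j) = y' (\<kappa> j)" for j by (simp add: vec_eq_iff)
  then have "x' = y'"
    using x y x' y' by (intro gauged_determined) (auto simp: gdom_def intro: zero_level_orbit)
  then show ?thesis using x'(1) y'(1) orbit_sym orbit_trans by blast
qed

lemma same_mu_gdom:
  assumes y: "y \<in> zero_level \<Lambda> lam \<beta>" and m: "mu y = mu x0"
  shows "y \<in> gdom"
proof -
  have "herm (y k) (x0 k) \<noteq> 0" if k: "k \<notin> K" for k
  proof -
    have "hopf (x0 k) = hopf (y k)" using fun_cong[OF m, of k] by (simp add: mu_def)
    then obtain g where "norm g = 1" "y k = qcomplex g \<odot> x0 k" by (rule hopf_eq_iff_phase)
    then show ?thesis using x0_nz[OF k] by (auto simp: herm_phase herm_self)
  qed
  then show ?thesis using y by (simp add: gdom_def)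
qed

end

lemma smooth_family_if:
  assumes f: "smooth_family S {i \<in> I. P i} f" and g: "smooth_family S {i \<in> I. \<not> P i} g"
  shows "smooth_family S I (\<lambda>i. if P i then f i else g i)"
proof (rule smooth_familyI)
  show S: "open S" using f by (rule smooth_family_open)
  fix m
  show "equi_Ck m S ((\<lambda>i. if P i then f i else g i) ` I)"
  proof (rule equi_Ck_subset[OF equi_Ck_Un[OF smooth_family_equi_Ck[OF f] smooth_family_equi_Ck[OF
      g]] S])
    fix h assume "h \<in> (\<lambda>i. if P i then f i else g i) ` I"
    then have "h \<in> f ` {i \<in> I. P i} \<union> g ` {i \<in> I. \<not> P i}" by auto
    then show "\<exists>k\<in>f ` {i \<in> I. P i} \<union> g ` {i \<in> I. \<not> P i}. \<forall>x\<in>S. h x = k x"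
      by (intro bexI[of _ h] ballI refl)
  qed
qed

lemma smooth_family_shrink:
  assumes "smooth_family S I f" "open U" "U \<subseteq> S"
  shows "smooth_family U I f"
proof (rule smooth_familyI[OF assms(2)])
  fix m
  have "equi_Ck m S F \<Longrightarrow> equi_Ck m U F" for F
  proof (induction m arbitrary: F)
    case 0
    then show ?case using assms(3) unfolding equi_Ck.simps loc_bdd_def by (meson subsetD)
  next
    case (Suc m)
    obtain G f' where G: "loc_bdd S F" "equi_Ck m S G"
      "\<And>f x. f \<in> F \<Longrightarrow> x \<in> S \<Longrightarrow> (f has_derivative f' f x) (at x)"
      "\<And>f h. f \<in> F \<Longrightarrow> norm h \<le> 1 \<Longrightarrow> \<exists>g\<in>G. \<forall>x\<in>S. g x = f' f x h"
      using Suc.prems by (rule equi_Ck_SucE) (rule that)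
    have "loc_bdd U F" using G(1) assms(3) unfolding loc_bdd_def by (meson subsetD)
    then show ?case
    proof (rule equi_Ck_SucI[OF _ Suc.IH[OF G(2)]])
      show "(f has_derivative f' f x) (at x)" if "f \<in> F" "x \<in> U" for f x using G(3) that assms(3) by
          blast
      show "\<exists>g\<in>G. \<forall>x\<in>U. g x = f' f x h" if "f \<in> F" "norm h \<le> 1" for f h
        using G(4)[OF that] assms(3) by blast
    qed
  qed
  then show "equi_Ck m U (f ` I)" using smooth_family_equi_Ck[OF assms(1)] by blast
qed

lemma smooth_family_single:
  assumes "smooth_family S {()} (\<lambda>_. f)"
  shows "smooth_family S I (\<lambda>_. f)"
  using assms by (rule smooth_family_subset) auto

lemma bounded_linear_axis: "bounded_linear (\<lambda>q. axis j (q :: quat) :: quat ^ 'n)"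
  unfolding linear_conv_bounded_linear[symmetric]
  by (rule linearI) (auto simp: axis_def vec_eq_iff)

lemma smooth_family_vec:
  fixes f :: "'n::finite \<Rightarrow> 'i \<Rightarrow> 'a::real_normed_vector \<Rightarrow> quat"
  assumes S: "open S" and f: "\<And>j. smooth_family S I (f j)"
  shows "smooth_family S I (\<lambda>i x. \<chi> j. f j i x)"
proof -
  have "smooth_family S I (\<lambda>i x. \<Sum>j\<in>UNIV. axis j (f j i x) :: quat ^ 'n)"
    by (rule smooth_family_sum[OF finite S]) (intro smooth_family_bounded_linear[OF
        bounded_linear_axis] f)
  moreover have "(\<Sum>j\<in>UNIV. axis j (f j i x) :: quat ^ 'n) = (\<chi> j. f j i x)" for i x
    by (simp add: vec_eq_iff axis_def)
  ultimately show ?thesis by simp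
qed

lemma summable_on_finite_change:
  fixes f :: "'k \<Rightarrow> real"
  assumes "f summable_on UNIV" "finite F" "\<And>k. k \<notin> F \<Longrightarrow> g k \<le> f k" "\<And>k. 0 \<le> g k" "\<And>k. 0 \<le> f k"
  shows "g summable_on UNIV"
proof (rule summable_on_comparison_test)
  have "(\<lambda>k. if k \<in> F then g k else 0) summable_on F" using assms(2) by simp
  then have "(\<lambda>k. if k \<in> F then g k else 0) summable_on UNIV"
    by (rule summable_on_cong_neutral[THEN iffD1, rotated -1]) auto
  then show "(\<lambda>k. f k + (if k \<in> F then g k else 0)) summable_on UNIV"
    using assms(1) by (intro summable_on_add)
qed (use assms(3-5) in \<open>auto simp: add_increasing\<close>)

section \<open>The local section in chart coordinates\<close>

context hk_chart
begin

lemma C_bound: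
  obtains B where "B > 0" "\<And>v j. \<bar>C v $ j\<bar> \<le> B * norm v"
proof -
  have "bounded_linear C" using linC by (simp add: linear_conv_bounded_linear)
  then obtain B where B: "B > 0" "\<And>v. norm (C v) \<le> norm v * B"
    using bounded_linear.pos_bounded by blast
  have "\<bar>C v $ j\<bar> \<le> B * norm v" for v j
    using component_le_norm_cart[of "C v" j] B(2)[of v] by (simp add: mult.commute)
  then show ?thesis using B(1) by (rule that[rotated])
qed

text \<open>A single term of \<open>summable_V\<close> bounds \<open>(norm (V k))\<^sup>2\<close>,
  and \<open>norm (V k)\<close> is at most its square. This makes one radius work for all
  coordinates of the section.\<close>

lemma V_le_norm_sq:
  obtains B where "B > 0" "\<And>k. k \<notin> K \<Longrightarrow> norm (V k) \<le> B * (norm (x0 k))\<^sup>2"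
proof -
  obtain c where c: "c > 0" "\<And>k. k \<notin> K \<Longrightarrow> 1 + norm (lam k) \<le> c * (norm (x0 k))\<^sup>2"
    using x0_M_aff zeros by (rule weight_le_norm_sq) (rule that)
  define s where "s = (\<Sum>\<^sub>\<infinity>k. (norm (V k))\<^sup>2 / (1 + norm (lam k)))"
  have "norm (V k) \<le> (s * c + 1) * (norm (x0 k))\<^sup>2" if k: "k \<notin> K" for k
  proof -
    have "(\<Sum>k\<in>{k}. (norm (V k))\<^sup>2 / (1 + norm (lam k))) \<le> s"
      unfolding s_def by (rule finite_sum_le_infsum[OF summable_V]) (auto intro:
          divide_nonneg_nonneg)
    then have "(norm (V k))\<^sup>2 \<le> s * (1 + norm (lam k))" by (simp add: divide_le_eq add_pos_nonneg)
    moreover have "s \<ge> 0" unfolding s_def by (intro infsum_nonneg divide_nonneg_nonneg) auto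
    ultimately have "(norm (V k))\<^sup>2 \<le> s * (c * (norm (x0 k))\<^sup>2)"
      using mult_left_mono[OF c(2)[OF k]] by (meson order_trans)
    also have "\<dots> \<le> (s * c + 1) * (norm (x0 k))\<^sup>2" by (simp add: algebra_simps)
    finally have "(norm (V k))\<^sup>2 \<le> (s * c + 1) * (norm (x0 k))\<^sup>2" .
    moreover have "norm (V k) * 1 \<le> norm (V k) * norm (V k)"
      using norm_V_ge_1 by (intro mult_left_mono) auto
    ultimately show ?thesis by (simp add: power2_eq_square)
  qed
  moreover have "s * c + 1 > 0" unfolding s_def using c(1)
    by (intro add_nonneg_pos mult_nonneg_nonneg infsum_nonneg divide_nonneg_nonneg) auto
  ultimately show ?thesis by (rule that[rotated])
qed

lemma summable_V_x0: "(\<lambda>k. if k \<in> K then 1 else (norm (V k) / norm (x0 k))\<^sup>2) summable_on UNIV"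
proof -
  obtain c where c: "c > 0" "\<And>k. k \<notin> K \<Longrightarrow> 1 + norm (lam k) \<le> c * (norm (x0 k))\<^sup>2"
    using x0_M_aff zeros by (rule weight_le_norm_sq) (rule that)
  show ?thesis
  proof (rule summable_on_finite_change[OF summable_on_cmult_right[OF summable_V, of c] finK])
    fix k assume k: "k \<notin> K"
    have p: "0 < (norm (x0 k))\<^sup>2" "0 < 1 + norm (lam k)" using x0_nz[OF k] by (auto simp:
        add_pos_nonneg)
    have "(norm (V k))\<^sup>2 * (1 + norm (lam k)) \<le> (norm (V k))\<^sup>2 * (c * (norm (x0 k))\<^sup>2)"
      using c(2)[OF k] by (rule mult_left_mono) simp
    then have "(norm (V k))\<^sup>2 / (norm (x0 k))\<^sup>2 \<le> c * ((norm (V k))\<^sup>2 / (1 + norm (lam k)))"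
      using p by (simp add: divide_simps mult_ac)
    then show "(if k \<in> K then 1 else (norm (V k) / norm (x0 k))\<^sup>2) \<le> c * ((norm (V k))\<^sup>2 / (1 + norm
        (lam k)))"
      using k by (simp add: power_divide)
  qed (use c in auto)
qed

text \<open>The order of magnitude by which coordinate \<open>k\<close> of the section moves: the
  Hopf value changes by a multiple of \<open>norm (V k)\<close>, and \<open>hopf\<close> scales like
  \<open>(norm (x0 k))\<^sup>2\<close>. The squares are summable by
  \<open>summable_V\<close>.\<close>

definition wt :: "'k \<Rightarrow> real" where
  "wt k = (if k \<in> K then 1 else norm (V k) / norm (x0 k))"

lemma wt_summable: "(\<lambda>k. (wt k)\<^sup>2) summable_on UNIV"
proof -
  have "(\<lambda>k. (wt k)\<^sup>2) = (\<lambda>k. if k \<in> K then 1 else (norm (V k) / norm (x0 k))\<^sup>2)"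
    by (auto simp: wt_def)
  then show ?thesis using summable_V_x0 by simp
qed

text \<open>The change of the Hopf value at \<open>k\<close> which the zero level equations force
  when the frame coordinates become \<open>q\<close>.\<close>

definition delta :: "quat ^ 'n \<Rightarrow> 'k \<Rightarrow> quat" where
  "delta q k = (\<Sum>j\<in>UNIV. C (V k) $ j *\<^sub>R (hopf (q $ j) - hopf (x0 (\<kappa> j))))"

definition Sec :: "quat ^ 'n \<Rightarrow> 'k \<Rightarrow> quat" where
  "Sec q k = (if k \<in> K then q $ (inv \<kappa> k)
     else x0 k \<odot> hopf_sec (hopf (x0 k) /\<^sub>R (norm (x0 k))\<^sup>2) (delta q k /\<^sub>R (norm (x0 k))\<^sup>2))"

lemma Sec_frame: "Sec q (\<kappa> j) = q $ j"
  using frame_inj[OF fr] by (simp add: Sec_def)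

lemma delta_ImH: "delta q k \<in> ImH"
  unfolding delta_def
  by (intro subspace_sum[OF ImH_subspace] subspace_scale[OF ImH_subspace] subspace_diff[OF
      ImH_subspace] hopf_ImH)

lemma smooth_family_nth: "open S \<Longrightarrow> smooth_family S I (\<lambda>_ q. (q :: quat ^ 'n) $ j)"
  by (rule smooth_family_linear_maps[of S I _ 1]) (auto simp: linear_iff intro:
      Finite_Cartesian_Product.norm_nth_le)

text \<open>After division by \<open>norm (V k)\<close> the coefficients are bounded by the operator
  bound of \<open>C\<close>, uniformly in \<open>k\<close>.\<close>

lemma smooth_family_delta_scaled:
  "smooth_family UNIV I (\<lambda>k q. delta q k /\<^sub>R norm (V k))"
proof -
  obtain B where B: "B > 0" "\<And>v j. \<bar>C v $ j\<bar> \<le> B * norm v" by (rule C_bound) (rule that)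
  have "smooth_family UNIV I (\<lambda>k q. \<Sum>j\<in>UNIV. (C (V k) $ j / norm (V k)) *\<^sub>R (hopf (q $ j) - hopf (x0
      (\<kappa> j))))"
  proof (rule smooth_family_sum[OF finite open_UNIV])
    fix j :: 'n
    have "smooth_family UNIV I (\<lambda>k q. C (V k) $ j / norm (V k))"
    proof (rule smooth_family_const[OF open_UNIV, where C = B])
      fix k show "norm (C (V k) $ j / norm (V k)) \<le> B"
        using B(1) B(2)[of "V k" j] norm_V_ge_1[of k] by (simp add: divide_le_eq)
    qed
    moreover have "smooth_family UNIV I (\<lambda>k q. hopf (q $ j) - hopf (x0 (\<kappa> j)))"
      by (intro smooth_family_diff smooth_family_hopf smooth_family_nth open_UNIV
          smooth_family_const[OF open_UNIV, where C = "norm (hopf (x0 (\<kappa> j)))"] order_refl)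
    ultimately show "smooth_family UNIV I (\<lambda>k q. (C (V k) $ j / norm (V k)) *\<^sub>R (hopf (q $ j) - hopf
        (x0 (\<kappa> j))))"
      by (rule smooth_family_scaleR)
  qed
  then show ?thesis
    by (rule smooth_family_cong) (simp add: delta_def scaleR_sum_right divide_inverse mult.commute)
qed

text \<open>A choice, because the radius rests on constants known only to exist; it has to be a
  fixed number for the chart domain to be a definition.\<close>

definition wradius :: real where
  "wradius = (SOME e. e > 0 \<and> (\<forall>q k. k \<notin> K \<longrightarrow> (\<Sum>j\<in>UNIV. norm (hopf (q $ j) - hopf (x0 (\<kappa> j)))) < e
     \<longrightarrow> norm (delta q k) \<le> (norm (x0 k))\<^sup>2 / 2))"

lemma wradius:
  "wradius > 0"
  "k \<notin> K \<Longrightarrow> (\<Sum>j\<in>UNIV. norm (hopf (q $ j) - hopf (x0 (\<kappa> j)))) < wradius \<Longrightarrow> norm (delta q k) \<le> (norm (x0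
      k))\<^sup>2 / 2"
proof -
  obtain B where B: "B > 0" "\<And>v j. \<bar>C v $ j\<bar> \<le> B * norm v" by (rule C_bound) (rule that)
  obtain D where D: "D > 0" "\<And>k. k \<notin> K \<Longrightarrow> norm (V k) \<le> D * (norm (x0 k))\<^sup>2" by (rule V_le_norm_sq)
      (rule that)
  have "\<exists>e. e > 0 \<and> (\<forall>q k. k \<notin> K \<longrightarrow> (\<Sum>j\<in>UNIV. norm (hopf (q $ j) - hopf (x0 (\<kappa> j)))) < e
     \<longrightarrow> norm (delta q k) \<le> (norm (x0 k))\<^sup>2 / 2)"
  \<comment> \<open>\<open>norm (delta q k)\<close> is at most
    \<open>B * D * (norm (x0 k))\<^sup>2\<close> times the sum of the frame changes.\<close>
  proof (intro exI[of _ "1 / (2 * B * D)"] conjI allI impI)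
    show "1 / (2 * B * D) > 0" using B D by simp
    fix q :: "quat ^ 'n" and k
    let ?s = "\<Sum>j\<in>UNIV. norm (hopf (q $ j) - hopf (x0 (\<kappa> j)))"
    assume k: "k \<notin> K" and s: "?s < 1 / (2 * B * D)"
    have "norm (delta q k) \<le> (\<Sum>j\<in>UNIV. (B * (D * (norm (x0 k))\<^sup>2)) * norm (hopf (q $ j) - hopf (x0
        (\<kappa> j))))"
      unfolding delta_def
    proof (rule sum_norm_le)
      fix j
      have "\<bar>C (V k) $ j\<bar> \<le> B * norm (V k)" by (rule B(2))
      also have "\<dots> \<le> B * (D * (norm (x0 k))\<^sup>2)" using D(2)[OF k] B(1) by (intro mult_left_mono) auto
      finally show "norm (C (V k) $ j *\<^sub>R (hopf (q $ j) - hopf (x0 (\<kappa> j))))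
          \<le> (B * (D * (norm (x0 k))\<^sup>2)) * norm (hopf (q $ j) - hopf (x0 (\<kappa> j)))"
        unfolding norm_scaleR by (rule mult_right_mono) simp
    qed
    also have "\<dots> = (B * (D * (norm (x0 k))\<^sup>2)) * ?s" by (simp add: sum_distrib_left)
    also have "\<dots> \<le> (B * (D * (norm (x0 k))\<^sup>2)) * (1 / (2 * B * D))"
      using s B D by (intro mult_left_mono) auto
    also have "\<dots> = (norm (x0 k))\<^sup>2 / 2" using B D by simp
    finally show "norm (delta q k) \<le> (norm (x0 k))\<^sup>2 / 2" .
  qed
  from someI_ex[OF this] show "wradius > 0"
    "k \<notin> K \<Longrightarrow> (\<Sum>j\<in>UNIV. norm (hopf (q $ j) - hopf (x0 (\<kappa> j)))) < wradius \<Longrightarrow> norm (delta q k) \<le> (norm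
        (x0 k))\<^sup>2 / 2"
    unfolding wradius_def by blast+
qed

definition W :: "(quat ^ 'n) set" where
  "W = {q. (\<Sum>j\<in>UNIV. norm (hopf (q $ j) - hopf (x0 (\<kappa> j)))) < wradius}"

lemma open_W: "open W"
proof -
  have "continuous_on UNIV (\<lambda>q :: quat ^ 'n. hopf (q $ j))" for j
    using smooth_family_imp_continuous_on[OF smooth_family_hopf[OF smooth_family_nth[OF open_UNIV,
        of "{()}"]]] by simp
  then show ?thesis unfolding W_def
    by (intro open_Collect_less continuous_on_sum continuous_on_norm continuous_on_diff
        continuous_on_const)
qed

lemma Phi_x0_W: "Phi x0 \<in> W"
  using wradius(1) by (simp add: W_def Phi_x0)

lemma delta_W: "q \<in> W \<Longrightarrow> k \<notin> K \<Longrightarrow> norm (delta q k) \<le> (norm (x0 k))\<^sup>2 / 2"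
  using wradius(2) by (simp add: W_def)

text \<open>The displacement of the section divided by \<open>wt k\<close>. The parameter
  \<open>norm (V k) / (norm (x0 k))\<^sup>2\<close> and the vector
  \<open>delta q k /\<^sub>R norm (V k)\<close> are bounded separately, uniformly in
  \<open>k\<close>, and their product is the argument of \<open>hopf_sec\<close> in
  \<open>Sec\<close>.\<close>

definition Sec_quot :: "'k \<Rightarrow> quat ^ 'n \<Rightarrow> quat" where
  "Sec_quot k q = (if k \<in> K then q $ (inv \<kappa> k) - x0 k
     else (x0 k /\<^sub>R norm (x0 k)) \<odot> hopf_sec_quot (hopf (x0 k) /\<^sub>R (norm (x0 k))\<^sup>2)
        (norm (V k) / (norm (x0 k))\<^sup>2) (delta q k /\<^sub>R norm (V k)))"

lemma scaled_delta:
  "(norm (V k) / (norm (x0 k))\<^sup>2) *\<^sub>R (delta q k /\<^sub>R norm (V k)) = delta q k /\<^sub>R (norm (x0 k))\<^sup>2"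
proof -
  have "norm (V k) * inverse (norm (V k)) = 1" using norm_V_ge_1[of k] by (intro right_inverse)
      linarith
  then show ?thesis by (simp add: divide_inverse)
qed

lemma p_unit: "k \<notin> K \<Longrightarrow> norm (hopf (x0 k) /\<^sub>R (norm (x0 k))\<^sup>2) = 1"
  using x0_nz[of k] by (simp add: norm_hopf)

lemma tz_le: "q \<in> W \<Longrightarrow> k \<notin> K \<Longrightarrow>
  norm ((norm (V k) / (norm (x0 k))\<^sup>2) *\<^sub>R (delta q k /\<^sub>R norm (V k))) \<le> 1 / 2"
  unfolding scaled_delta using delta_W[of q k] x0_nz[of k] by (simp add: divide_simps)

lemma Sec_diff: "q \<in> W \<Longrightarrow> Sec q k - x0 k = wt k *\<^sub>R Sec_quot k q"
proof (cases "k \<in> K")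
  case False
  assume q: "q \<in> W"
  let ?n = "norm (x0 k)" and ?v = "norm (V k)"
  have n: "?n > 0" using x0_nz[OF False] by simp
  have "Sec q k = x0 k \<odot> (qcomplex 1 + (?v / ?n\<^sup>2) *\<^sub>R hopf_sec_quot (hopf (x0 k) /\<^sub>R ?n\<^sup>2) (?v /
      ?n\<^sup>2) (delta q k /\<^sub>R ?v))"
    using False hopf_sec_quot[OF p_unit[OF False] tz_le[OF q False]] unfolding Sec_def scaled_delta
        by simp
  moreover have "x0 k \<odot> qcomplex 1 = x0 k" by (simp add: qmul_def qcomplex_def)
  ultimately show ?thesis
    using False n by (simp add: wt_def Sec_quot_def qmul_distribs power2_eq_square divide_inverse
        mult_ac)
qed (simp add: Sec_def wt_def Sec_quot_def)

lemma smooth_family_Sec_quot: "smooth_family W UNIV Sec_quot"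
proof -
  have 1: "smooth_family W {k \<in> UNIV. k \<in> K} (\<lambda>k q. q $ (inv \<kappa> k) - x0 k)"
  proof (rule smooth_family_diff)
    show "smooth_family W {k \<in> UNIV. k \<in> K} (\<lambda>k q. (q :: quat ^ 'n) $ (inv \<kappa> k))"
      by (rule smooth_family_linear_maps[OF open_W, of _ _ 1]) (auto simp: linear_iff intro:
          Finite_Cartesian_Product.norm_nth_le)
    show "smooth_family W {k \<in> UNIV. k \<in> K} (\<lambda>k q. x0 k)"
      by (rule smooth_family_const[OF open_W, of _ _ "\<Sum>k\<in>K. norm (x0 k)"]) (auto intro!:
          member_le_sum)
  qed
  obtain D where D: "D > 0" "\<And>k. k \<notin> K \<Longrightarrow> norm (V k) \<le> D * (norm (x0 k))\<^sup>2" by (rule V_le_norm_sq)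
      (rule that)
  have 2: "smooth_family W {k \<in> UNIV. k \<notin> K} (\<lambda>k q. (x0 k /\<^sub>R norm (x0 k)) \<odot> hopf_sec_quot (hopf (x0
      k) /\<^sub>R (norm (x0 k))\<^sup>2)
        (norm (V k) / (norm (x0 k))\<^sup>2) (delta q k /\<^sub>R norm (V k)))"
  proof (rule bounded_bilinear.smooth_family_prod[OF bounded_bilinear_qmul])
    show "smooth_family W {k \<in> UNIV. k \<notin> K} (\<lambda>k q. x0 k /\<^sub>R norm (x0 k))"
      by (rule smooth_family_const[OF open_W, of _ _ 1]) (use x0_nz in simp)
    show "smooth_family W {k \<in> UNIV. k \<notin> K} (\<lambda>k q. hopf_sec_quot (hopf (x0 k) /\<^sub>R (norm (x0 k))\<^sup>2)
        (norm (V k) / (norm (x0 k))\<^sup>2) (delta q k /\<^sub>R norm (V k)))"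
    proof (rule smooth_family_hopf_sec_quot[where T = D])
      show "smooth_family W {k \<in> UNIV. k \<notin> K} (\<lambda>k q. delta q k /\<^sub>R norm (V k))"
        by (rule smooth_family_shrink[OF smooth_family_delta_scaled open_W]) simp
      fix k assume "k \<in> {k \<in> UNIV. k \<notin> K}"
      then have k: "k \<notin> K" by simp
      show "norm (hopf (x0 k) /\<^sub>R (norm (x0 k))\<^sup>2) = 1" by (rule p_unit[OF k])
      show "\<bar>norm (V k) / (norm (x0 k))\<^sup>2\<bar> \<le> D" using D(2)[OF k] x0_nz[OF k] by (simp add:
          divide_le_eq)
      show "norm ((norm (V k) / (norm (x0 k))\<^sup>2) *\<^sub>R (delta q k /\<^sub>R norm (V k))) \<le> 1 / 2" if "q \<in> W"
          for q
        by (rule tz_le[OF that k])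
    qed
  qed
  show ?thesis
    by (rule smooth_family_cong[OF smooth_family_if[OF 1 2]]) (simp add: Sec_quot_def)
qed

lemma Sec_quot_bound:
  assumes "q \<in> W" obtains B where "\<And>k. norm (Sec_quot k q) \<le> B"
proof -
  obtain B where "B \<ge> 0" "\<And>f. f \<in> range Sec_quot \<Longrightarrow> norm (f q) \<le> B"
    using equi_Ck_loc_bdd[OF smooth_family_equi_Ck[OF smooth_family_Sec_quot]] assms by (rule
        loc_bdd_at) (rule that)
  then show ?thesis by (intro that) auto
qed

lemma Sec_M_aff: assumes q: "q \<in> W" shows "Sec q \<in> M_aff \<Lambda>"
proof (rule M_aff_trans[OF x0_M_aff])
  obtain B where "\<And>k. norm (Sec_quot k q) \<le> B" using q by (rule Sec_quot_bound) (rule that)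
  from l2H_summable[of "weighted wt (\<lambda>k. Sec_quot k q)", unfolded l2H_apply_weighted[OF wt_summable
      this]]
  show "(\<lambda>k. (norm (Sec q k - x0 k))\<^sup>2) summable_on UNIV" by (simp add: Sec_diff[OF q])
qed

lemma coord_Sec: assumes q: "q \<in> W" shows "coord \<Lambda> (Sec q) = coord \<Lambda> x0 + weighted wt (\<lambda>k. Sec_quot
    k q)"
proof (rule l2H_eqI)
  obtain B where B: "\<And>k. norm (Sec_quot k q) \<le> B" using q by (rule Sec_quot_bound) (rule that)
  fix k
  have "Sec q k = x0 k + wt k *\<^sub>R Sec_quot k q" using Sec_diff[OF q, of k] by (simp add:
      algebra_simps)
  then show "l2H_apply (coord \<Lambda> (Sec q)) k = l2H_apply (coord \<Lambda> x0 + weighted wt (\<lambda>k. Sec_quot k q))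
      k"
    by (simp add: l2H_apply_coord[OF Sec_M_aff[OF q]] plus_l2H.rep_eq l2H_apply_coord[OF x0_M_aff]
        l2H_apply_weighted[OF wt_summable B])
qed

lemma smooth_Sec: "smooth_family W {()} (\<lambda>_ q. coord \<Lambda> (Sec q))"
proof -
  have "smooth_family W {()} (\<lambda>_ q. coord \<Lambda> x0 + weighted wt (\<lambda>k. Sec_quot k q))"
    by (intro smooth_family_add smooth_family_weighted smooth_family_Sec_quot wt_summable
        smooth_family_const[OF open_W, where C = "norm (coord \<Lambda> x0)"] order_refl)
  then show ?thesis by (rule smooth_family_cong) (simp add: coord_Sec)
qed

lemma Sec_hopf: assumes q: "q \<in> W" and k: "k \<notin> K"
  shows "hopf (Sec q k) = hopf (x0 k) + delta q k" "\<exists>s>0. herm (Sec q k) (x0 k) = of_real s"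
  using hopf_section[OF x0_nz[OF k] delta_ImH delta_W[OF q k]] k by (simp_all add: Sec_def)

lemma gauged_Sec: "q \<in> W \<Longrightarrow> gauged (Sec q)"
  by (simp add: gauged_def Sec_hopf)

lemma Sec_zero_level: assumes q: "q \<in> W" shows "Sec q \<in> zero_level \<Lambda> lam \<beta>"
  unfolding zero_level_iff[OF fr]
proof (intro conjI allI Sec_M_aff[OF q])
  fix k
  have m: "mu (Sec q) (\<kappa> j) = mu x0 (\<kappa> j) + (1 / 2) *\<^sub>R (hopf (q $ j) - hopf (x0 (\<kappa> j)))" for j
    by (simp add: mu_def Sec_frame scaleR_diff_right)
  show "mu (Sec q) k = (\<Sum>j\<in>UNIV. C (V k) $ j *\<^sub>R mu (Sec q) (\<kappa> j))"
  proof (cases "k \<in> K")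
    case True
    then obtain i where i: "k = \<kappa> i" by auto
    \<comment> \<open>On the frame the equation is an identity, since \<open>C\<close> sends
      \<open>V (\<kappa> i)\<close> to a unit vector.\<close>
    have "(\<Sum>j\<in>UNIV. C (V k) $ j *\<^sub>R mu (Sec q) (\<kappa> j)) = (\<Sum>j\<in>UNIV. if j = i then mu (Sec q) (\<kappa> j)
        else 0)"
      by (rule sum.cong) (auto simp: i frame_V[OF fr] axis_def)
    then show ?thesis by (simp add: i)
  next
    case False
    have "mu (Sec q) k = mu x0 k + (1 / 2) *\<^sub>R delta q k"
      by (simp add: mu_def Sec_hopf(1)[OF q False] scaleR_add_right)
    also have "mu x0 k = (\<Sum>j\<in>UNIV. C (V k) $ j *\<^sub>R mu x0 (\<kappa> j))"
      using x0 zero_level_iff[OF fr] by blast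
    finally show ?thesis
      unfolding m delta_def by (simp add: scaleR_sum_right scaleR_add_right sum.distrib
          mult.commute)
  qed
qed

lemma Sec_gdom: "q \<in> W \<Longrightarrow> Sec q \<in> gdom"
  using gauged_nz[OF gauged_Sec] by (simp add: gdom_def Sec_zero_level)

lemma Phi_Sec: "q \<in> W \<Longrightarrow> Phi (Sec q) = q"
  by (simp add: Phi_eqI[OF orbit_refl gauged_Sec] Sec_frame vec_eq_iff)

lemma Sec_Phi: assumes x: "x \<in> gdom" and w: "Phi x \<in> W" shows "Sec (Phi x) \<in> Orb x"
  by (rule Phi_inj[OF x Sec_gdom[OF w]]) (simp add: Phi_Sec[OF w])

text \<open>Turns infinitely many conditions of nonvanishing into one uniform bound. The difference
  of \<open>y\<close> and \<open>x0\<close> is at most \<open>M\<close>, so it is at most half of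
  \<open>norm (x0 k)\<close> for all but finitely many \<open>k\<close>, and there the product is at
  least half of \<open>(norm (x0 k))\<^sup>2\<close>.\<close>

lemma norm_sq_le_herm:
  assumes y: "y \<in> M_aff \<Lambda>" and nz: "\<And>k. k \<notin> K \<Longrightarrow> herm (y k) (x0 k) \<noteq> 0"
  obtains c where "c > 0" "\<And>k. k \<notin> K \<Longrightarrow> (norm (x0 k))\<^sup>2 \<le> c * norm (herm (y k) (x0 k))"
proof -
  define M where "M = norm (coord \<Lambda> y - coord \<Lambda> x0)"
  define F where "F = {k. norm (x0 k) \<le> 2 * M} - K"
  have F: "finite F" using finite_norm_le[OF x0_M_aff] by (simp add: F_def)
  define b where "b = (\<Sum>k\<in>F. (norm (x0 k))\<^sup>2 / norm (herm (y k) (x0 k)))"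
  have b: "b \<ge> 0" unfolding b_def by (intro sum_nonneg) simp
  have "(norm (x0 k))\<^sup>2 \<le> (2 + b) * norm (herm (y k) (x0 k))" if k: "k \<notin> K" for k
  proof (cases "k \<in> F")
    case True
    have "(norm (x0 k))\<^sup>2 / norm (herm (y k) (x0 k)) \<le> b"
      unfolding b_def by (rule member_le_sum[OF True]) (auto simp: F)
    then have "(norm (x0 k))\<^sup>2 \<le> b * norm (herm (y k) (x0 k))" using nz[OF k] by (simp add:
        divide_le_eq)
    also have "\<dots> \<le> (2 + b) * norm (herm (y k) (x0 k))" by (intro mult_right_mono) auto
    finally show ?thesis .
  next
    case False
    then have n: "2 * M \<le> norm (x0 k)" using k by (simp add: F_def)
    have "norm (herm (y k - x0 k) (x0 k)) \<le> norm (y k - x0 k) * norm (x0 k)" by (rule norm_herm_le)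
    also have "\<dots> \<le> (norm (x0 k) / 2) * norm (x0 k)"
      using n norm_diff_le_coord[OF y x0_M_aff, of k] by (intro mult_right_mono) (auto simp: M_def)
    finally have 1: "norm (herm (y k - x0 k) (x0 k)) \<le> (norm (x0 k))\<^sup>2 / 2" by (simp add:
        power2_eq_square)
    have "herm (x0 k) (x0 k) = herm (y k) (x0 k) - herm (y k - x0 k) (x0 k)" by (simp add:
        herm_diff)
    then have "norm (herm (x0 k) (x0 k)) \<le> norm (herm (y k) (x0 k)) + norm (herm (y k - x0 k) (x0
        k))"
      by (metis norm_triangle_ineq4)
    moreover have "norm (herm (x0 k) (x0 k)) = (norm (x0 k))\<^sup>2" unfolding herm_self norm_of_real by
        simp
    ultimately have "(norm (x0 k))\<^sup>2 \<le> 2 * norm (herm (y k) (x0 k))" using 1 by linarith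
    also have "\<dots> \<le> (2 + b) * norm (herm (y k) (x0 k))" using b by (intro mult_right_mono) auto
    finally show ?thesis .
  qed
  then show ?thesis using b by (intro that[of "2 + b"]) auto
qed

lemma norm_x0_low:
  obtains e where "e > 0" "\<And>k. k \<notin> K \<Longrightarrow> e \<le> norm (x0 k)"
proof -
  obtain c where c: "c > 0" "\<And>k. k \<notin> K \<Longrightarrow> 1 + norm (lam k) \<le> c * (norm (x0 k))\<^sup>2"
    using x0_M_aff zeros by (rule weight_le_norm_sq) (rule that)
  have "sqrt (1 / c) \<le> norm (x0 k)" if "k \<notin> K" for k
  proof -
    have "1 \<le> c * (norm (x0 k))\<^sup>2" using c(2)[OF that] norm_ge_zero[of "lam k"] by linarith
    then have "1 / c \<le> (norm (x0 k))\<^sup>2" using c(1) by (simp add: divide_le_eq mult.commute)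
    then have "sqrt (1 / c) \<le> sqrt ((norm (x0 k))\<^sup>2)" by (rule real_sqrt_le_mono)
    then show ?thesis by simp
  qed
  then show ?thesis using c(1) by (intro that[of "sqrt (1 / c)"]) auto
qed

text \<open>Parametrising the points by a smooth map \<open>f\<close> gives both the smoothness of \<open>Phi\<close> itself and
  that of the transition functions, and so avoids a chain rule through the Hilbert space.\<close>

lemma Phi_smooth:
  fixes f :: "'a::real_normed_vector \<Rightarrow> 'k \<Rightarrow> quat"
  assumes fM: "\<And>x. x \<in> S \<Longrightarrow> f x \<in> M_aff \<Lambda>"
    and sf: "smooth_family S {()} (\<lambda>_ x. coord \<Lambda> (f x))"
    and a: "a \<in> S" and nz: "\<And>k. k \<notin> K \<Longrightarrow> herm (f a k) (x0 k) \<noteq> 0"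
  obtains U F where "open U" "a \<in> U" "U \<subseteq> S" "smooth_family U {()} (\<lambda>_. F)"
    "\<And>x k. x \<in> U \<Longrightarrow> k \<notin> K \<Longrightarrow> herm (f x k) (x0 k) \<noteq> 0" "\<And>x. x \<in> U \<Longrightarrow> F x = Phi (f x)"
proof -
  have S: "open S" using sf by (rule smooth_family_open)
  obtain c where c: "c > 0" "\<And>k. k \<notin> K \<Longrightarrow> (norm (x0 k))\<^sup>2 \<le> c * norm (herm (f a k) (x0 k))"
    using fM[OF a] nz by (rule norm_sq_le_herm) (assumption, rule that)
  obtain e0 where e0: "e0 > 0" "\<And>k. k \<notin> K \<Longrightarrow> e0 \<le> norm (x0 k)" by (rule norm_x0_low) (rule that)
  define e where "e = min e0 1"
  \<comment> \<open>The length scale of coordinate \<open>k\<close>. On the frame, where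
    \<open>x0 k\<close> may vanish, any positive value serves.\<close>
  define d where "d k = (if k \<in> K then 1 else norm (x0 k))" for k
  have e: "e > 0" "\<And>k. e \<le> d k" using e0 by (auto simp: e_def d_def min_le_iff_disj)
  have dpos: "d k > 0" for k using e(1) e(2)[of k] by linarith
  define h where "h k = herm (f a k) (x0 k)" for k
  have h: "h k \<noteq> 0" if "k \<notin> K" for k using nz[OF that] by (simp add: h_def)
  \<comment> \<open>Scaled so that \<open>p k x / d k\<close> is the change of
    \<open>herm (f x k) (x0 k)\<close> relative to its value at \<open>a\<close>; with the factor
    \<open>d k\<close> the operators are still uniformly bounded, by \<open>c\<close>.\<close>
  define L where "L k w = (if k \<in> K then 0 else of_real (d k) * herm w (x0 k) / h k)" for k w
  have linL: "linear (L k)" for k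
    by (rule linearI) (auto simp: L_def herm_add herm_scaleR scaleR_conv_of_real add_divide_distrib
        distrib_left)
  have bdL: "norm (L k w) \<le> c * norm w" for k w
  proof (cases "k \<in> K")
    case False
    have hp: "norm (h k) > 0" using h[OF False] by simp
    have "norm (L k w) = norm (x0 k) * norm (herm w (x0 k)) / norm (h k)"
      using False by (simp add: L_def norm_mult norm_divide d_def)
    also have "\<dots> \<le> norm (x0 k) * (norm w * norm (x0 k)) / norm (h k)"
      by (intro divide_right_mono mult_left_mono norm_herm_le) auto
    also have "\<dots> = ((norm (x0 k))\<^sup>2 / norm (h k)) * norm w" by (simp add: power2_eq_square)
    also have "\<dots> \<le> c * norm w"
      using c(2)[OF False] hp by (intro mult_right_mono) (auto simp: divide_le_eq h_def)
    finally show ?thesis .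
  qed (use c in \<open>simp add: L_def\<close>)
  define v where "v x = coord \<Lambda> (f x) - coord \<Lambda> (f a)" for x
  have sv: "smooth_family S {()} (\<lambda>_. v)"
    unfolding v_def using sf by (rule smooth_family_diff) (rule smooth_family_const[OF S, where C =
        "norm (coord \<Lambda> (f a))"], simp)
  define p where "p k x = L k (l2H_apply (v x) k)" for k x
  have sp: "smooth_family S UNIV p"
  proof -
    have "smooth_family S UNIV (\<lambda>k x. (\<lambda>w. L k (l2H_apply w k)) (v x))"
    proof (rule smooth_family_linear_comp[OF smooth_family_single[OF sv], where B = c])
      show "linear (\<lambda>w. L k (l2H_apply w k))" for k
        using linear_compose[OF bounded_linear.linear[OF bounded_linear_l2H_apply[of k]] linL[of k]]
            by (simp add: o_def)
      show "norm (L k (l2H_apply w k)) \<le> c * norm w" for k w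
        using bdL[of k "l2H_apply w k"] mult_left_mono[OF norm_l2H_apply_le[of w k], of c] c(1) by
            linarith
    qed
    then show ?thesis by (rule smooth_family_cong) (simp add: p_def)
  qed
  \<comment> \<open>As \<open>c * r = e / 4\<close>, every relative change on \<open>U\<close> is at
    most 1 / 4, where the principal logarithm is smooth.\<close>
  define r where "r = e / (4 * c)"
  have r: "r > 0" using e c by (simp add: r_def)
  define U where "U = S \<inter> v -` ball 0 r"
  have U: "open U" "a \<in> U" "U \<subseteq> S"
  proof -
    show "open U" unfolding U_def
      by (rule continuous_open_preimage[OF _ S open_ball])
        (use smooth_family_imp_continuous_on[OF sv] in simp)
  qed (use a r in \<open>auto simp: U_def v_def\<close>)
  have pU: "norm (p k x) \<le> d k / 4" if "x \<in> U" for k x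
  proof -
    have "norm (p k x) \<le> c * norm (l2H_apply (v x) k)" unfolding p_def by (rule bdL)
    also have "\<dots> \<le> c * r"
      using norm_l2H_apply_le[of "v x" k] that c(1) by (intro mult_left_mono) (auto simp: U_def)
    also have "\<dots> \<le> d k / 4" using c(1) e(2)[of k] by (simp add: r_def)
    finally show ?thesis .
  qed
  \<comment> \<open>The quadratic remainder of the logarithm, enlarged by
    \<open>(d k)\<^sup>2\<close> and still smooth uniformly in \<open>k\<close>. Multiplied by the
    weights \<open>1 / d k\<close> it is the remainder of
    \<open>d k * Ln (1 + p k x / d k)\<close>.\<close>
  define g where "g k x = of_real ((d k)\<^sup>2) * (Ln (1 + p k x / of_real (d k)) - p k x / of_real (d
      k))" for k x
  have sg: "smooth_family U UNIV g"
  proof -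
    have "smooth_family U UNIV (\<lambda>k x. of_real ((d k)\<^sup>2) * (Ln (1 + p k x / of_real (d k)) - p k x /
        of_real (d k)))"
    proof (rule smooth_family_Ln_remainder[OF smooth_family_shrink[OF sp U(1,3)] e(1) e(2)])
      show "norm (p k x) \<le> d k / 2" if "x \<in> U" for k x using pU[OF that, of k] dpos[of k] by
          linarith
    qed
    then show ?thesis by (rule smooth_family_cong) (simp add: g_def)
  qed
  define T where "T k w = qcomplex (L k w)" for k w
  have linT: "linear (T k)" for k
    using linear_compose[OF linL bounded_linear.linear[OF bounded_linear_qcomplex]] by (simp add:
        T_def[abs_def] o_def)
  have bdT: "norm (T k w) \<le> c * norm w" for k w by (simp add: T_def norm_qcomplex bdL)
  have dsum: "(\<lambda>k. (1 / d k)\<^sup>2) summable_on UNIV"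
  proof (rule summable_on_finite_change[OF wt_summable finK])
    fix k assume k: "k \<notin> K"
    have "1 / d k \<le> wt k" using k norm_V_ge_1[of k] by (simp add: d_def wt_def divide_right_mono)
    then show "(1 / d k)\<^sup>2 \<le> (wt k)\<^sup>2" using dpos[of k] by (intro power_mono) auto
  qed auto
  \<comment> \<open>Collects \<open>d k * Ln (1 + p k x / d k)\<close> in the Hilbert space. The
    linear part has merely bounded coefficients and needs the square summability of
    \<open>v x\<close>; the remainder needs that of the weights.\<close>
  define R where "R x = l2H_diag T (v x) + weighted (\<lambda>k. 1 / d k) (\<lambda>k. qcomplex (g k x))" for x
  have sR: "smooth_family U {()} (\<lambda>_. R)"
    unfolding R_def[abs_def]
    by (intro smooth_family_add smooth_family_bounded_linear[OF bounded_linear_l2H_diag[OF linT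
        bdT]]
        smooth_family_shrink[OF sv U(1,3)] smooth_family_weighted dsum
            smooth_family_bounded_linear[OF bounded_linear_qcomplex] sg)
  define \<theta>1 where "\<theta>1 x k = Im (Ln (1 + p k x / of_real (d k)))" for x k
  have Rk: "l2H_apply (R x) k = qcomplex (of_real (d k) * Ln (1 + p k x / of_real (d k)))" if x: "x
      \<in> U" for x k
  proof -
    obtain B where B: "\<And>k. norm (qcomplex (g k x)) \<le> B"
    proof -
      obtain B where "B \<ge> 0" "\<And>f. f \<in> range g \<Longrightarrow> norm (f x) \<le> B"
        using equi_Ck_loc_bdd[OF smooth_family_equi_Ck[OF sg]] x by (rule loc_bdd_at) (rule that)
      then show ?thesis by (intro that) (auto simp: norm_qcomplex)
    qed
    have "l2H_apply (R x) k = qcomplex (p k x) + (1 / d k) *\<^sub>R qcomplex (g k x)"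
      by (simp add: R_def plus_l2H.rep_eq l2H_apply_diag[OF linT bdT] l2H_apply_weighted[OF dsum B]
          T_def p_def)
    also have "\<dots> = qcomplex (p k x + of_real (1 / d k) * g k x)"
      by (simp add: qcomplex_def scaleR_conv_of_real)
    also have "p k x + of_real (1 / d k) * g k x = of_real (d k) * Ln (1 + p k x / of_real (d k))"
      using dpos[of k] by (simp add: g_def power2_eq_square algebra_simps)
    finally show ?thesis .
  qed
  have th1: "\<theta>1 x \<in> t_alg lam" if x: "x \<in> U" for x
  proof (rule t_alg_by_x0[OF l2H_summable[of "R x"]])
    fix k
    show "\<theta>1 x k = 0" if "k \<in> K" using that by (simp add: \<theta>1_def p_def L_def)
    assume k: "k \<notin> K"
    have "\<bar>\<theta>1 x k\<bar> * norm (x0 k) = d k * \<bar>Im (Ln (1 + p k x / of_real (d k)))\<bar>"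
      using k by (simp add: \<theta>1_def d_def)
    also have "\<dots> \<le> d k * norm (Ln (1 + p k x / of_real (d k)))"
      using dpos[of k] by (intro mult_left_mono abs_Im_le_cmod) auto
    also have "\<dots> = norm (l2H_apply (R x) k)" using dpos[of k] by (simp add: Rk[OF x] norm_qcomplex
        norm_mult)
    finally show "\<bar>\<theta>1 x k\<bar> * norm (x0 k) \<le> 1 * norm (l2H_apply (R x) k)" by simp
  qed
  obtain BC where BC: "BC > 0" "\<And>v j. \<bar>C v $ j\<bar> \<le> BC * norm v" by (rule C_bound) (rule that)
  have asum: "(\<lambda>k. (C (V k) $ j / d k)\<^sup>2) summable_on UNIV" for j
  proof (rule summable_on_finite_change[OF summable_on_cmult_right[OF wt_summable, of "BC\<^sup>2"] finK])
    fix k assume k: "k \<notin> K"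
    have "\<bar>C (V k) $ j / d k\<bar> \<le> BC * wt k"
      using k BC(2)[of "V k" j] dpos[of k] by (simp add: d_def wt_def divide_right_mono)
    then have "\<bar>C (V k) $ j / d k\<bar>\<^sup>2 \<le> (BC * wt k)\<^sup>2" by (rule power_mono) simp
    then show "(C (V k) $ j / d k)\<^sup>2 \<le> BC\<^sup>2 * (wt k)\<^sup>2" by (simp only: power2_abs
        power_mult_distrib)
  qed auto
  \<comment> \<open>Represents coordinate \<open>j\<close> of \<open>C (\<beta> \<theta>)\<close> as
    an inner product with \<open>R\<close>: the division by \<open>d k\<close> undoes the scaling,
    and pairing with \<open>\<i>\<close> takes imaginary parts.\<close>
  define Bv where "Bv j = weighted (\<lambda>k. C (V k) $ j / d k) (\<lambda>_. qcomplex \<i>)" for j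
  have beta1: "C (\<beta> (\<theta>1 x)) $ j = R x \<bullet> Bv j" if x: "x \<in> U" for x j
  proof -
    have bl: "bounded_linear (\<lambda>v. C v $ j)"
      using bounded_linear_compose[OF bounded_linear_vec_nth, of C] linC by (simp add:
          linear_conv_bounded_linear)
    have "((\<lambda>k. C (\<theta>1 x k *\<^sub>R V k) $ j) has_sum C (\<beta> (\<theta>1 x)) $ j) UNIV"
      using has_sum_bounded_linear[OF bl beta_has_sum[OF th1[OF x]]] by (simp add: o_def)
    then have "C (\<beta> (\<theta>1 x)) $ j = (\<Sum>\<^sub>\<infinity>k. \<theta>1 x k * C (V k) $ j)"
      by (simp add: linear_scale[OF linC] infsumI)
    also have "\<dots> = (\<Sum>\<^sub>\<infinity>k. l2H_apply (R x) k \<bullet> l2H_apply (Bv j) k)"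
    proof (rule infsum_cong)
      fix k
      have "norm (qcomplex \<i>) \<le> 1" by (simp add: norm_qcomplex)
      from l2H_apply_weighted[OF asum this]
      have "l2H_apply (Bv j) k = (C (V k) $ j / d k) *\<^sub>R qcomplex \<i>" by (simp add: Bv_def)
      then show "\<theta>1 x k * C (V k) $ j = l2H_apply (R x) k \<bullet> l2H_apply (Bv j) k"
        using dpos[of k] by (simp add: Rk[OF x] \<theta>1_def qcomplex_def inner_complex_def)
    qed
    finally show ?thesis by (simp add: inner_l2H_def)
  qed
  \<comment> \<open>Principal arguments are used at the fixed point \<open>a\<close> only. The angle
    at \<open>x\<close> adds the small angle \<open>\<theta>1 x\<close>, which has no jumps on
    \<open>U\<close>.\<close>
  define \<theta>0 where "\<theta>0 = Arg_herm (f a)"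
  have th0: "\<theta>0 \<in> t_alg lam" unfolding \<theta>0_def by (rule Arg_herm_t_alg[OF fM[OF a] nz])
  define F where "F x = (\<chi> j. qcomplex (exp (\<i> * of_real (C (\<beta> \<theta>0) $ j + R x \<bullet> Bv j)))
      \<odot> (\<Lambda> (\<kappa> j) + l2H_apply (coord \<Lambda> (f x)) (\<kappa> j)))" for x
  have sF: "smooth_family U {()} (\<lambda>_. F)"
    unfolding F_def[abs_def]
  proof (rule smooth_family_vec[OF U(1)], rule bounded_bilinear.smooth_family_prod[OF
      bounded_bilinear_qmul])
    fix j
    have "smooth_family U {()} (\<lambda>_ x. C (\<beta> \<theta>0) $ j + R x \<bullet> Bv j)"
      by (intro smooth_family_add smooth_family_inner sR
          smooth_family_const[OF U(1), where C = "norm (C (\<beta> \<theta>0) $ j)"]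
          smooth_family_const[OF U(1), where C = "norm (Bv j)"] order_refl)
    then show "smooth_family U {()} (\<lambda>_ x. qcomplex (exp (\<i> * of_real (C (\<beta> \<theta>0) $ j + R x \<bullet> Bv
        j))))"
      by (intro smooth_family_bounded_linear[OF bounded_linear_qcomplex] smooth_family_exp
          smooth_family_bounded_linear[OF bounded_linear_compose[OF bounded_linear_mult_right
              bounded_linear_of_real]])
    show "smooth_family U {()} (\<lambda>_ x. \<Lambda> (\<kappa> j) + l2H_apply (coord \<Lambda> (f x)) (\<kappa> j))"
      by (intro smooth_family_add smooth_family_bounded_linear[OF bounded_linear_l2H_apply]
          smooth_family_shrink[OF sf U(1,3)] smooth_family_const[OF U(1), where C = "norm (\<Lambda> (\<kappa>
              j))"] order_refl)
  qed
  have z: "herm (f x k) (x0 k) = h k * (1 + p k x / of_real (d k))" "1 + p k x / of_real (d k) \<noteq> 0"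
    if x: "x \<in> U" and k: "k \<notin> K" for x k
  proof -
    have "l2H_apply (v x) k = f x k - f a k"
      using x U(3) a by (simp add: v_def minus_l2H.rep_eq l2H_apply_coord fM subset_iff)
    then have "p k x / of_real (d k) = (herm (f x k) (x0 k) - h k) / h k"
      using k dpos[of k] by (simp add: p_def L_def h_def herm_diff)
    then show "herm (f x k) (x0 k) = h k * (1 + p k x / of_real (d k))" using h[OF k] by (simp add:
        field_simps)
    have "norm (p k x / of_real (d k)) \<le> 1 / 4" using pU[OF x, of k] dpos[of k] by (simp add:
        norm_divide divide_le_eq)
    then show "1 + p k x / of_real (d k) \<noteq> 0"
      by (metis add_eq_0_iff norm_minus_cancel norm_one minus_minus not_le divide_less_eq_1_pos
          one_less_numeral_iff semiring_norm(76) zero_less_numeral)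
  qed
  have FPhi: "F x = Phi (f x)" if x: "x \<in> U" for x
  proof -
    define \<theta> where "\<theta> k = \<theta>0 k + \<theta>1 x k" for k
    have t: "\<theta> \<in> t_alg lam" unfolding \<theta>_def by (rule t_alg_add[OF th0 th1[OF x]])
    have t0: "\<theta> (\<kappa> j) = 0" for j by (simp add: \<theta>_def \<theta>0_def Arg_herm_def \<theta>1_def p_def L_def)
    obtain y where y: "y \<in> Orb (f x)" "gauged y"
      "\<And>j. y (\<kappa> j) = qcomplex (exp (\<i> * of_real (C (\<beta> \<theta>) $ j))) \<odot> f x (\<kappa> j)"
    proof (rule gauge_by[OF t t0])
      fix k assume k: "k \<notin> K"
      let ?z = "1 + p k x / of_real (d k)"
      note zz = z[OF x k]
      have "h k = of_real (norm (h k)) * exp (\<i> * of_real (\<theta>0 k))"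
        using Arg_eq[OF h[OF k]] k by (simp add: \<theta>0_def Arg_herm_def h_def)
      moreover have "?z = of_real (norm ?z) * exp (\<i> * of_real (\<theta>1 x k))"
        using Arg_eq[OF zz(2)] Arg_eq_Im_Ln[OF zz(2)] by (simp add: \<theta>1_def)
      ultimately have "h k * ?z = (of_real (norm (h k)) * exp (\<i> * of_real (\<theta>0 k))) * (of_real (norm
          ?z) * exp (\<i> * of_real (\<theta>1 x k)))"
        by (rule arg_cong2[where f = "(*)"])
      also have "\<dots> = of_real (norm (h k) * norm ?z) * exp (\<i> * of_real (\<theta> k))"
        by (simp add: \<theta>_def distrib_left exp_add mult_ac)
      finally have "herm (f x k) (x0 k) = of_real (norm (h k) * norm ?z) * exp (\<i> * of_real (\<theta> k))"
        unfolding zz(1) .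
      moreover have "norm (h k) * norm ?z > 0" using h[OF k] zz(2) by simp
      ultimately show "\<exists>s>0. herm (f x k) (x0 k) = of_real s * exp (\<i> * of_real (\<theta> k))" by blast
    qed (rule that)
    have "C (\<beta> \<theta>) $ j = C (\<beta> \<theta>0) $ j + R x \<bullet> Bv j" for j
      unfolding \<theta>_def beta_add[OF th0 th1[OF x]] by (simp add: linear_add[OF linC] beta1[OF x])
    moreover have "\<Lambda> (\<kappa> j) + l2H_apply (coord \<Lambda> (f x)) (\<kappa> j) = f x (\<kappa> j)" for j
      using fM[of x] x U(3) by (simp add: l2H_apply_coord subset_iff)
    ultimately show ?thesis unfolding Phi_eqI[OF y(1,2)] F_def y(3) by simp
  qed
  show ?thesis
  proof (rule that[OF U sF _ FPhi])
    show "herm (f x k) (x0 k) \<noteq> 0" if "x \<in> U" "k \<notin> K" for x k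
      using z[OF that] h[OF that(2)] by simp
  qed
qed

end

section \<open>The quotient as a smooth manifold\<close>

lemma bounded_linear_act:
  assumes "\<And>k. norm (g k) = 1"
  shows "bounded_linear (l2H_diag (\<lambda>k q. qcomplex (g k) \<odot> q))"
    and "l2H_apply (l2H_diag (\<lambda>k q. qcomplex (g k) \<odot> q) v) k = qcomplex (g k) \<odot> l2H_apply v k"
proof -
  have lin: "linear (\<lambda>q. qcomplex (g k) \<odot> q)" for k by (rule linearI) (simp_all add: qmul_distribs)
  have bd: "norm (qcomplex (g k) \<odot> q) \<le> 1 * norm q" for k q using assms by (simp add: norm_qmul
      norm_qcomplex)
  show "bounded_linear (l2H_diag (\<lambda>k q. qcomplex (g k) \<odot> q))" by (rule bounded_linear_l2H_diag[OF
      lin bd])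
  show "l2H_apply (l2H_diag (\<lambda>k q. qcomplex (g k) \<odot> q) v) k = qcomplex (g k) \<odot> l2H_apply v k"
    by (rule l2H_apply_diag[OF lin bd])
qed

lemma topspace_M_topology: "topspace (M_topology \<Lambda>) = M_aff \<Lambda>"
  by (simp add: M_topology_def topspace_pullback_topology)

lemma openin_M_topology: "openin (M_topology \<Lambda>) X \<longleftrightarrow> (\<exists>T. open T \<and> X = {x \<in> M_aff \<Lambda>. coord \<Lambda> x \<in> T})"
  unfolding M_topology_def openin_pullback_topology by (auto simp: vimage_def Int_def conj_commute)

lemma second_countable_M_topology: "second_countable (M_topology (\<Lambda> :: 'k::countable \<Rightarrow> quat))"
proof -
  obtain B :: "'k l2H set set" where B: "countable B" "\<forall>V\<in>B. open V"
    "\<forall>U x. open U \<and> x \<in> U \<longrightarrow> (\<exists>V\<in>B. x \<in> V \<and> V \<subseteq> U)"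
    using second_countable_l2H unfolding second_countable_def open_openin[symmetric] by blast
  let ?B = "(\<lambda>T. {x \<in> M_aff \<Lambda>. coord \<Lambda> x \<in> T}) ` B"
  show ?thesis unfolding second_countable_def
  proof (intro exI[of _ ?B] conjI ballI allI impI)
    show "countable ?B" using B(1) by simp
    show "openin (M_topology \<Lambda>) V" if "V \<in> ?B" for V
      using that B(2) unfolding openin_M_topology by blast
    fix U x assume "openin (M_topology \<Lambda>) U \<and> x \<in> U"
    then obtain T where T: "open T" "U = {x \<in> M_aff \<Lambda>. coord \<Lambda> x \<in> T}" "x \<in> U"
      unfolding openin_M_topology by blast
    then obtain V where "V \<in> B" "coord \<Lambda> x \<in> V" "V \<subseteq> T" using B(3) by blast
    then show "\<exists>V\<in>?B. x \<in> V \<and> V \<subseteq> U"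
      using T by (intro bexI[of _ "{x \<in> M_aff \<Lambda>. coord \<Lambda> x \<in> V}"]) auto
  qed
qed

lemma smooth_onI_family: "smooth_family S {()} (\<lambda>_. f) \<Longrightarrow> smooth_on S f"
  by (rule smooth_onI) blast

section \<open>Topology of the quotient\<close>

context hk_setting
begin

abbreviation Z :: "('k \<Rightarrow> quat) set" where "Z \<equiv> zero_level \<Lambda> lam \<beta>"

abbreviation Ztop :: "('k \<Rightarrow> quat) topology" where "Ztop \<equiv> subtopology (M_topology \<Lambda>) Z"

abbreviation Q :: "('k \<Rightarrow> quat) set topology" where "Q \<equiv> hk_quotient \<Lambda> lam \<beta>"

lemma Z_subset: "Z \<subseteq> M_aff \<Lambda>"
  using zero_level_M_aff by blast

lemma topspace_Ztop: "topspace Ztop = Z"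
  using Z_subset by (auto simp: topspace_M_topology)

lemma openin_Ztop: "openin Ztop X \<longleftrightarrow> (\<exists>T. open T \<and> X = {x \<in> Z. coord \<Lambda> x \<in> T})"
proof -
  have eq: "{x \<in> M_aff \<Lambda>. coord \<Lambda> x \<in> T} \<inter> Z = {x \<in> Z. coord \<Lambda> x \<in> T}" for T
    using Z_subset by blast
  show ?thesis
  proof
    assume "openin Ztop X"
    then obtain T where "open T" "X = {x \<in> M_aff \<Lambda>. coord \<Lambda> x \<in> T} \<inter> Z"
      unfolding openin_subtopology openin_M_topology by (elim exE conjE) simp
    then show "\<exists>T. open T \<and> X = {x \<in> Z. coord \<Lambda> x \<in> T}" unfolding eq by (intro exI conjI)
  next
    assume "\<exists>T. open T \<and> X = {x \<in> Z. coord \<Lambda> x \<in> T}"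
    then obtain T where T: "open T" "X = {x \<in> M_aff \<Lambda>. coord \<Lambda> x \<in> T} \<inter> Z"
      by (elim exE conjE) (rule that, simp_all only: eq)
    show "openin Ztop X"
      unfolding openin_subtopology openin_M_topology by (intro exI conjI) (rule T(1), rule refl,
          rule T(2))
  qed
qed

lemma openin_ZtopI:
  assumes "X \<subseteq> Z" "\<And>x. x \<in> X \<Longrightarrow> \<exists>T. open T \<and> coord \<Lambda> x \<in> T \<and> {y \<in> Z. coord \<Lambda> y \<in> T} \<subseteq> X"
  shows "openin Ztop X"
proof -
  let ?T = "\<Union> {T. open T \<and> {y \<in> Z. coord \<Lambda> y \<in> T} \<subseteq> X}"
  have "X = {x \<in> Z. coord \<Lambda> x \<in> ?T}" using assms by blast
  moreover have "open ?T" by (rule open_Union) auto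
  ultimately show ?thesis unfolding openin_Ztop by blast
qed

lemma Lambda_M_aff: "\<Lambda> \<in> M_aff \<Lambda>"
  by (simp add: M_aff_def)

text \<open>In the global chart a group element is an affine map: a bounded diagonal operator
  followed by the translation that accounts for the origin \<open>\<Lambda>\<close>.\<close>

lemma coord_act:
  assumes t: "t \<in> t_alg lam" and x: "x \<in> M_aff \<Lambda>"
  shows "coord \<Lambda> (act (exp_t t) x) = l2H_diag (\<lambda>k q. qcomplex (exp_t t k) \<odot> q) (coord \<Lambda> x) + coord \<Lambda>
      (act (exp_t t) \<Lambda>)"
  by (rule l2H_eqI)
    (simp add: plus_l2H.rep_eq l2H_apply_coord[OF act_M_aff[OF exp_t_T_group[OF t] x]]
      l2H_apply_coord[OF act_M_aff[OF exp_t_T_group[OF t] Lambda_M_aff]] bounded_linear_act(2)[OF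
          norm_exp_t]
      l2H_apply_coord[OF x] act_apply qmul_distribs)

lemma quotient_map_Orb: "quotient_map Ztop Q Orb"
  unfolding hk_quotient_def by (rule quotient_map_quotient_topology)

lemma topspace_Q: "topspace Q = Orb ` Z"
  unfolding hk_quotient_def topspace_quotient_topology topspace_Ztop ..

text \<open>The projection is open because each group element acts continuously: the saturation of
  an open set is a union of preimages under the action. Second countability passes to the quotient
  in this way.\<close>

lemma openin_Q_image:
  assumes X: "openin Ztop X"
  shows "openin Q (Orb ` X)"
  unfolding hk_quotient_def openin_quotient_topology topspace_Ztop
proof
  obtain T where T: "open T" "X = {x \<in> Z. coord \<Lambda> x \<in> T}" using X unfolding openin_Ztop by blast
  show "Orb ` X \<subseteq> Orb ` Z" using T by blast
  show "openin Ztop {x \<in> Z. Orb x \<in> Orb ` X}"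
  proof (rule openin_ZtopI)
    fix x assume "x \<in> {x \<in> Z. Orb x \<in> Orb ` X}"
    then obtain y where x: "x \<in> Z" and y: "y \<in> X" "Orb x = Orb y" by blast
    then obtain t where t: "t \<in> n_lattice" "y = act (exp_t t) x" unfolding orbit_eq_iff orbit_iff by
        blast
    have ta: "t \<in> t_alg lam" using t by (simp add: n_lattice_def)
    define G where "G w = l2H_diag (\<lambda>k q. qcomplex (exp_t t k) \<odot> q) w + coord \<Lambda> (act (exp_t t) \<Lambda>)"
        for w
    have G: "coord \<Lambda> (act (exp_t t) x) = G (coord \<Lambda> x)" if "x \<in> Z" for x
      unfolding G_def by (rule coord_act[OF ta zero_level_M_aff[OF that]])
    have "continuous_on UNIV G" unfolding G_def[abs_def]
      by (intro continuous_on_add continuous_on_const linear_continuous_on bounded_linear_act(1)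
          norm_exp_t)
    then have "open (G -` T)" using T(1) by (simp add: open_vimage)
    moreover have "coord \<Lambda> x \<in> G -` T" using G[OF x] y(1) t(2) T(2) by simp
    moreover have "{w \<in> Z. coord \<Lambda> w \<in> G -` T} \<subseteq> {x \<in> Z. Orb x \<in> Orb ` X}"
    proof clarify
      fix w assume w: "w \<in> Z" "G (coord \<Lambda> w) \<in> T"
      have o: "act (exp_t t) w \<in> Orb w" using t(1) by (auto simp: orbit_iff)
      then have "act (exp_t t) w \<in> X" using G[OF w(1)] w zero_level_orbit[OF o] by (simp add: T(2))
      then show "Orb w \<in> Orb ` X" using o orbit_eq_iff by blast
    qed
    ultimately show "\<exists>T. open T \<and> coord \<Lambda> x \<in> T \<and> {w \<in> Z. coord \<Lambda> w \<in> T} \<subseteq> {x \<in> Z. Orb x \<in> Orb ` X}"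
      by blast
  qed blast
qed

lemma second_countable_Q: "second_countable Q"
proof (rule second_countable_open_map_image)
  show "continuous_map Ztop Q Orb" by (rule quotient_imp_continuous_map[OF quotient_map_Orb])
  show "open_map Ztop Q Orb" unfolding open_map_def using openin_Q_image by blast
  show "Orb ` topspace Ztop = topspace Q" by (simp only: topspace_Q topspace_Ztop)
  show "second_countable Ztop" by (rule second_countable_subtopology[OF
      second_countable_M_topology])
qed

text \<open>An invariant function separates orbits where it is continuous: preimages of disjoint
  open sets are open and invariant within \<open>D\<close>, and the projection is open. Taking
  \<open>T\<close> to be the whole space shows that \<open>D\<close> is open as well.\<close>

lemma separate_orbits:
  fixes f :: "('k \<Rightarrow> quat) \<Rightarrow> 'e::t2_space"
  assumes f: "\<And>T. open T \<Longrightarrow> openin Ztop {x \<in> D. f x \<in> T}"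
    and inv: "\<And>x y. x \<in> D \<Longrightarrow> y \<in> Orb x \<Longrightarrow> f y = f x"
    and x: "x \<in> D" and y: "y \<in> D" and ne: "f x \<noteq> f y"
  shows "\<exists>U V. openin Q U \<and> openin Q V \<and> Orb x \<in> U \<and> Orb y \<in> V \<and> disjnt U V"
proof -
  obtain S T where ST: "open S" "open T" "f x \<in> S" "f y \<in> T" "S \<inter> T = {}"
    using hausdorff[OF ne] by blast
  let ?U = "Orb ` {x \<in> D. f x \<in> S}" and ?V = "Orb ` {x \<in> D. f x \<in> T}"
  have "disjnt ?U ?V"
  proof (rule ccontr)
    assume "\<not> disjnt ?U ?V"
    then obtain a b where ab: "a \<in> D" "f a \<in> S" "b \<in> D" "f b \<in> T" "Orb a = Orb b"
      unfolding disjnt_def by blast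
    then have "f b = f a" using inv[OF ab(1)] orbit_eq_iff by blast
    then show False using ab ST by auto
  qed
  moreover have "openin Q ?U" "openin Q ?V" using f ST openin_Q_image by blast+
  ultimately show ?thesis using x y ST by (intro exI[of _ ?U] exI[of _ ?V]) auto
qed

lemma mu_open: "open T \<Longrightarrow> openin Ztop {x \<in> Z. mu x k \<in> T}"
proof -
  assume T: "open T"
  define G where "G w = lam k + (1 / 2) *\<^sub>R hopf (\<Lambda> k + l2H_apply w k)" for w
  have "smooth_family UNIV {()} (\<lambda>_ w. hopf (\<Lambda> k + l2H_apply w k))"
    by (intro smooth_family_hopf smooth_family_add smooth_family_const[OF open_UNIV, where C = "norm
        (\<Lambda> k)"]
        order_refl smooth_family_linear_maps[OF open_UNIV, where C = 1])
      (simp_all add: norm_l2H_apply_le bounded_linear.linear[OF bounded_linear_l2H_apply])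
  from smooth_family_imp_continuous_on[OF this]
  have "continuous_on UNIV G" unfolding G_def[abs_def]
    by (intro continuous_on_add continuous_on_const continuous_on_scaleR) simp
  then have "open (G -` T)" using T by (simp add: open_vimage)
  moreover have "{x \<in> Z. mu x k \<in> T} = {x \<in> Z. coord \<Lambda> x \<in> G -` T}"
    using zero_level_M_aff by (auto simp: G_def mu_def l2H_apply_coord)
  ultimately show ?thesis unfolding openin_Ztop by blast
qed

end

section \<open>The chart at a base point\<close>

context hk_chart
begin

text \<open>\<open>Phi_smooth\<close> with the inverse of the global chart as parametrisation. The
  gauge exists off the zero level too, which provides the extension to an open set of the Hilbert
  space.\<close>

lemma Phi_local:
  assumes x: "x \<in> gdom"
  obtains U F where "open U" "coord \<Lambda> x \<in> U" "smooth_family U {()} (\<lambda>_. F)"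
    "\<And>y. y \<in> Z \<Longrightarrow> coord \<Lambda> y \<in> U \<Longrightarrow> y \<in> gdom \<and> Phi y = F (coord \<Lambda> y)"
proof -
  have xM: "x \<in> M_aff \<Lambda>" using x zero_level_M_aff by (auto simp: gdom_def)
  have sf: "smooth_family UNIV {()} (\<lambda>_ w. coord \<Lambda> (of_coord \<Lambda> w))"
    unfolding coord_of_coord by (rule smooth_family_linear_maps[of _ _ _ 1]) (auto simp: linear_iff)
  obtain U F where U: "open U" "coord \<Lambda> x \<in> U" "smooth_family U {()} (\<lambda>_. F)"
    "\<And>w k. w \<in> U \<Longrightarrow> k \<notin> K \<Longrightarrow> herm (of_coord \<Lambda> w k) (x0 k) \<noteq> 0"
    "\<And>w. w \<in> U \<Longrightarrow> F w = Phi (of_coord \<Lambda> w)"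
  proof (rule Phi_smooth[OF of_coord_M_aff sf UNIV_I])
    show "herm (of_coord \<Lambda> (coord \<Lambda> x) k) (x0 k) \<noteq> 0" if "k \<notin> K" for k
      using x that by (simp add: of_coord_coord[OF xM] gdom_def)
  qed (rule that)
  show ?thesis
  proof (rule that[OF U(1-3)])
    fix y assume y: "y \<in> Z" "coord \<Lambda> y \<in> U"
    have "of_coord \<Lambda> (coord \<Lambda> y) = y" using y(1) zero_level_M_aff of_coord_coord by blast
    then show "y \<in> gdom \<and> Phi y = F (coord \<Lambda> y)" using U(4,5)[OF y(2)] y(1) by (simp add: gdom_def)
  qed
qed

lemma gdom_open:
  assumes "open T"
  shows "openin Ztop {x \<in> gdom. Phi x \<in> T}"
proof (rule openin_ZtopI)
  show "{x \<in> gdom. Phi x \<in> T} \<subseteq> Z" by (auto simp: gdom_def)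
  fix x assume x: "x \<in> {x \<in> gdom. Phi x \<in> T}"
  obtain U F where U: "open U" "coord \<Lambda> x \<in> U" "smooth_family U {()} (\<lambda>_. F)"
    "\<And>y. y \<in> Z \<Longrightarrow> coord \<Lambda> y \<in> U \<Longrightarrow> y \<in> gdom \<and> Phi y = F (coord \<Lambda> y)"
    using Phi_local[of x] x by blast
  have "open (U \<inter> F -` T)"
    by (rule continuous_open_preimage[OF _ U(1) assms]) (use smooth_family_imp_continuous_on[OF
        U(3)] in simp)
  moreover have "x \<in> Z" using x by (simp add: gdom_def)
  ultimately show "\<exists>T'. open T' \<and> coord \<Lambda> x \<in> T' \<and> {y \<in> Z. coord \<Lambda> y \<in> T'} \<subseteq> {x \<in> gdom. Phi x \<in> T}"
    using U x by (intro exI[of _ "U \<inter> F -` T"]) auto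
qed

definition cdom :: "('k \<Rightarrow> quat) set" where
  "cdom = {x \<in> gdom. Phi x \<in> W}"

definition chart_set :: "('k \<Rightarrow> quat) set set" where
  "chart_set = Orb ` cdom"

definition chart_map :: "('k \<Rightarrow> quat) set \<Rightarrow> quat ^ 'n" where
  "chart_map O' = Phi (SOME x. x \<in> O')"

lemma chart_map_Orb: "chart_map (Orb x) = Phi x"
proof -
  have "(SOME y. y \<in> Orb x) \<in> Orb x" by (rule someI[of _ x]) (rule orbit_refl)
  then show ?thesis unfolding chart_map_def by (rule Phi_orbit)
qed

lemma Orb_in_chart_set: "Orb x \<in> chart_set \<longleftrightarrow> x \<in> cdom"
proof
  assume "Orb x \<in> chart_set"
  then obtain y where y: "y \<in> cdom" "Orb x = Orb y" by (auto simp: chart_set_def)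
  then have "x \<in> Orb y" using orbit_refl[of x] by simp
  then show "x \<in> cdom" using y(1) gdom_orbit Phi_orbit by (simp add: cdom_def)
qed (simp add: chart_set_def)

lemma Sec_cdom: "q \<in> W \<Longrightarrow> Sec q \<in> cdom"
  by (simp add: cdom_def Sec_gdom Phi_Sec)

lemma chart_map_image: "chart_map ` chart_set = W"
proof
  show "chart_map ` chart_set \<subseteq> W" by (auto simp: chart_set_def chart_map_Orb cdom_def)
  show "W \<subseteq> chart_map ` chart_set"
  proof
    fix q assume "q \<in> W"
    then show "q \<in> chart_map ` chart_set"
      by (intro image_eqI[of _ _ "Orb (Sec q)"]) (simp_all add: chart_map_Orb Phi_Sec
          Orb_in_chart_set Sec_cdom)
  qed
qed

lemma Orb_Sec_chart_map: "P \<in> chart_set \<Longrightarrow> Orb (Sec (chart_map P)) = P"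
proof -
  assume "P \<in> chart_set"
  then obtain x where x: "x \<in> gdom" "Phi x \<in> W" "P = Orb x" by (auto simp: chart_set_def cdom_def)
  have "Orb x = Orb (Sec (Phi x))" unfolding orbit_eq_iff by (rule Sec_Phi[OF x(1,2)])
  then show ?thesis unfolding x(3) chart_map_Orb by (rule sym)
qed

lemma chart_map_Orb_Sec: "q \<in> W \<Longrightarrow> chart_map (Orb (Sec q)) = q"
  by (simp add: chart_map_Orb Phi_Sec)

lemma inj_chart_map: "inj_on chart_map chart_set"
  by (rule inj_on_inverseI) (rule Orb_Sec_chart_map)

lemma inv_chart_map: "q \<in> W \<Longrightarrow> inv_into chart_set chart_map q = Orb (Sec q)"
  using inv_into_f_f[OF inj_chart_map, of "Orb (Sec q)"] by (simp add: chart_map_Orb_Sec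
      Orb_in_chart_set Sec_cdom)

lemma chart_set_open: "openin Q chart_set"
  unfolding chart_set_def cdom_def by (intro openin_Q_image gdom_open open_W)

lemma homeomorphic_chart_map: "homeomorphic_map (subtopology Q chart_set) (top_of_set W) chart_map"
proof -
  have ts: "topspace (subtopology Q chart_set) = chart_set"
    using openin_subset[OF chart_set_open] by (simp add: inf_absorb2)
  have "homeomorphic_maps (subtopology Q chart_set) (top_of_set W) chart_map (\<lambda>q. Orb (Sec q))"
    unfolding homeomorphic_maps_def
  proof (intro conjI ballI)
    show "continuous_map (subtopology Q chart_set) (top_of_set W) chart_map"
      unfolding continuous_map_in_subtopology ts
    proof
      show "chart_map \<in> chart_set \<rightarrow> W" using chart_map_image by blast
      show "continuous_map (subtopology Q chart_set) euclidean chart_map"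
        unfolding continuous_map_def ts
      proof (intro conjI allI impI)
        fix T :: "(quat ^ 'n) set" assume "openin euclidean T"
        then have T: "open (T \<inter> W)" using open_W by (simp add: open_Int)
        have "{P \<in> chart_set. chart_map P \<in> T} = Orb ` {x \<in> gdom. Phi x \<in> T \<inter> W}"
          by (auto simp: chart_set_def chart_map_Orb cdom_def)
        then have "openin Q {P \<in> chart_set. chart_map P \<in> T}"
          using openin_Q_image[OF gdom_open[OF T]] by simp
        then show "openin (subtopology Q chart_set) {P \<in> chart_set. chart_map P \<in> T}"
          unfolding openin_open_subtopology[OF chart_set_open] by blast
      qed auto
    qed
    show "continuous_map (top_of_set W) (subtopology Q chart_set) (\<lambda>q. Orb (Sec q))"
      unfolding continuous_map_in_subtopology
    proof
      show "(\<lambda>q. Orb (Sec q)) \<in> topspace (top_of_set W) \<rightarrow> chart_set"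
        by (auto simp: Orb_in_chart_set Sec_cdom)
      have "continuous_map (top_of_set W) Ztop Sec"
        unfolding continuous_map_def topspace_Ztop
      proof (intro conjI allI impI)
        show "Sec \<in> topspace (top_of_set W) \<rightarrow> Z" by (auto simp: Sec_zero_level)
        fix X assume "openin Ztop X"
        then obtain T where T: "open T" "X = {x \<in> Z. coord \<Lambda> x \<in> T}" unfolding openin_Ztop by blast
        have "open (W \<inter> (\<lambda>q. coord \<Lambda> (Sec q)) -` T)"
          by (rule continuous_open_preimage[OF _ open_W T(1)]) (use
              smooth_family_imp_continuous_on[OF smooth_Sec] in simp)
        moreover have "{q \<in> W. Sec q \<in> X} = W \<inter> (\<lambda>q. coord \<Lambda> (Sec q)) -` T"
          by (auto simp: T(2) Sec_zero_level)
        ultimately show "openin (top_of_set W) {q \<in> topspace (top_of_set W). Sec q \<in> X}"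
          unfolding openin_open_eq[OF open_W] by simp
      qed
      from continuous_map_compose[OF this quotient_imp_continuous_map[OF quotient_map_Orb]]
      show "continuous_map (top_of_set W) Q (\<lambda>q. Orb (Sec q))" by (simp add: o_def)
    qed
  qed (use ts Orb_Sec_chart_map chart_map_Orb_Sec in auto)
  then show ?thesis unfolding homeomorphic_map_maps by blast
qed

lemma smooth_on_M_chart: "smooth_on_M \<Lambda> {z \<in> Z. Orb z \<in> chart_set} (chart_map \<circ> Orb)"
  unfolding smooth_on_M_def
proof
  fix y assume "y \<in> {z \<in> Z. Orb z \<in> chart_set}"
  then have "y \<in> gdom" by (simp add: Orb_in_chart_set cdom_def)
  then obtain U F where U: "open U" "coord \<Lambda> y \<in> U" "smooth_family U {()} (\<lambda>_. F)"
    "\<And>y. y \<in> Z \<Longrightarrow> coord \<Lambda> y \<in> U \<Longrightarrow> y \<in> gdom \<and> Phi y = F (coord \<Lambda> y)"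
    by (rule Phi_local) (rule that)
  then show "\<exists>\<Omega> F. open \<Omega> \<and> coord \<Lambda> y \<in> \<Omega> \<and> smooth_on \<Omega> F \<and>
     (\<forall>x\<in>{z \<in> Z. Orb z \<in> chart_set}. coord \<Lambda> x \<in> \<Omega> \<longrightarrow> (chart_map \<circ> Orb) x = F (coord \<Lambda> x))"
    by (intro exI[of _ U] exI[of _ F] conjI ballI impI smooth_onI_family) (auto simp: chart_map_Orb)
qed

text \<open>\<open>Sec\<close> meets the orbit of \<open>z\<close> but perhaps not \<open>z\<close>;
  a fixed group element moves it there, and acts smoothly.\<close>

lemma smooth_section:
  assumes z: "z \<in> Z" "Orb z \<in> chart_set"
  shows "\<exists>W s. open W \<and> chart_map (Orb z) \<in> W \<and> W \<subseteq> chart_map ` chart_set \<and>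
        s (chart_map (Orb z)) = z \<and>
        (\<forall>w\<in>W. s w \<in> Z \<and> Orb (s w) \<in> chart_set \<and> chart_map (Orb (s w)) = w) \<and>
        smooth_on W (coord \<Lambda> \<circ> s)"
proof -
  have zc: "z \<in> gdom" "Phi z \<in> W" using z(2) by (auto simp: Orb_in_chart_set cdom_def)
  have "z \<in> Orb (Sec (Phi z))" using Sec_Phi[OF zc] by (rule orbit_sym)
  then obtain t where t: "t \<in> n_lattice" "z = act (exp_t t) (Sec (Phi z))" unfolding orbit_iff by
      blast
  have ta: "t \<in> t_alg lam" using t by (simp add: n_lattice_def)
  define s where "s w = act (exp_t t) (Sec w)" for w
  have so: "s w \<in> Orb (Sec w)" for w unfolding s_def orbit_iff using t(1) by blast
  have "smooth_family W {()} (\<lambda>_ w. l2H_diag (\<lambda>k q. qcomplex (exp_t t k) \<odot> q) (coord \<Lambda> (Sec w)) +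
      coord \<Lambda> (act (exp_t t) \<Lambda>))"
    by (intro smooth_family_add smooth_family_bounded_linear[OF bounded_linear_act(1)[OF
        norm_exp_t]] smooth_Sec
        smooth_family_const[OF open_W, where C = "norm (coord \<Lambda> (act (exp_t t) \<Lambda>))"] order_refl)
  then have "smooth_family W {()} (\<lambda>_. coord \<Lambda> \<circ> s)"
    by (rule smooth_family_cong) (simp add: s_def coord_act[OF ta Sec_M_aff])
  then have sm: "smooth_on W (coord \<Lambda> \<circ> s)" by (rule smooth_onI_family)
  have "s w \<in> Z \<and> Orb (s w) \<in> chart_set \<and> chart_map (Orb (s w)) = w" if w: "w \<in> W" for w
  proof -
    have "Orb (s w) = Orb (Sec w)" using so[of w] orbit_eq_iff by blast
    then show ?thesis
      using zero_level_orbit[OF so Sec_zero_level[OF w]] w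
      by (simp add: chart_map_Orb_Sec Orb_in_chart_set Sec_cdom)
  qed
  moreover have "s (chart_map (Orb z)) = z" using t(2) by (simp add: s_def chart_map_Orb)
  ultimately show ?thesis
    using sm zc(2) open_W
    by (intro exI[of _ W] exI[of _ s] conjI) (simp_all add: chart_map_image chart_map_Orb)
qed

text \<open>The points of \<open>Z\<close> with the same moment values as \<open>x0\<close> all lie in \<open>gdom\<close>, although they may
  lie outside the smaller chart domain \<open>cdom\<close>.\<close>

lemma separate_same_mu:
  assumes y: "y \<in> Z" and m: "mu y = mu x0" and ne: "Orb x0 \<noteq> Orb y"
  shows "\<exists>U V. openin Q U \<and> openin Q V \<and> Orb x0 \<in> U \<and> Orb y \<in> V \<and> disjnt U V"
proof (rule separate_orbits[where D = gdom and f = Phi])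
  show x: "x0 \<in> gdom" and yg: "y \<in> gdom" using same_mu_gdom x0 y m by auto
  show "Phi x0 \<noteq> Phi y" using Phi_inj[OF x yg] ne orbit_eq_iff by blast
qed (use gdom_open Phi_orbit in auto)

end

text \<open>In coordinates the transition is the gauge map of the second chart along the section of
  the first, so \<open>Phi_smooth\<close> applies with \<open>Sec\<close> as
  parametrisation.\<close>

lemma (in hk_chart) smooth_transition:
  assumes c1: "hk_chart u lam \<Lambda> \<beta> x1 \<kappa>1 C1"
  shows "smooth_on (chart_map ` (chart_set \<inter> hk_chart.chart_set u lam \<Lambda> \<beta> x1 \<kappa>1 C1))
    (hk_chart.chart_map lam \<beta> x1 \<kappa>1 \<circ> inv_into chart_set chart_map)"
proof -
  interpret c1: hk_chart u lam \<Lambda> \<beta> x1 \<kappa>1 C1 by (rule c1)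
  have img: "chart_map ` (chart_set \<inter> c1.chart_set) = {q \<in> W. Sec q \<in> c1.cdom}"
  proof (intro subset_antisym subsetI)
    fix q assume "q \<in> chart_map ` (chart_set \<inter> c1.chart_set)"
    then obtain P where P: "P \<in> chart_set" "P \<in> c1.chart_set" "q = chart_map P" by blast
    have "Orb (Sec q) \<in> c1.chart_set" using P Orb_Sec_chart_map by simp
    moreover have "q \<in> W" using P chart_map_image by blast
    ultimately show "q \<in> {q \<in> W. Sec q \<in> c1.cdom}" using c1.Orb_in_chart_set by simp
  next
    fix q assume "q \<in> {q \<in> W. Sec q \<in> c1.cdom}"
    then show "q \<in> chart_map ` (chart_set \<inter> c1.chart_set)"
      by (intro image_eqI[of _ _ "Orb (Sec q)"])
        (simp_all add: chart_map_Orb_Sec Orb_in_chart_set Sec_cdom c1.Orb_in_chart_set)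
  qed
  show ?thesis unfolding img
  proof (rule smooth_onI)
    fix q assume "q \<in> {q \<in> W. Sec q \<in> c1.cdom}"
    then have q: "q \<in> W" "Sec q \<in> c1.gdom" "c1.Phi (Sec q) \<in> c1.W" by (auto simp: c1.cdom_def)
    obtain U F where U: "open U" "q \<in> U" "U \<subseteq> W" "smooth_family U {()} (\<lambda>_. F)"
      "\<And>x k. x \<in> U \<Longrightarrow> k \<notin> c1.K \<Longrightarrow> herm (Sec x k) (x1 k) \<noteq> 0" "\<And>x. x \<in> U \<Longrightarrow> F x = c1.Phi (Sec x)"
    proof (rule c1.Phi_smooth[OF Sec_M_aff smooth_Sec q(1)])
      show "herm (Sec q k) (x1 k) \<noteq> 0" if "k \<notin> c1.K" for k using q(2) that by (simp add:
          c1.gdom_def)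
    qed (assumption, rule that)
    \<comment> \<open>On \<open>U\<close> the points \<open>Sec x\<close> already lie in
      \<open>c1.gdom\<close>; the intersection keeps their coordinates in the image of the second
      chart.\<close>
    define U' where "U' = U \<inter> F -` c1.W"
    have U'o: "open U'" unfolding U'_def
      by (rule continuous_open_preimage[OF _ U(1) c1.open_W])
        (use smooth_family_imp_continuous_on[OF U(4)] in simp)
    have "smooth_family U' {()} (\<lambda>_. c1.chart_map \<circ> inv_into chart_set chart_map)"
    proof (rule smooth_family_cong[OF smooth_family_shrink[OF U(4) U'o]])
      show "U' \<subseteq> U" by (simp add: U'_def)
      fix x assume "x \<in> U'"
      then have x: "x \<in> U" "x \<in> W" using U(3) by (auto simp: U'_def)
      show "(c1.chart_map \<circ> inv_into chart_set chart_map) x = F x"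
        by (simp add: inv_chart_map[OF x(2)] c1.chart_map_Orb U(6)[OF x(1)])
    qed
    moreover have "q \<in> U'" using q(3) U(2) U(6)[OF U(2)] by (simp add: U'_def)
    moreover have "U' \<subseteq> {q \<in> W. Sec q \<in> c1.cdom}"
    proof
      fix x assume "x \<in> U'"
      then have x: "x \<in> U" "F x \<in> c1.W" "x \<in> W" using U(3) by (auto simp: U'_def)
      have "Sec x \<in> c1.gdom" using U(5)[OF x(1)] Sec_zero_level[OF x(3)] by (simp add: c1.gdom_def)
      then show "x \<in> {q \<in> W. Sec q \<in> c1.cdom}" using x U(6)[OF x(1)] by (simp add: c1.cdom_def)
    qed
    ultimately show "\<exists>U'. q \<in> U' \<and> U' \<subseteq> {q \<in> W. Sec q \<in> c1.cdom} \<and>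
        smooth_family U' {()} (\<lambda>_. c1.chart_map \<circ> inv_into chart_set chart_map)" by blast
  qed
qed

section \<open>The atlas and the smooth projection\<close>

context hk_setting
begin

definition hk_atlas :: "(('k \<Rightarrow> quat) set set \<times> (('k \<Rightarrow> quat) set \<Rightarrow> quat ^ 'n)) set" where
  "hk_atlas = {(hk_chart.chart_set u lam \<Lambda> \<beta> x0 \<kappa> C, hk_chart.chart_map lam \<beta> x0 \<kappa>) |x0 \<kappa> C.
     hk_chart u lam \<Lambda> \<beta> x0 \<kappa> C}"

lemma hk_atlasE:
  assumes "(U, \<phi>) \<in> hk_atlas"
  obtains x0 \<kappa> C where "hk_chart u lam \<Lambda> \<beta> x0 \<kappa> C"
    "U = hk_chart.chart_set u lam \<Lambda> \<beta> x0 \<kappa> C" "\<phi> = hk_chart.chart_map lam \<beta> x0 \<kappa>"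
  using assms unfolding hk_atlas_def by blast

lemma exists_chart:
  assumes x: "x \<in> Z"
  obtains \<kappa> C where "hk_chart u lam \<Lambda> \<beta> x \<kappa> C"
proof -
  obtain \<kappa> C where "frame \<kappa> C" "{k. x k = 0} \<subseteq> range \<kappa>"
    using x by (rule exists_frame_zeros) (rule that)
  with x have "hk_chart u lam \<Lambda> \<beta> x \<kappa> C" by unfold_locales
  then show ?thesis by (rule that)
qed

lemma Hausdorff_Q: "Hausdorff_space Q"
  unfolding Hausdorff_space_def topspace_Q
proof (intro allI impI)
  fix P P' assume "P \<in> Orb ` Z \<and> P' \<in> Orb ` Z \<and> P \<noteq> P'"
  then obtain x y where xy: "x \<in> Z" "y \<in> Z" "P = Orb x" "P' = Orb y" "Orb x \<noteq> Orb y" by blast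
  show "\<exists>U V. openin Q U \<and> openin Q V \<and> P \<in> U \<and> P' \<in> V \<and> disjnt U V"
  proof (cases "mu x = mu y")
    case True
    obtain \<kappa> C where "hk_chart u lam \<Lambda> \<beta> x \<kappa> C" using xy(1) by (rule exists_chart)
    then interpret hk_chart u lam \<Lambda> \<beta> x \<kappa> C .
    show ?thesis using separate_same_mu[OF xy(2) _ xy(5)] True xy(3,4) by simp
  next
    case False
    then obtain k where "mu x k \<noteq> mu y k" by blast
    from separate_orbits[of Z "\<lambda>x. mu x k", OF mu_open _ xy(1,2) this]
    show ?thesis using mu_orbit xy(3,4) by simp
  qed
qed

lemma smooth_atlas_hk: "smooth_atlas Q hk_atlas"
  unfolding smooth_atlas_def
proof (intro conjI)
  show "\<Union> (fst ` hk_atlas) = topspace Q"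
  proof (intro subset_antisym subsetI)
    fix P assume "P \<in> \<Union> (fst ` hk_atlas)"
    then obtain U \<phi> where U: "(U, \<phi>) \<in> hk_atlas" "P \<in> U" by auto
    obtain x0 \<kappa> C where c: "hk_chart u lam \<Lambda> \<beta> x0 \<kappa> C"
      "U = hk_chart.chart_set u lam \<Lambda> \<beta> x0 \<kappa> C" "\<phi> = hk_chart.chart_map lam \<beta> x0 \<kappa>"
      using U(1) by (rule hk_atlasE)
    interpret hk_chart u lam \<Lambda> \<beta> x0 \<kappa> C by (rule c(1))
    show "P \<in> topspace Q" using openin_subset[OF chart_set_open] U(2) c(2) by blast
  next
    fix P assume "P \<in> topspace Q"
    then obtain x where x: "x \<in> Z" "P = Orb x" unfolding topspace_Q by blast
    obtain \<kappa> C where c: "hk_chart u lam \<Lambda> \<beta> x \<kappa> C" using x(1) by (rule exists_chart)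
    interpret hk_chart u lam \<Lambda> \<beta> x \<kappa> C by (rule c)
    \<comment> \<open>Every point lies in the domain of the chart based at it, so these charts cover
      the quotient.\<close>
    have "x \<in> cdom" using same_mu_gdom[OF x(1) refl] Phi_x0_W by (simp add: cdom_def)
    then have "P \<in> chart_set" unfolding x(2) Orb_in_chart_set .
    moreover have "(chart_set, chart_map) \<in> hk_atlas" unfolding hk_atlas_def using c by blast
    ultimately show "P \<in> \<Union> (fst ` hk_atlas)" by force
  qed
  show "\<forall>(U, \<phi>)\<in>hk_atlas. openin Q U \<and> open (\<phi> ` U) \<and>
        homeomorphic_map (subtopology Q U) (top_of_set (\<phi> ` U)) \<phi>"
  proof clarify
    fix U \<phi> assume "(U, \<phi>) \<in> hk_atlas"
    then obtain x0 \<kappa> C where c: "hk_chart u lam \<Lambda> \<beta> x0 \<kappa> C"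
      "U = hk_chart.chart_set u lam \<Lambda> \<beta> x0 \<kappa> C" "\<phi> = hk_chart.chart_map lam \<beta> x0 \<kappa>"
      by (rule hk_atlasE)
    interpret hk_chart u lam \<Lambda> \<beta> x0 \<kappa> C by (rule c(1))
    show "openin Q U \<and> open (\<phi> ` U) \<and> homeomorphic_map (subtopology Q U) (top_of_set (\<phi> ` U)) \<phi>"
      unfolding c(2,3) chart_map_image using chart_set_open open_W homeomorphic_chart_map by blast
  qed
  show "\<forall>(U, \<phi>)\<in>hk_atlas. \<forall>(V, \<psi>)\<in>hk_atlas. smooth_on (\<phi> ` (U \<inter> V)) (\<psi> \<circ> inv_into U \<phi>)"
  proof clarify
    fix U \<phi> V \<psi> assume U: "(U, \<phi>) \<in> hk_atlas" and V: "(V, \<psi>) \<in> hk_atlas"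
    obtain x0 \<kappa> C where c: "hk_chart u lam \<Lambda> \<beta> x0 \<kappa> C"
      "U = hk_chart.chart_set u lam \<Lambda> \<beta> x0 \<kappa> C" "\<phi> = hk_chart.chart_map lam \<beta> x0 \<kappa>"
      using U by (rule hk_atlasE)
    obtain x1 \<kappa>1 C1 where c1: "hk_chart u lam \<Lambda> \<beta> x1 \<kappa>1 C1"
      "V = hk_chart.chart_set u lam \<Lambda> \<beta> x1 \<kappa>1 C1" "\<psi> = hk_chart.chart_map lam \<beta> x1 \<kappa>1"
      using V by (rule hk_atlasE)
    interpret hk_chart u lam \<Lambda> \<beta> x0 \<kappa> C by (rule c(1))
    show "smooth_on (\<phi> ` (U \<inter> V)) (\<psi> \<circ> inv_into U \<phi>)"
      unfolding c(2,3) c1(2,3) by (rule smooth_transition[OF c1(1)])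
  qed
qed

lemma smooth_submersion_hk: "smooth_submersion_onto \<Lambda> Z Orb hk_atlas"
  unfolding smooth_submersion_onto_def
proof clarify
  fix U \<phi> assume "(U, \<phi>) \<in> hk_atlas"
  then obtain x0 \<kappa> C where c: "hk_chart u lam \<Lambda> \<beta> x0 \<kappa> C"
    "U = hk_chart.chart_set u lam \<Lambda> \<beta> x0 \<kappa> C" "\<phi> = hk_chart.chart_map lam \<beta> x0 \<kappa>"
    by (rule hk_atlasE)
  interpret hk_chart u lam \<Lambda> \<beta> x0 \<kappa> C by (rule c(1))
  show "smooth_on_M \<Lambda> {z \<in> Z. Orb z \<in> U} (\<phi> \<circ> Orb) \<and>
     (\<forall>z\<in>Z. Orb z \<in> U \<longrightarrow> (\<exists>W s. open W \<and> \<phi> (Orb z) \<in> W \<and> W \<subseteq> \<phi> ` U \<and>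
        s (\<phi> (Orb z)) = z \<and>
        (\<forall>w\<in>W. s w \<in> Z \<and> Orb (s w) \<in> U \<and> \<phi> (Orb (s w)) = w) \<and>
        smooth_on W (coord \<Lambda> \<circ> s)))"
    unfolding c(2,3) by (intro conjI ballI impI smooth_on_M_chart smooth_section)
qed

end

theorem theorem6:
  fixes u :: "'k::countable \<Rightarrow> int ^ 'n"
    and lam \<Lambda> :: "'k \<Rightarrow> quat"
    and \<beta> :: "('k \<Rightarrow> real) \<Rightarrow> real ^ 'n"
  assumes u_primitive: "\<And>k. primitive (u k)"
    and u_span: "span (range (\<lambda>k. real_vec (u k))) = UNIV"
    and lambda_Im: "\<And>k. lam k \<in> ImH"
    and lambda_growth:
      "(\<lambda>k. inverse (1 + norm (lam k) / norm (real_vec (u k)))) summable_on UNIV"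
    and flats_distinct: "inj (flat u lam)"
    and Lambda: "\<And>k. lam k = - (1/2) *\<^sub>R (qcnj (\<Lambda> k) \<odot> qi \<odot> \<Lambda> k)"
    and beta_continuous_linear: "continuous_linear_t lam \<beta>"
    and beta_u: "\<And>k. \<beta> (e_vec k) = real_vec (u k)"
    and a: "\<And>F. F \<subseteq> range (flat u lam) \<Longrightarrow> card F = CARD('n) + 1 \<Longrightarrow> \<Inter> F = {}"
    and b: "\<And>K. card K = CARD('n) \<Longrightarrow> \<Inter> (flat u lam ` K) \<noteq> {} \<Longrightarrow> Z_basis_family u K"
  shows "hk_quotient_smooth \<Lambda> lam \<beta>"
proof -
  interpret hk_setting u lam \<Lambda> \<beta>
    by (unfold_locales; fact assms)
  show ?thesis
    unfolding hk_quotient_smooth_def smooth_manifold_def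
    using Hausdorff_Q second_countable_Q smooth_atlas_hk smooth_submersion_hk by blast
qed

end
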